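(* Let $P_n(z)=\sum_{j=0}^n\eta_j\varphi_j(z)$, where $\{\eta_j\}$ are complex-valued i.i.d. standard Gaussian random variables and $\{\varphi_j\}$ are orthonormal polynomials on the unit circle $\mathbb{T}$ with respect to a probability Borel measure $\mu$, such that their recurrence coefficients satisfy $\{\alpha_j\}\subset(-1,1)$ and $\alpha_j\to0$ as $j\to\infty$. Let $S$ be a compact subset of $\mathbb{T}\setminus\{\pm1\}$. Assume, in addition, that $\mu$ is absolutely continuous with respect to the arclength measure on an open set containing $S$ and that its Radon–Nikodym derivative is positive and continuous at each point of $S$. Then for any $-\infty<\tau_1<\tau_2<\infty$, $$\lim_{n\rightarrow \infty}\frac1n\, \mathbb{E}\big[N_n\big(\Omega(S,\tau_1,\tau_2)\big)\big] = \frac{|S|}{2\pi}\left(\frac{H'(\tau_2)}{H(\tau_2)}-\frac{H'(\tau_1)}{H(\tau_1)}\right),$$ where $$\Omega(S,\tau_1,\tau_2) := \Big\{ rz:\ z\in S,\ r\in\big(1+\tfrac{\tau_1}{2n},\,1+\tfrac{\tau_2}{2n}\big) \Big\},\qquad H(\tau) := \frac{e^\tau-1}{\tau}\quad(H(0)=1),$$ $N_n(\Omega)$ denotes the number of zeros of $P_n$ in $\Omega$ counted with multiplicity, and $|S|$ is the arclength measure of $S$.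
   Context: A complex-valued standard Gaussian random variable here is $\eta=\alpha+i\beta$ with $\alpha,\beta$ independent standard real Gaussians (all independent across $j$). Orthonormal polynomials on the unit circle (OPUC): $\mu$ is a probability Borel measure on $\mathbb{T}=\{|z|=1\}$ with infinite support; $\varphi_j$ has degree $j$ and positive leading coefficient, and $\int_{\mathbb{T}}\varphi_m\overline{\varphi_k}\,d\mu=\delta_{mk}$ for all $m,k\ge0$. They satisfy $\varphi_{n+1}(z)=\dfrac{z\varphi_n(z)-\overline{\alpha_n}\,\varphi_n^*(z)}{\sqrt{1-|\alpha_n|^2}}$, $n\ge0$, where $\varphi_n^*(z)=z^n\overline{\varphi_n(1/\bar z)}$ and the recurrence coefficients $\alpha_n$ lie in the open unit disk. When all $\alpha_n\in(-1,1)$ the $\varphi_n$ have real coefficients and $\mu$ is invariant under complex conjugation. The set $\Omega(S,\tau_1,\tau_2)$ depends on $n$, and in $\mathbb{E}[N_n(\Omega(S,\tau_1,\tau_2))]$ it is taken with the same $n$ as $P_n$. *)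

theory Defs
  imports "HOL-Probability.Probability" "HOL-Computational_Algebra.Polynomial"
begin

abbreviation unit_circle :: "complex set" where
  "unit_circle \<equiv> sphere 0 1"

(* Measures on the circle are Borel measures on the complex plane concentrated on unit_circle.
   The arclength measure has total mass 2 * pi. *)
definition arclength :: "complex measure" where
  "arclength = distr (restrict_space lborel {-pi<..pi}) borel cis"

definition measure_support :: "'a::topological_space measure \<Rightarrow> 'a set" where
  "measure_support \<mu> = {x. \<forall>U. open U \<and> x \<in> U \<longrightarrow> emeasure \<mu> U > 0}"

definition circle_prob_measure :: "complex measure \<Rightarrow> bool" where
  "circle_prob_measure \<mu> \<longleftrightarrow>
     prob_space \<mu> \<and> sets \<mu> = sets borel \<and> (AE z in \<mu>. z \<in> unit_circle) \<and>
     infinite (measure_support \<mu>)"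

definition opuc :: "complex measure \<Rightarrow> (nat \<Rightarrow> complex poly) \<Rightarrow> bool" where
  "opuc \<mu> \<phi> \<longleftrightarrow>
     (\<forall>j. degree (\<phi> j) = j \<and> (\<exists>c>0. lead_coeff (\<phi> j) = complex_of_real c)) \<and>
     (\<forall>m k. (\<integral>z. poly (\<phi> m) z * cnj (poly (\<phi> k) z) \<partial>\<mu>) = (if m = k then 1 else 0))"

definition reversed_poly :: "nat \<Rightarrow> complex poly \<Rightarrow> complex \<Rightarrow> complex" where
  "reversed_poly n p z = z ^ n * cnj (poly p (1 / cnj z))"

(* The formula for reversed_poly is only meaningful for z \<noteq> 0 (division by zero is 0 here);
   as both sides are polynomials in z, the identity on z \<noteq> 0 determines it everywhere. *)
definition recurrence_coeffs :: "(nat \<Rightarrow> complex poly) \<Rightarrow> (nat \<Rightarrow> complex) \<Rightarrow> bool" where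
  "recurrence_coeffs \<phi> \<alpha> \<longleftrightarrow>
     (\<forall>n. cmod (\<alpha> n) < 1 \<and>
       (\<forall>z. z \<noteq> 0 \<longrightarrow>
         poly (\<phi> (Suc n)) z =
           (z * poly (\<phi> n) z - cnj (\<alpha> n) * reversed_poly n (\<phi> n) z)
             / complex_of_real (sqrt (1 - (cmod (\<alpha> n))\<^sup>2))))"

(* RN_deriv is only determined almost everywhere, so regularity on S is required
   of some version w of it. Continuity at z is relative to the whole circle, not to S. *)
definition ac_pos_cont_density_on :: "complex measure \<Rightarrow> complex set \<Rightarrow> bool" where
  "ac_pos_cont_density_on \<mu> S \<longleftrightarrow>
     (\<exists>U w. open U \<and> S \<subseteq> U \<and>
        absolutely_continuous (restrict_space arclength U) (restrict_space \<mu> U) \<and>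
        (AE z in restrict_space arclength U.
           RN_deriv (restrict_space arclength U) (restrict_space \<mu> U) z = ennreal (w z)) \<and>
        (\<forall>z\<in>S. (w z :: real) > 0 \<and> continuous (at z within unit_circle) w))"

(* Real and imaginary parts both have variance 1, so E|X|^2 = 2. *)
definition complex_std_gaussian :: "'w measure \<Rightarrow> ('w \<Rightarrow> complex) \<Rightarrow> bool" where
  "complex_std_gaussian M X \<longleftrightarrow>
     distributed M lborel (\<lambda>\<omega>. Re (X \<omega>)) std_normal_density \<and>
     distributed M lborel (\<lambda>\<omega>. Im (X \<omega>)) std_normal_density \<and>
     prob_space.indep_var M borel (\<lambda>\<omega>. Re (X \<omega>)) borel (\<lambda>\<omega>. Im (X \<omega>))"

definition iid_complex_std_gaussian :: "'w measure \<Rightarrow> (nat \<Rightarrow> 'w \<Rightarrow> complex) \<Rightarrow> bool" where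
  "iid_complex_std_gaussian M \<eta> \<longleftrightarrow>
     prob_space.indep_vars M (\<lambda>_. borel) \<eta> UNIV \<and> (\<forall>j. complex_std_gaussian M (\<eta> j))"

definition random_poly ::
  "(nat \<Rightarrow> 'w \<Rightarrow> complex) \<Rightarrow> (nat \<Rightarrow> complex poly) \<Rightarrow> nat \<Rightarrow> 'w \<Rightarrow> complex poly" where
  "random_poly \<eta> \<phi> n \<omega> = (\<Sum>j\<le>n. smult (\<eta> j \<omega>) (\<phi> j))"

(* Meaningful for p \<noteq> 0 only. *)
definition zero_count :: "complex poly \<Rightarrow> complex set \<Rightarrow> nat" where
  "zero_count p A = (\<Sum>z\<in>{z \<in> A. poly p z = 0}. order z p)"

definition Omega :: "nat \<Rightarrow> complex set \<Rightarrow> real \<Rightarrow> real \<Rightarrow> complex set" where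
  "Omega n S \<tau>1 \<tau>2 =
     {complex_of_real r * z | r z.
        z \<in> S \<and> r \<in> {1 + \<tau>1 / (2 * real n) <..< 1 + \<tau>2 / (2 * real n)}}"

definition H :: "real \<Rightarrow> real" where
  "H \<tau> = (if \<tau> = 0 then 1 else (exp \<tau> - 1) / \<tau>)"

end

(* Let K_n(z) = sum_{j<=n} |phi_j(z)|^2 and L = ln K_n. Since P_n(z) is centred complex Gaussian with
   E |P_n(z)|^2 = 2 K_n(z), we have E ln |P_n(z)| = L(z) / 2 + const, so the expected zero measure in
   the coordinates z = e^(x + i t) has density (1 / 4 pi) (d_x^2 + d_t^2) L. It remains to find L at
   the scale 1/n. With the peaking polynomials (1 + z cnj z0)^m, m small compared to n, the extremal
   characterisation of K_n allows to compare mu locally with a multiple of arclength; here alpha_n -> 0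
   only enters through the subexponential growth of K_n on the circle. The result is
   W K_n(z0 e^(u/n)) / n -> H(2 Re u), W = 2 pi w(z0), uniformly for z0 in S and bounded complex u. Along lines the
   kernels extend holomorphically, so first and second derivatives converge as well, and n^(-2) times
   the Laplacian of L tends to 4 (ln H)''. *)
theory Submission
  imports Defs "HOL-Complex_Analysis.Complex_Analysis" "HOL-Real_Asymp.Real_Asymp"
    "HOL-Computational_Algebra.Fundamental_Theorem_Algebra"
begin

section \<open>Christoffel functions on the unit circle\<close>

text \<open>Near \<open>S\<close> only the density of the measure is controlled, so no asymptotics
  of a single \<open>\<phi> n\<close> are at hand and \<open>K_n\<close> is never computed. It is
  squeezed between model kernels by one inequality, \<open>kern_comparison\<close>, used with the
  two measures in both orders. The inequality holds off the circle too, where the zeros lie, and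
  involves the diagonal only. Bounds on values say nothing about derivatives; the holomorphic
  extension is there so that Cauchy estimates can supply them. Zeros are reached through test
  functions: \<open>ln |p|\<close> is singular, so its Laplacian is evaluated weakly, with one
  angular mode \<open>Re (c * z ^ k)\<close> times a bump in \<open>x\<close>. This reduces the
  plane to the operator \<open>d_x^2 - k^2\<close> on a line. Approximation then leads, for fixed
  \<open>n\<close>, from such products to the indicator of the region, the number of zeros being at
  most \<open>n\<close>. Only afterwards does \<open>n\<close> grow. With
  \<open>x = s / (2 n)\<close> the edges \<open>1 + \<tau> / (2 n)\<close> tend to
  \<open>s = \<tau>\<close>, and integrating \<open>(ln H)''\<close> between them gives the
  difference of \<open>H' / H\<close>.\<close>

definition kern :: "(nat \<Rightarrow> complex poly) \<Rightarrow> nat \<Rightarrow> complex \<Rightarrow> real" where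
  "kern \<phi> n z = (\<Sum>j\<le>n. (cmod (poly (\<phi> j) z))\<^sup>2)"

lemma kern_nonneg: "0 \<le> kern \<phi> n z"
  by (simp add: kern_def sum_nonneg)

lemma kern_mono: "n \<le> m \<Longrightarrow> kern \<phi> n z \<le> kern \<phi> m z"
  unfolding kern_def by (rule sum_mono2) auto

text \<open>Covers both sides of the comparison: \<open>\<mu>\<close> with its orthonormal
  polynomials, and \<open>arclength\<close>, of mass \<open>2 * pi\<close>, with normalised
  monomials.\<close>

locale circle_system =
  fixes \<nu> :: "complex measure" and \<phi> :: "nat \<Rightarrow> complex poly"
  assumes finite_nu: "finite_measure \<nu>"
    and sets_nu: "sets \<nu> = sets borel"
    and AE_circle: "AE z in \<nu>. z \<in> unit_circle"
    and degree_phi: "degree (\<phi> j) = j"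
    and phi_nz: "\<phi> j \<noteq> 0"
    and orthonormal: "(\<integral>z. poly (\<phi> m) z * cnj (poly (\<phi> k) z) \<partial>\<nu>) = (if m = k then 1 else 0)"
begin

lemma integrable_continuous:
  fixes f :: "complex \<Rightarrow> 'b::{banach, second_countable_topology}"
  assumes "continuous_on UNIV f"
  shows "integrable \<nu> f"
proof -
  have "compact (f ` unit_circle)"
    using assms by (intro compact_continuous_image) (auto intro: continuous_on_subset)
  then obtain B where B: "\<And>z. z \<in> unit_circle \<Longrightarrow> norm (f z) \<le> B"
    by (force simp: bounded_iff dest!: compact_imp_bounded)
  have [measurable]: "f \<in> borel_measurable \<nu>"
    using borel_measurable_continuous_onI[OF assms] sets_nu by (simp cong: measurable_cong_sets)
  show ?thesis
    by (rule finite_measure.integrable_const_bound[OF finite_nu, where B = B])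
       (use AE_circle B in auto)
qed

lemma kern_pos: "0 < kern \<phi> n z"
proof -
  have "poly (\<phi> 0) z \<noteq> 0"
    using degree_phi[of 0] phi_nz[of 0] by (auto elim!: degree_eq_zeroE)
  then have "0 < (cmod (poly (\<phi> 0) z))\<^sup>2" by simp
  also have "\<dots> = kern \<phi> 0 z" by (simp add: kern_def)
  also have "\<dots> \<le> kern \<phi> n z" by (rule kern_mono) simp
  finally show ?thesis .
qed

lemma expansion:
  assumes "degree p \<le> n"
  shows "\<exists>c. p = (\<Sum>j\<le>n. smult (c j) (\<phi> j))"
  using assms
proof (induction n arbitrary: p)
  case 0
  obtain a b where ab: "\<phi> 0 = [:a:]" "p = [:b:]"
    using degree_phi[of 0] 0 by (auto elim!: degree_eq_zeroE)
  then have "a \<noteq> 0" using phi_nz[of 0] by auto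
  then show ?case
    using ab by (intro exI[of _ "\<lambda>_. b / a"]) simp
next
  case (Suc n)
  define a where "a = coeff p (Suc n) / coeff (\<phi> (Suc n)) (Suc n)"
  define p' where "p' = p - smult a (\<phi> (Suc n))"
  have "coeff (\<phi> (Suc n)) (Suc n) \<noteq> 0"
    using degree_phi[of "Suc n"] phi_nz[of "Suc n"] by (metis leading_coeff_neq_0)
  then have c0: "coeff p' (Suc n) = 0" by (simp add: p'_def a_def)
  have "degree p' \<le> Suc n"
    unfolding p'_def using Suc.prems degree_phi[of "Suc n"]
    by (intro degree_diff_le) (auto intro: order.trans[OF degree_smult_le])
  with c0 have "degree p' \<le> n"
    by (metis coeff_0 degree_0 le_SucE le_zero_eq leading_coeff_0_iff not_less_eq_eq zero_le)
  from Suc.IH[OF this] obtain c where c: "p' = (\<Sum>j\<le>n. smult (c j) (\<phi> j))" by blast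
  have "p = (\<Sum>j\<le>Suc n. smult ((c(Suc n := a)) j) (\<phi> j))"
    using c by (simp add: p'_def algebra_simps)
  then show ?case by blast
qed

lemma norm_expansion:
  assumes "p = (\<Sum>j\<le>n. smult (c j) (\<phi> j))"
  shows "(\<integral>z. (cmod (poly p z))\<^sup>2 \<partial>\<nu>) = (\<Sum>j\<le>n. (cmod (c j))\<^sup>2)"
proof -
  have int: "integrable \<nu> (\<lambda>z. c j * cnj (c k) * (poly (\<phi> j) z * cnj (poly (\<phi> k) z)))" for j k
    by (rule integrable_continuous) (intro continuous_intros)
  have "complex_of_real (\<integral>z. (cmod (poly p z))\<^sup>2 \<partial>\<nu>) = (\<integral>z. poly p z * cnj (poly p z) \<partial>\<nu>)"
    by (simp only: complex_norm_square[symmetric] integral_complex_of_real)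
  also have "\<dots> = (\<integral>z. (\<Sum>j\<le>n. \<Sum>k\<le>n. c j * cnj (c k) * (poly (\<phi> j) z * cnj (poly (\<phi> k) z))) \<partial>\<nu>)"
    by (simp add: assms poly_sum sum_product mult_ac)
  also have "\<dots> = (\<Sum>j\<le>n. \<Sum>k\<le>n. c j * cnj (c k) * (\<integral>z. poly (\<phi> j) z * cnj (poly (\<phi> k) z) \<partial>\<nu>))"
    using int by (simp add: Bochner_Integration.integral_sum)
  also have "\<dots> = (\<Sum>j\<le>n. c j * cnj (c j))"
    by (simp add: orthonormal if_distrib cong: if_cong)
  also have "\<dots> = complex_of_real (\<Sum>j\<le>n. (cmod (c j))\<^sup>2)"
    by (simp add: complex_norm_square del: of_real_power)
  finally show ?thesis by (simp only: of_real_eq_iff)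
qed

text \<open>Expansion in the orthonormal system and Cauchy-Schwarz for the coefficients. The
  integral sees only the circle while \<open>z\<close> is any complex number; this is what carries
  estimates off the circle.\<close>

lemma poly_le_kern:
  assumes "degree p \<le> n"
  shows "(cmod (poly p z))\<^sup>2 \<le> kern \<phi> n z * (\<integral>z. (cmod (poly p z))\<^sup>2 \<partial>\<nu>)"
proof -
  obtain c where c: "p = (\<Sum>j\<le>n. smult (c j) (\<phi> j))" using expansion[OF assms] by blast
  have "cmod (poly p z) \<le> (\<Sum>j\<le>n. cmod (c j) * cmod (poly (\<phi> j) z))"
    by (simp add: c poly_sum flip: norm_mult) (rule norm_sum)
  then have "(cmod (poly p z))\<^sup>2 \<le> (\<Sum>j\<le>n. cmod (c j) * cmod (poly (\<phi> j) z))\<^sup>2"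
    by (intro power_mono) auto
  also have "\<dots> \<le> (\<Sum>j\<le>n. (cmod (c j))\<^sup>2) * (\<Sum>j\<le>n. (cmod (poly (\<phi> j) z))\<^sup>2)"
    by (rule Cauchy_Schwarz_ineq_sum)
  finally show ?thesis by (simp add: norm_expansion[OF c] kern_def mult.commute)
qed

text \<open>The witness is the reproducing kernel with its second argument frozen at
  \<open>\<zeta>\<close>; it attains equality in \<open>poly_le_kern\<close> at
  \<open>\<zeta>\<close>.\<close>

lemma extremal_poly:
  obtains p where "degree p \<le> n" "poly p \<zeta> = complex_of_real (kern \<phi> n \<zeta>)"
    "(\<integral>z. (cmod (poly p z))\<^sup>2 \<partial>\<nu>) = kern \<phi> n \<zeta>"
proof
  define p where "p = (\<Sum>j\<le>n. smult (cnj (poly (\<phi> j) \<zeta>)) (\<phi> j))"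
  show "degree p \<le> n"
    unfolding p_def using degree_phi
    by (intro degree_sum_le) (auto intro: order.trans[OF degree_smult_le])
  show "poly p \<zeta> = complex_of_real (kern \<phi> n \<zeta>)"
    by (simp add: p_def poly_sum kern_def complex_norm_square mult.commute del: of_real_power)
  show "(\<integral>z. (cmod (poly p z))\<^sup>2 \<partial>\<nu>) = kern \<phi> n \<zeta>"
    by (subst norm_expansion[OF p_def]) (simp add: kern_def)
qed

end

text \<open>The factor \<open>((1 + z cnj z0) / 2) ^ m\<close> makes polynomials small on the circle away from \<open>z0\<close>,
  at the price of \<open>m\<close> additional degrees.\<close>

definition peak :: "complex \<Rightarrow> complex poly" where
  "peak z0 = [:1 / 2, cnj z0 / 2:]"

text \<open>The parallelogram law for \<open>1\<close> and \<open>z * cnj z0\<close>, both of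
  modulus one.\<close>

lemma peak_circle:
  assumes "z \<in> unit_circle" "z0 \<in> unit_circle"
  shows "(cmod (poly (peak z0) z))\<^sup>2 = 1 - (dist z z0)\<^sup>2 / 4"
proof -
  have "(Re z)\<^sup>2 + (Im z)\<^sup>2 = 1" "(Re z0)\<^sup>2 + (Im z0)\<^sup>2 = 1"
    using assms by (auto simp: cmod_def)
  then show ?thesis
    unfolding dist_norm cmod_power2 peak_def by (simp add: power2_eq_square field_simps) algebra
qed

text \<open>The extremal polynomial of the first measure, multiplied by the peak power, is a trial
  polynomial of degree at most \<open>n + m\<close> for the second. Inside the ball the measures are
  compared; outside, the crude bound \<open>M\<close> is paid for by the decay of the peak.\<close>

lemma kern_comparison:
  assumes s1: "circle_system \<nu>1 \<phi>1" and s2: "circle_system \<nu>2 \<phi>2"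
    and z0: "z0 \<in> unit_circle" and \<delta>: "0 < \<delta>" "\<delta> \<le> 1" and c: "0 \<le> c"
    and le: "\<And>f. f \<in> borel_measurable borel \<Longrightarrow>
       (\<integral>\<^sup>+z. f z * indicator (ball z0 \<delta>) z \<partial>\<nu>2) \<le> ennreal c * (\<integral>\<^sup>+z. f z * indicator (ball z0 \<delta>) z \<partial>\<nu>1)"
    and M: "\<And>z. z \<in> unit_circle \<Longrightarrow> kern \<phi>1 n z \<le> M"
  shows "(cmod (poly (peak z0) \<zeta>))^(2 * m) * kern \<phi>1 n \<zeta> \<le>
     kern \<phi>2 (n + m) \<zeta> * (c + (1 - \<delta>\<^sup>2 / 4)^m * measure \<nu>2 UNIV * M)"
proof -
  interpret s1: circle_system \<nu>1 \<phi>1 by fact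
  interpret s2: circle_system \<nu>2 \<phi>2 by fact
  interpret f2: finite_measure \<nu>2 by (rule s2.finite_nu)
  have [measurable_cong]: "sets \<nu>1 = sets borel" "sets \<nu>2 = sets borel"
    by (fact s1.sets_nu s2.sets_nu)+
  have [measurable]: "ball z0 \<delta> \<in> sets borel" by simp
  have pm[measurable]: "poly p \<in> borel_measurable borel" for p :: "complex poly"
    by (intro borel_measurable_continuous_onI continuous_intros)
  obtain p where p: "degree p \<le> n" "poly p \<zeta> = complex_of_real (kern \<phi>1 n \<zeta>)"
    "(\<integral>z. (cmod (poly p z))\<^sup>2 \<partial>\<nu>1) = kern \<phi>1 n \<zeta>"
    using s1.extremal_poly by blast
  define K where "K = kern \<phi>1 n \<zeta>"
  have K: "0 < K" unfolding K_def by (rule s1.kern_pos)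
  have M0: "0 \<le> M" using M[OF z0] kern_nonneg[of \<phi>1 n z0] by linarith
  define q where "q = peak z0 ^ m * p"
  have "degree (peak z0 ^ m) \<le> degree (peak z0) * m" by (rule degree_power_le)
  also have "\<dots> \<le> 1 * m" by (intro mult_right_mono) (auto simp: peak_def)
  finally have dq: "degree q \<le> n + m"
    using p(1) degree_mult_le[of "peak z0 ^ m" p] unfolding q_def by linarith
  define \<kappa> where "\<kappa> = 1 - \<delta>\<^sup>2 / 4"
  have \<kappa>: "0 \<le> \<kappa>" using \<delta> power_le_one[of \<delta> 2] by (simp add: \<kappa>_def)
  \<comment> \<open>The integral of \<open>|p|^2\<close> is again \<open>K\<close>, so
    \<open>poly_le_kern\<close> for \<open>p\<close> itself bounds it on the whole circle.\<close>
  have pbd: "(cmod (poly p z))\<^sup>2 \<le> M * K" if "z \<in> unit_circle" for z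
    using s1.poly_le_kern[OF p(1), of z] M[OF that] K unfolding p(3) K_def[symmetric]
    by (meson less_eq_real_def mult_right_mono order_trans)
  have near: "(cmod (poly q z))\<^sup>2 \<le> (cmod (poly p z))\<^sup>2" if "z \<in> unit_circle" for z
  proof -
    have "(cmod (poly q z))\<^sup>2 = ((cmod (poly (peak z0) z))\<^sup>2)^m * (cmod (poly p z))\<^sup>2"
      by (simp add: q_def norm_mult norm_power power_mult_distrib power_mult[symmetric] mult.commute)
    moreover have le1: "((cmod (poly (peak z0) z))\<^sup>2)^m \<le> 1"
    proof (rule power_le_one)
      show "(cmod (poly (peak z0) z))\<^sup>2 \<le> 1" unfolding peak_circle[OF that z0] by simp
    qed simp
    have "((cmod (poly (peak z0) z))\<^sup>2)^m * (cmod (poly p z))\<^sup>2 \<le> 1 * (cmod (poly p z))\<^sup>2"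
      using le1 by (rule mult_right_mono) simp
    ultimately show ?thesis by simp
  qed
  have far: "(cmod (poly q z))\<^sup>2 \<le> \<kappa>^m * (M * K)" if "z \<in> unit_circle" "z \<notin> ball z0 \<delta>" for z
  proof -
    have "(cmod (poly q z))\<^sup>2 = ((cmod (poly (peak z0) z))\<^sup>2)^m * (cmod (poly p z))\<^sup>2"
      by (simp add: q_def norm_mult norm_power power_mult_distrib power_mult[symmetric] mult.commute)
    also have "\<dots> \<le> \<kappa>^m * (M * K)"
    proof (intro mult_mono power_mono)
      have "\<delta> \<le> dist z z0" using that by (simp add: dist_commute)
      then have "\<delta>\<^sup>2 \<le> (dist z z0)\<^sup>2" using \<delta> by (intro power_mono) auto
      then show "(cmod (poly (peak z0) z))\<^sup>2 \<le> \<kappa>"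
        by (simp add: peak_circle[OF that(1) z0] \<kappa>_def)
    qed (use pbd[OF that(1)] \<kappa> in auto)
    finally show ?thesis .
  qed
  have "ennreal (\<integral>z. (cmod (poly q z))\<^sup>2 \<partial>\<nu>2) = (\<integral>\<^sup>+z. ennreal ((cmod (poly q z))\<^sup>2) \<partial>\<nu>2)"
    by (subst nn_integral_eq_integral) (auto intro!: s2.integrable_continuous continuous_intros)
  also have "\<dots> \<le> (\<integral>\<^sup>+z. ennreal ((cmod (poly p z))\<^sup>2) * indicator (ball z0 \<delta>) z + ennreal (\<kappa>^m * (M * K)) \<partial>\<nu>2)"
  proof (rule nn_integral_mono_AE)
    show "AE z in \<nu>2. ennreal ((cmod (poly q z))\<^sup>2)
        \<le> ennreal ((cmod (poly p z))\<^sup>2) * indicator (ball z0 \<delta>) z + ennreal (\<kappa>^m * (M * K))"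
      using s2.AE_circle
    proof eventually_elim
      case (elim z)
      show ?case
        using near[OF elim] far[OF elim] \<kappa> M0 K
        by (cases "z \<in> ball z0 \<delta>") (auto simp flip: ennreal_plus intro!: ennreal_leI add_increasing2)
    qed
  qed
  also have "\<dots> = (\<integral>\<^sup>+z. ennreal ((cmod (poly p z))\<^sup>2) * indicator (ball z0 \<delta>) z \<partial>\<nu>2)
      + ennreal (\<kappa>^m * (M * K)) * emeasure \<nu>2 (space \<nu>2)"
    by (subst nn_integral_add) auto
  also have "\<dots> \<le> ennreal c * (\<integral>\<^sup>+z. ennreal ((cmod (poly p z))\<^sup>2) * indicator (ball z0 \<delta>) z \<partial>\<nu>1)
      + ennreal (\<kappa>^m * (M * K)) * emeasure \<nu>2 (space \<nu>2)"
    by (intro add_right_mono le) measurable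
  also have "\<dots> \<le> ennreal c * (\<integral>\<^sup>+z. ennreal ((cmod (poly p z))\<^sup>2) \<partial>\<nu>1)
      + ennreal (\<kappa>^m * (M * K)) * emeasure \<nu>2 (space \<nu>2)"
    by (intro add_right_mono mult_left_mono nn_integral_mono) (auto simp: indicator_def)
  also have "(\<integral>\<^sup>+z. ennreal ((cmod (poly p z))\<^sup>2) \<partial>\<nu>1) = ennreal K"
    unfolding K_def p(3)[symmetric]
    by (subst nn_integral_eq_integral) (auto intro!: s1.integrable_continuous continuous_intros)
  also have "space \<nu>2 = UNIV" using s2.sets_nu by (metis sets_eq_imp_space_eq space_borel)
  also have "ennreal c * ennreal K + ennreal (\<kappa>^m * (M * K)) * emeasure \<nu>2 UNIV
     = ennreal (c * K + \<kappa>^m * (M * K) * measure \<nu>2 UNIV)"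
    using c K \<kappa> M0 by (simp add: f2.emeasure_eq_measure ennreal_plus ennreal_mult)
  finally have int: "(\<integral>z. (cmod (poly q z))\<^sup>2 \<partial>\<nu>2) \<le> c * K + \<kappa>^m * (M * K) * measure \<nu>2 UNIV"
    using c K \<kappa> M0 by (subst (asm) ennreal_le_iff) auto
  \<comment> \<open>As \<open>p\<close> takes the value \<open>K\<close> at \<open>\<zeta>\<close>,
    the left side carries \<open>K\<close> squared; one factor cancels at the end.\<close>
  have "(cmod (poly (peak z0) \<zeta>))^(2 * m) * K * K = (cmod (poly q \<zeta>))\<^sup>2"
    using K unfolding q_def
    by (simp add: p(2) norm_mult norm_power power_mult_distrib power_mult[symmetric] K_def[symmetric]
        mult.commute power2_eq_square)
       (simp add: power_mult mult_ac power2_eq_square power_mult_distrib)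
  also have "\<dots> \<le> kern \<phi>2 (n + m) \<zeta> * (\<integral>z. (cmod (poly q z))\<^sup>2 \<partial>\<nu>2)"
    by (rule s2.poly_le_kern[OF dq])
  also have "\<dots> \<le> kern \<phi>2 (n + m) \<zeta> * (c * K + \<kappa>^m * (M * K) * measure \<nu>2 UNIV)"
    by (intro mult_left_mono int kern_nonneg)
  also have "\<dots> = (kern \<phi>2 (n + m) \<zeta> * (c + \<kappa>^m * measure \<nu>2 UNIV * M)) * K"
    by (simp add: algebra_simps)
  finally show ?thesis
    using K unfolding K_def[symmetric] \<kappa>_def[symmetric] by (simp only: mult_le_cancel_right_pos)
qed

section \<open>Arclength measure and its orthonormal monomials\<close>

lemma sets_arclength [simp, measurable_cong]: "sets arclength = sets borel"
  by (simp add: arclength_def)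

lemma measurable_cis [measurable]: "cis \<in> borel_measurable borel"
  by (intro borel_measurable_continuous_onI continuous_intros)

lemma nn_integral_arclength:
  assumes [measurable]: "f \<in> borel_measurable borel"
  shows "(\<integral>\<^sup>+z. f z \<partial>arclength) = (\<integral>\<^sup>+t. f (cis t) * indicator {-pi<..pi} t \<partial>lborel)"
  unfolding arclength_def
  by (subst nn_integral_distr) (auto intro!: measurable_restrict_space1 simp: nn_integral_restrict_space)

lemma emeasure_arclength: "A \<in> sets borel \<Longrightarrow>
    emeasure arclength A = emeasure lborel ({t. cis t \<in> A} \<inter> {-pi<..pi})"
proof -
  assume [measurable]: "A \<in> sets borel"
  have "emeasure arclength A = (\<integral>\<^sup>+t. indicator A (cis t) * indicator {-pi<..pi} t \<partial>lborel)"
    by (subst nn_integral_arclength[symmetric]) auto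
  also have "\<dots> = (\<integral>\<^sup>+t. indicator ({t. cis t \<in> A} \<inter> {-pi<..pi}) t \<partial>lborel)"
    by (intro nn_integral_cong) (auto simp: indicator_def)
  also have "\<dots> = emeasure lborel ({t. cis t \<in> A} \<inter> {-pi<..pi})"
    by (intro nn_integral_indicator) measurable
  finally show ?thesis .
qed

lemma measure_arclength: "A \<in> sets borel \<Longrightarrow>
    measure arclength A = measure lborel ({t. cis t \<in> A} \<inter> {-pi<..pi})"
  by (simp add: measure_def emeasure_arclength)

lemma measure_arclength_UNIV: "measure arclength UNIV = 2 * pi"
  by (subst measure_arclength) auto

lemma finite_measure_arclength: "finite_measure arclength"
  by (rule finite_measureI) (simp add: emeasure_arclength sets_eq_imp_space_eq[OF sets_arclength])

lemma integral_cis: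
  assumes "k \<noteq> 0"
  shows "(LINT t:{-pi<..pi}|lborel. cis (of_int k * t)) = 0"
proof -
  define F where "F t = cis (of_int k * t) / (\<i> * of_int k)" for t :: real
  have "has_bochner_integral lborel (\<lambda>t. indicator {-pi..pi} t *\<^sub>R cis (of_int k * t)) (F pi - F (-pi))"
  proof (rule has_bochner_integral_FTC_Icc)
    fix t :: real
    show "(F has_vector_derivative cis (of_int k * t)) (at t within {-pi..pi})"
      unfolding F_def cis_conv_exp of_real_mult of_real_of_int_eq using assms
      by (intro has_vector_derivative_real_field) (auto intro!: derivative_eq_intros simp: mult.commute[of _ \<i>])
  qed (auto intro!: continuous_intros)
  moreover have "cis (of_int k * pi) = cis (of_int k * - pi)"
    by (simp add: complex_eq_iff sin_times_pi_eq_0)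
  then have "F pi = F (-pi)" by (simp add: F_def)
  ultimately have "(\<integral>t. indicator {-pi..pi} t *\<^sub>R cis (of_int k * t) \<partial>lborel) = 0"
    by (simp add: has_bochner_integral_integral_eq)
  moreover have "(LINT t:{-pi<..pi}|lborel. cis (of_int k * t))
      = (\<integral>t. indicator {-pi..pi} t *\<^sub>R cis (of_int k * t) \<partial>lborel)"
    unfolding set_lebesgue_integral_def
    using AE_lborel_singleton[of "-pi"]
    by (intro integral_cong_AE) (auto simp: indicator_def)
  ultimately show ?thesis by simp
qed

text \<open>The factor compensates the total mass \<open>2 * pi\<close> of \<open>arclength\<close>.
  This explicit system is the model for all other kernels.\<close>

definition circle_monom :: "nat \<Rightarrow> complex poly" where
  "circle_monom j = monom (complex_of_real (1 / sqrt (2 * pi))) j"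

lemma kern_circle_monom:
  "kern circle_monom n z = (\<Sum>j\<le>n. cmod z ^ (2 * j)) / (2 * pi)"
  by (simp add: kern_def circle_monom_def poly_monom norm_mult norm_power norm_divide power_divide
      power_mult[symmetric] mult.commute sum_divide_distrib power_mult_distrib)

lemma circle_system_arclength: "circle_system arclength circle_monom"
proof (rule circle_system.intro)
  show "AE z in arclength. z \<in> unit_circle"
    unfolding arclength_def by (subst AE_distr_iff) (auto intro!: measurable_restrict_space1)
  fix m k
  have pt: "poly (circle_monom m) (cis t) * cnj (poly (circle_monom k) (cis t))
      = cis (of_int (int m - int k) * t) / (2 * pi)" for t
  proof -
    have "complex_of_real (1 / sqrt (2 * pi)) * complex_of_real (1 / sqrt (2 * pi)) = 1 / (2 * pi)"
      unfolding of_real_mult[symmetric] by simp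
    moreover have "cis t ^ m * cnj (cis t) ^ k = cis (of_int (int m - int k) * t)"
      unfolding cis_cnj Complex.DeMoivre cis_mult by (rule arg_cong[where f = cis]) (simp add: algebra_simps)
    moreover have "poly (circle_monom m) (cis t) * cnj (poly (circle_monom k) (cis t)) =
        (complex_of_real (1 / sqrt (2 * pi)) * complex_of_real (1 / sqrt (2 * pi))) * (cis t ^ m * cnj (cis t) ^ k)"
      by (simp add: circle_monom_def poly_monom)
    ultimately show ?thesis by simp
  qed
  have "(\<integral>z. poly (circle_monom m) z * cnj (poly (circle_monom k) z) \<partial>arclength)
     = (LINT t:{-pi<..pi}|lborel. cis (of_int (int m - int k) * t) / (2 * pi))"
    unfolding arclength_def
    by (subst integral_distr) (auto intro!: measurable_restrict_space1 borel_measurable_continuous_onI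
       continuous_intros simp: integral_restrict_space set_lebesgue_integral_def pt)
  also have "\<dots> = (if m = k then 1 else 0)"
  proof (cases "m = k")
    case True
    then show ?thesis by (simp add: set_lebesgue_integral_def scaleR_conv_of_real)
  next
    case False
    then have "int m - int k \<noteq> 0" by simp
    from integral_cis[OF this] show ?thesis using False by (simp add: set_integral_divide_zero)
  qed
  finally show "(\<integral>z. poly (circle_monom m) z * cnj (poly (circle_monom k) z) \<partial>arclength) = (if m = k then 1 else 0)" .
qed (auto simp: finite_measure_arclength circle_monom_def degree_monom_eq)

lemma AE_arclength: "AE z in arclength. z \<in> unit_circle"
  by (rule circle_system.AE_circle[OF circle_system_arclength])

section \<open>Growth of the kernel on the circle\<close>

lemma circle_system_opuc:
  assumes "circle_prob_measure \<mu>" "opuc \<mu> \<phi>"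
  shows "circle_system \<mu> \<phi>"
proof (rule circle_system.intro)
  have "prob_space \<mu>" using assms by (simp add: circle_prob_measure_def)
  then show "finite_measure \<mu>" by (rule prob_space.finite_measure)
  show "\<phi> j \<noteq> 0" for j
    using assms(2) unfolding opuc_def by (metis leading_coeff_0_iff less_numeral_extra(3) of_real_eq_0_iff)
qed (use assms in \<open>auto simp: circle_prob_measure_def opuc_def\<close>)

text \<open>On the circle the reversed polynomial has the same modulus as \<open>\<phi> n\<close>.
  With \<open>a = cmod (\<alpha> n)\<close> one step thus costs at most the factor
  \<open>(1 + a) / sqrt (1 - a^2)\<close>, whose square is the quotient shown.\<close>

lemma recurrence_step:
  assumes "recurrence_coeffs \<phi> \<alpha>" "z \<in> unit_circle"
  shows "(cmod (poly (\<phi> (Suc n)) z))\<^sup>2 \<le> (1 + cmod (\<alpha> n)) / (1 - cmod (\<alpha> n)) * (cmod (poly (\<phi> n) z))\<^sup>2"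
proof -
  define a where "a = cmod (\<alpha> n)"
  define b where "b = cmod (poly (\<phi> n) z)"
  have a: "0 \<le> a" "a < 1" using assms(1) by (auto simp: a_def recurrence_coeffs_def)
  have z: "cmod z = 1" "z \<noteq> 0" using assms(2) by auto
  have "1 / cnj z = z"
    using z by (simp add: divide_eq_eq complex_norm_square[symmetric])
  then have rev: "cmod (reversed_poly n (\<phi> n) z) = b"
    using z by (simp add: reversed_poly_def norm_mult norm_power b_def)
  have sq: "0 < 1 - a\<^sup>2" using a by (simp add: power_less_one_iff abs_square_less_1)
  have "poly (\<phi> (Suc n)) z = (z * poly (\<phi> n) z - cnj (\<alpha> n) * reversed_poly n (\<phi> n) z)
             / complex_of_real (sqrt (1 - a\<^sup>2))"
    using assms(1) z(2) unfolding recurrence_coeffs_def a_def by blast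
  then have "cmod (poly (\<phi> (Suc n)) z) =
       cmod (z * poly (\<phi> n) z - cnj (\<alpha> n) * reversed_poly n (\<phi> n) z) / sqrt (1 - a\<^sup>2)"
    using sq by (simp add: norm_divide)
  also have "\<dots> \<le> (b + a * b) / sqrt (1 - a\<^sup>2)"
    using sq z rev
    by (intro divide_right_mono order.trans[OF norm_triangle_ineq4]) (auto simp: norm_mult a_def b_def)
  finally have "(cmod (poly (\<phi> (Suc n)) z))\<^sup>2 \<le> ((b + a * b) / sqrt (1 - a\<^sup>2))\<^sup>2"
    by (intro power_mono) auto
  also have "\<dots> = (1 + a)\<^sup>2 * b\<^sup>2 / ((1 - a) * (1 + a))"
    using sq by (simp add: power_divide power2_eq_square algebra_simps)
  also have "\<dots> = (1 + a) / (1 - a) * b\<^sup>2"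
    using a by (simp add: power2_eq_square)
  finally show ?thesis by (simp add: a_def b_def)
qed

lemma kern_subexponential:
  assumes rec: "recurrence_coeffs \<phi> \<alpha>" and lim: "\<alpha> \<longlonglongrightarrow> 0" and \<delta>: "0 < (\<delta>::real)"
  shows "\<exists>C\<ge>0. \<forall>n. \<forall>z\<in>unit_circle. kern \<phi> n z \<le> C * (1 + \<delta>)^n"
proof -
  have "(\<lambda>n. (1 + cmod (\<alpha> n)) / (1 - cmod (\<alpha> n))) \<longlonglongrightarrow> (1 + cmod 0) / (1 - cmod 0)"
    by (intro tendsto_intros lim) auto
  then have "eventually (\<lambda>n. (1 + cmod (\<alpha> n)) / (1 - cmod (\<alpha> n)) < 1 + \<delta>) sequentially"
    using \<delta> by (intro order_tendstoD) auto
  then obtain N where N: "\<And>n. n \<ge> N \<Longrightarrow> (1 + cmod (\<alpha> n)) / (1 - cmod (\<alpha> n)) < 1 + \<delta>"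
    by (auto simp: eventually_sequentially)
  have "\<exists>B. \<forall>z\<in>unit_circle. (cmod (poly (\<phi> j) z))\<^sup>2 \<le> B" for j
  proof -
    have "compact ((\<lambda>z. (cmod (poly (\<phi> j) z))\<^sup>2) ` unit_circle)"
      by (intro compact_continuous_image continuous_intros) auto
    then show ?thesis by (force simp: bounded_iff dest!: compact_imp_bounded)
  qed
  then obtain B where B: "\<And>j z. z \<in> unit_circle \<Longrightarrow> (cmod (poly (\<phi> j) z))\<^sup>2 \<le> B j" by metis
  have B0: "0 \<le> B j" for j
    using order.trans[OF zero_le_power2 B[of 1 j]] by simp
  \<comment> \<open>Absorbs the finitely many degrees up to \<open>N\<close>, for which the ratio
    may still exceed \<open>1 + \<delta>\<close>.\<close>
  define C where "C = (\<Sum>j\<le>N. B j)"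
  have C0: "0 \<le> C" unfolding C_def by (intro sum_nonneg B0)
  have bd: "(cmod (poly (\<phi> j) z))\<^sup>2 \<le> C * (1 + \<delta>)^j" if z: "z \<in> unit_circle" for j z
  proof (induction j)
    case 0
    have "(cmod (poly (\<phi> 0) z))\<^sup>2 \<le> B 0" by (rule B[OF z])
    also have "\<dots> \<le> C" unfolding C_def by (rule member_le_sum) (auto intro: B0)
    finally show ?case by simp
  next
    case (Suc j)
    show ?case
    proof (cases "Suc j \<le> N")
      case True
      have "(cmod (poly (\<phi> (Suc j)) z))\<^sup>2 \<le> B (Suc j)" by (rule B[OF z])
      also have "\<dots> \<le> C * 1" unfolding C_def using True by (auto intro!: member_le_sum B0)
      also have "\<dots> \<le> C * (1 + \<delta>)^Suc j" using \<delta> C0 by (intro mult_left_mono one_le_power) auto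
      finally show ?thesis .
    next
      case False
      have "(cmod (poly (\<phi> (Suc j)) z))\<^sup>2 \<le> (1 + cmod (\<alpha> j)) / (1 - cmod (\<alpha> j)) * (cmod (poly (\<phi> j) z))\<^sup>2"
        by (rule recurrence_step[OF rec z])
      also have "\<dots> \<le> (1 + \<delta>) * (C * (1 + \<delta>)^j)"
        using False N[of j] Suc.IH \<delta> by (intro mult_mono) auto
      finally show ?thesis by (simp add: mult_ac)
    qed
  qed
  have "kern \<phi> n z \<le> (C * (1 + \<delta>) / \<delta>) * (1 + \<delta>)^n" if z: "z \<in> unit_circle" for n z
  proof -
    have "kern \<phi> n z \<le> (\<Sum>j\<le>n. C * (1 + \<delta>)^j)" unfolding kern_def by (intro sum_mono bd z)
    also have "\<dots> = C * (((1 + \<delta>)^Suc n - 1) / \<delta>)"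
      using \<delta> geometric_sum[of "1 + \<delta>" "Suc n"] by (simp add: sum_distrib_left[symmetric] lessThan_Suc_atMost)
    also have "\<dots> \<le> C * ((1 + \<delta>)^Suc n / \<delta>)"
      using \<delta> C0 by (intro mult_left_mono divide_right_mono) auto
    finally show ?thesis by (simp add: mult_ac)
  qed
  moreover have "0 \<le> C * (1 + \<delta>) / \<delta>" using C0 \<delta> by simp
  ultimately show ?thesis by blast
qed

text \<open>Here \<open>w\<close> is continuous only at the points of \<open>S\<close>, not on a
  neighbourhood, so Heine-Cantor does not apply as such; a Lebesgue number of the cover by
  continuity balls gives the common radius.\<close>

lemma uniform_continuity_on_compact_points:
  fixes w :: "'a::metric_space \<Rightarrow> real"
  assumes "compact S" and "\<And>z. z \<in> S \<Longrightarrow> continuous (at z within T) w" and "S \<subseteq> T" and "0 < \<epsilon>"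
  obtains \<delta> where "0 < \<delta>" "\<And>z y. z \<in> S \<Longrightarrow> y \<in> T \<Longrightarrow> dist y z < \<delta> \<Longrightarrow> \<bar>w y - w z\<bar> < \<epsilon>"
proof -
  have "\<exists>d>0. \<forall>y\<in>T. dist y z < d \<longrightarrow> \<bar>w y - w z\<bar> < \<epsilon> / 2" if "z \<in> S" for z
    using assms(2)[OF that] \<open>0 < \<epsilon>\<close> unfolding continuous_within_eps_delta dist_real_def
    by (meson half_gt_zero)
  then obtain d where d: "\<And>z. z \<in> S \<Longrightarrow> 0 < d z"
     "\<And>z y. z \<in> S \<Longrightarrow> y \<in> T \<Longrightarrow> dist y z < d z \<Longrightarrow> \<bar>w y - w z\<bar> < \<epsilon> / 2" by metis
  have "S \<subseteq> \<Union>((\<lambda>z. ball z (d z)) ` S)" using d(1) by force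
  then obtain e where e: "0 < e" "\<And>z. z \<in> S \<Longrightarrow> \<exists>G \<in> (\<lambda>z. ball z (d z)) ` S. ball z e \<subseteq> G"
    using Heine_Borel_lemma[OF assms(1), of "(\<lambda>z. ball z (d z)) ` S"] by blast
  show ?thesis
  proof (rule that[OF e(1)])
    fix z y assume zy: "z \<in> S" "y \<in> T" "dist y z < e"
    obtain x where x: "x \<in> S" "ball z e \<subseteq> ball x (d x)" using e(2)[OF zy(1)] by blast
    have "z \<in> ball z e" "y \<in> ball z e" using zy(3) e(1) by (auto simp: dist_commute)
    then have "z \<in> ball x (d x)" "y \<in> ball x (d x)" using x(2) by blast+
    then have "\<bar>w z - w x\<bar> < \<epsilon> / 2" "\<bar>w y - w x\<bar> < \<epsilon> / 2"
      using d(2)[OF x(1)] zy assms(3) by (auto simp: dist_commute)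
    then show "\<bar>w y - w z\<bar> < \<epsilon>" by linarith
  qed
qed

text \<open>Stated through integrals of nonnegative functions, the form that
  \<open>kern_comparison\<close> consumes. For negative \<open>a\<close> the coefficient
  \<open>ennreal a\<close> is \<open>0\<close>.\<close>

definition density_comparable :: "complex measure \<Rightarrow> complex set \<Rightarrow> real \<Rightarrow> real \<Rightarrow> bool" where
  "density_comparable \<mu> A a b \<longleftrightarrow> (\<forall>f\<in>borel_measurable borel.
     (\<integral>\<^sup>+y. f y * indicator A y \<partial>\<mu>) \<le> ennreal b * (\<integral>\<^sup>+y. f y * indicator A y \<partial>arclength) \<and>
     ennreal a * (\<integral>\<^sup>+y. f y * indicator A y \<partial>arclength) \<le> (\<integral>\<^sup>+y. f y * indicator A y \<partial>\<mu>))"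

text \<open>On balls inside \<open>U\<close> the density \<open>RN_deriv\<close> agrees almost
  everywhere with \<open>w\<close>, which continuity at the centre pins down; compactness of
  \<open>S\<close> makes the radius and the bounds \<open>W0\<close>, \<open>W1\<close> common to
  all centres.\<close>

lemma local_density_bounds:
  assumes ac: "ac_pos_cont_density_on \<mu> S" and S: "compact S" "S \<subseteq> unit_circle"
    and \<mu>: "sets \<mu> = sets borel" "AE z in \<mu>. z \<in> unit_circle"
  obtains w W0 W1 where "0 < W0" "\<And>z. z \<in> S \<Longrightarrow> W0 \<le> w z" "\<And>z. z \<in> S \<Longrightarrow> w z \<le> W1"
    "\<And>\<epsilon>::real. 0 < \<epsilon> \<Longrightarrow> \<exists>\<delta>>0. \<delta> \<le> 1 \<and> (\<forall>z\<in>S. density_comparable \<mu> (ball z \<delta>) (w z - \<epsilon>) (w z + \<epsilon>))"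
proof -
  obtain U w where U: "open U" "S \<subseteq> U"
    and acU: "absolutely_continuous (restrict_space arclength U) (restrict_space \<mu> U)"
    and RN: "AE z in restrict_space arclength U.
           RN_deriv (restrict_space arclength U) (restrict_space \<mu> U) z = ennreal (w z)"
    and w: "\<And>z. z \<in> S \<Longrightarrow> 0 < w z" "\<And>z. z \<in> S \<Longrightarrow> continuous (at z within unit_circle) w"
    using ac unfolding ac_pos_cont_density_on_def by metis
  have [measurable_cong]: "sets \<mu> = sets borel" by fact
  have [measurable]: "U \<in> sets borel" using U by simp
  have contS: "continuous_on S w"
    using w(2) S(2) unfolding continuous_on_eq_continuous_within by (meson continuous_within_subset)
  obtain W0 where W0: "0 < W0" "\<And>z. z \<in> S \<Longrightarrow> W0 \<le> w z"
  proof (cases "S = {}")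
    case True then show ?thesis using that[of 1] by auto
  next
    case False
    then obtain x where "x \<in> S" "\<And>z. z \<in> S \<Longrightarrow> w x \<le> w z"
      using continuous_attains_inf[OF S(1) _ contS] by blast
    then show ?thesis using that[of "w x"] w(1) by auto
  qed
  obtain W1 where W1: "\<And>z. z \<in> S \<Longrightarrow> w z \<le> W1"
  proof (cases "S = {}")
    case True then show ?thesis using that[of 1] by auto
  next
    case False
    then obtain x where "x \<in> S" "\<And>z. z \<in> S \<Longrightarrow> w z \<le> w x"
      using continuous_attains_sup[OF S(1) _ contS] by blast
    then show ?thesis using that[of "w x"] w(1) by auto
  qed
  let ?A = "restrict_space arclength U" and ?M = "restrict_space \<mu> U"
  have setsAM: "sets ?M = sets ?A" using \<mu>(1) by (simp add: sets_restrict_space)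
  interpret A: finite_measure ?A
    by (rule finite_measure_restrict_space[OF finite_measure_arclength]) simp
  have dens: "density ?A (RN_deriv ?A ?M) = ?M" by (rule A.density_RN_deriv[OF acU setsAM])
  have circA: "AE z in ?A. z \<in> unit_circle"
    using AE_arclength
    by (subst AE_restrict_space_iff) (auto simp: sets_eq_imp_space_eq[OF sets_arclength])
  show ?thesis
  proof (rule that[OF W0(1) W0(2) W1])
    fix \<epsilon> :: real assume \<epsilon>: "0 < \<epsilon>"
    obtain \<delta>1 where \<delta>1: "0 < \<delta>1" "\<And>z y. z \<in> S \<Longrightarrow> y \<in> unit_circle \<Longrightarrow> dist y z < \<delta>1 \<Longrightarrow> \<bar>w y - w z\<bar> < \<epsilon>"
      using uniform_continuity_on_compact_points[OF S(1) w(2) S(2) \<epsilon>] by blast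
    \<comment> \<open>The single set \<open>U\<close> is a cover of \<open>S\<close>; its Lebesgue
      number keeps all balls inside \<open>U\<close>.\<close>
    obtain \<delta>2 where \<delta>2: "0 < \<delta>2" "\<And>z. z \<in> S \<Longrightarrow> ball z \<delta>2 \<subseteq> U"
      using Heine_Borel_lemma[OF S(1), of "{U}"] U by auto
    define \<delta> where "\<delta> = min 1 (min \<delta>1 \<delta>2)"
    have \<delta>: "0 < \<delta>" "\<delta> \<le> 1" "\<delta> \<le> \<delta>1" "\<delta> \<le> \<delta>2" using \<delta>1(1) \<delta>2(1) by (auto simp: \<delta>_def)
    have "(\<integral>\<^sup>+y. f y * indicator (ball z \<delta>) y \<partial>\<mu>) \<le> ennreal (w z + \<epsilon>) * (\<integral>\<^sup>+y. f y * indicator (ball z \<delta>) y \<partial>arclength) \<and>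
      ennreal (w z - \<epsilon>) * (\<integral>\<^sup>+y. f y * indicator (ball z \<delta>) y \<partial>arclength) \<le> (\<integral>\<^sup>+y. f y * indicator (ball z \<delta>) y \<partial>\<mu>)"
      if z: "z \<in> S" and f[measurable]: "f \<in> borel_measurable borel" for z f
    proof -
      define g where "g y = f y * indicator (ball z \<delta>) y" for y
      have [measurable]: "ball z \<delta> \<in> sets borel" by simp
      have g[measurable]: "g \<in> borel_measurable borel" unfolding g_def by measurable
      have gU: "g y * indicator U y = g y" for y
        using \<delta>2(2)[OF z] \<delta>(4) by (auto simp: g_def indicator_def subset_iff)
      have gA: "g \<in> borel_measurable ?A" by (intro measurable_restrict_space1) simp
      have "(\<integral>\<^sup>+y. g y \<partial>\<mu>) = (\<integral>\<^sup>+y. g y \<partial>?M)"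
        by (subst nn_integral_restrict_space) (auto simp: gU)
      also have "\<dots> = (\<integral>\<^sup>+y. RN_deriv ?A ?M y * g y \<partial>?A)"
        by (subst dens[symmetric], subst nn_integral_density) (auto simp: gA)
      finally have 1: "(\<integral>\<^sup>+y. g y \<partial>\<mu>) = (\<integral>\<^sup>+y. RN_deriv ?A ?M y * g y \<partial>?A)" .
      have 2: "ennreal c * (\<integral>\<^sup>+y. g y \<partial>arclength) = (\<integral>\<^sup>+y. ennreal c * g y \<partial>?A)" for c
        by (subst nn_integral_cmult[OF gA], subst nn_integral_restrict_space) (auto simp: gU)
      \<comment> \<open>The premise \<open>g y \<noteq> 0\<close> places \<open>y\<close> in the
        ball; elsewhere \<open>w\<close> is not controlled.\<close>
      have AE: "AE y in ?A. g y \<noteq> 0 \<longrightarrow> RN_deriv ?A ?M y = ennreal (w y) \<and> \<bar>w y - w z\<bar> < \<epsilon>"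
        using RN circA
      proof eventually_elim
        case (elim y)
        then show ?case using \<delta>1(2)[OF z, of y] \<delta>(3)
          by (auto simp: g_def indicator_def dist_commute split: if_splits)
      qed
      have "(\<integral>\<^sup>+y. RN_deriv ?A ?M y * g y \<partial>?A) \<le> (\<integral>\<^sup>+y. ennreal (w z + \<epsilon>) * g y \<partial>?A)"
        using AE by (intro nn_integral_mono_AE, eventually_elim)
          (metis (no_types, opaque_lifting) abs_diff_less_iff add.commute ennreal_leI less_imp_le mult_right_mono mult_zero_right order_refl zero_le)
      moreover have "(\<integral>\<^sup>+y. ennreal (w z - \<epsilon>) * g y \<partial>?A) \<le> (\<integral>\<^sup>+y. RN_deriv ?A ?M y * g y \<partial>?A)"
        using AE by (intro nn_integral_mono_AE, eventually_elim)
          (metis (no_types, opaque_lifting) abs_diff_less_iff ennreal_leI less_imp_le mult_right_mono mult_zero_right order_refl zero_le)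
      ultimately show ?thesis unfolding g_def[symmetric] 1 2 by blast
    qed
    then show "\<exists>\<delta>>0. \<delta> \<le> 1 \<and> (\<forall>z\<in>S. density_comparable \<mu> (ball z \<delta>) (w z - \<epsilon>) (w z + \<epsilon>))"
      unfolding density_comparable_def using \<delta> by blast
  qed
qed

section \<open>Universality of the kernel at the scale 1/n\<close>

text \<open>With \<open>v = u / n\<close> the peak equals \<open>1 + (exp v - 1) / 2\<close>, and
  \<open>|exp v - 1| \<le> 2 * |v|\<close> for \<open>|v| \<le> 1 / 2\<close>; Bernoulli's
  inequality does the rest. At distance of order \<open>1 / n\<close> the peak thus loses little as
  long as \<open>m / n\<close> is small.\<close>

lemma peak_near:
  assumes "z0 \<in> unit_circle" "cmod u \<le> R" "2 * R \<le> real n" "0 < n"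
  shows "1 - 2 * real m * R / real n \<le> cmod (poly (peak z0) (z0 * exp (u / of_nat n))) ^ (2 * m)"
proof -
  have z0: "cnj z0 * z0 = 1"
    using assms(1) by (simp add: complex_norm_square[symmetric] mult.commute)
  define v where "v = u / of_nat n"
  have v: "cmod v \<le> R / n" "R / n \<le> 1 / 2" "0 \<le> R / n"
    using assms order.trans[OF norm_ge_zero assms(2)] by (auto simp: v_def norm_divide divide_right_mono field_simps)
  have "poly (peak z0) (z0 * exp v) = 1 + (exp v - 1) / 2"
    using z0 by (simp add: peak_def field_simps)
  moreover have "1 - cmod ((exp v - 1) / 2) \<le> cmod (1 + (exp v - 1) / 2)"
    using norm_diff_ineq[of 1 "(exp v - 1) / 2"] by simp
  ultimately have "1 - cmod ((exp v - 1) / 2) \<le> cmod (poly (peak z0) (z0 * exp v))" by simp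
  moreover have "cmod ((exp v - 1) / 2) \<le> R / n"
    using norm_exp_bounds(2)[of v] v by (simp add: norm_divide)
  ultimately have "1 - R / n \<le> cmod (poly (peak z0) (z0 * exp v))" by linarith
  moreover have "R / n \<le> 1" using v(2) by linarith
  ultimately have "(1 - R / n)^(2 * m) \<le> cmod (poly (peak z0) (z0 * exp v)) ^ (2 * m)"
    by (intro power_mono) auto
  moreover have "1 + real (2 * m) * (- (R / n)) \<le> (1 + (- (R / n)))^(2 * m)"
    using \<open>R / n \<le> 1\<close> by (intro Bernoulli_inequality) auto
  ultimately show ?thesis by (simp add: v_def mult.assoc)
qed

text \<open>The model kernel up to \<open>2 * pi\<close>, at radius \<open>exp (x / n)\<close>. The
  degree \<open>N\<close> and the scale \<open>n\<close> are separate because the peak shifts the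
  degree while the scale stays.\<close>

definition ref_sum :: "nat \<Rightarrow> nat \<Rightarrow> real \<Rightarrow> real" where
  "ref_sum N n x = (\<Sum>j\<le>N. exp (2 * x * real j / real n))"

lemma kern_circle_monom_exp:
  assumes "z0 \<in> unit_circle"
  shows "kern circle_monom N (z0 * exp (u / of_nat n)) = ref_sum N n (Re u) / (2 * pi)"
  using assms
  by (simp add: kern_circle_monom ref_sum_def norm_mult exp_of_nat_mult[symmetric] field_simps)

text \<open>Each additional term is at most \<open>exp (4 * R)\<close>, since \<open>j / n\<close>
  does not exceed two.\<close>

lemma ref_sum_diff:
  assumes "N \<le> N'" "N' \<le> 2 * n" "\<bar>x\<bar> \<le> R" "0 < n"
  shows "ref_sum N n x \<le> ref_sum N' n x" "ref_sum N' n x \<le> ref_sum N n x + real (N' - N) * exp (4 * R)"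
proof -
  have split: "ref_sum N' n x = ref_sum N n x + (\<Sum>j\<in>{N<..N'}. exp (2 * x * real j / real n))"
    unfolding ref_sum_def using assms(1) by (subst sum.union_disjoint[symmetric]) (auto intro!: sum.cong)
  show "ref_sum N n x \<le> ref_sum N' n x"
    unfolding split by (simp add: sum_nonneg)
  have "(\<Sum>j\<in>{N<..N'}. exp (2 * x * real j / real n)) \<le> (\<Sum>j\<in>{N<..N'}. exp (4 * R))"
  proof (intro sum_mono)
    fix j assume "j \<in> {N<..N'}"
    then have "real j / n \<le> 2" using assms by (auto simp: divide_le_eq)
    then have "2 * x * (real j / n) \<le> 2 * R * 2"
      using assms by (intro order.trans[OF mult_right_mono[of "2 * x" "2 * R"] mult_left_mono]) auto
    then show "exp (2 * x * real j / real n) \<le> exp (4 * R)" by simp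
  qed
  then show "ref_sum N' n x \<le> ref_sum N n x + real (N' - N) * exp (4 * R)"
    unfolding split by simp
qed

lemma ref_sum_le:
  assumes "\<bar>x\<bar> \<le> R" "0 < n"
  shows "ref_sum n n x \<le> real n * (2 * exp (4 * R))"
proof -
  have "ref_sum n n x \<le> ref_sum 0 n x + real (n - 0) * exp (4 * R)"
    by (rule ref_sum_diff) (use assms in auto)
  also have "ref_sum 0 n x = 1" by (simp add: ref_sum_def)
  also have "1 \<le> real n * exp (4 * R)"
    using assms mult_mono[of 1 "real n" 1 "exp (4 * R)"] by auto
  finally show ?thesis by simp
qed

text \<open>Turns the two-sided estimate with relative and absolute errors \<open>\<gamma>\<close>
  into a difference. A crude bound \<open>K \<le> 3 * A + 3 / 2\<close>, from
  \<open>\<gamma> \<le> 1 / 2\<close>, is obtained first and then fed back into the error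
  terms.\<close>

lemma squeeze_estimate:
  fixes a K A \<gamma> :: real
  assumes "0 \<le> a" "a \<le> A" "0 \<le> K" "0 \<le> \<gamma>" "\<gamma> \<le> 1 / 2"
    and up: "(1 - \<gamma>) * K \<le> (a + \<gamma>) * (1 + \<gamma>)" and lo: "(a - \<gamma>) * (1 - \<gamma>) \<le> K * (1 + \<gamma>)"
  shows "\<bar>K - a\<bar> \<le> \<gamma> * (6 * A + 6)"
proof -
  have g2: "\<gamma> * \<gamma> \<le> \<gamma> / 2" using mult_left_mono[OF assms(5,4)] by simp
  have A0: "0 \<le> A * \<gamma>" using assms by simp
  have aA: "a * \<gamma> \<le> A * \<gamma>" by (intro mult_right_mono assms)
  have "(1 / 2) * K \<le> (1 - \<gamma>) * K" using assms by (intro mult_right_mono) auto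
  also note up
  also have "(a + \<gamma>) * (1 + \<gamma>) \<le> (A + 1 / 2) * (3 / 2)" using assms by (intro mult_mono) auto
  finally have K: "K \<le> 3 * A + 3 / 2" by simp
  have Kg: "K * \<gamma> \<le> (3 * A + 3 / 2) * \<gamma>" by (intro mult_right_mono assms K)
  have "K - a \<le> \<gamma> * K + \<gamma> * a + \<gamma> + \<gamma> * \<gamma>" using up by (simp add: algebra_simps)
  then have 1: "K - a \<le> \<gamma> * (6 * A + 6)" using Kg aA g2 A0 assms(4) by (simp add: algebra_simps)
  have "a - K \<le> \<gamma> * K + \<gamma> * a + \<gamma>"
  proof -
    have "(a - \<gamma>) * (1 - \<gamma>) = a - \<gamma> - \<gamma> * a + \<gamma> * \<gamma>" "K * (1 + \<gamma>) = K + \<gamma> * K"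
      by (simp_all add: algebra_simps)
    moreover have "0 \<le> \<gamma> * \<gamma>" by simp
    ultimately show ?thesis using lo by linarith
  qed
  then have 2: "a - K \<le> \<gamma> * (6 * A + 6)"
    using Kg aA A0 assms(4) by (simp add: algebra_simps)
  from 1 2 show ?thesis by linarith
qed

text \<open>A peak power with exponent proportional to \<open>n\<close> decays geometrically, with
  ratio \<open>q = \<kappa>1 powr \<eta> < 1\<close>, and so beats any sufficiently slow exponential
  growth.\<close>

lemma power_decay:
  fixes \<kappa> \<eta> :: real
  assumes "0 \<le> \<kappa>" "\<kappa> < 1" "0 < \<eta>"
  obtains \<delta> where "0 < \<delta>" "(\<lambda>n. \<kappa> ^ nat \<lfloor>\<eta> * real n\<rfloor> * (1 + \<delta>)^n) \<longlonglongrightarrow> 0"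
proof -
  \<comment> \<open>Keeps the base of \<open>powr\<close> away from zero when
    \<open>\<kappa> = 0\<close>.\<close>
  define \<kappa>1 where "\<kappa>1 = max \<kappa> (1 / 2)"
  have k1: "0 < \<kappa>1" "\<kappa>1 < 1" "\<kappa> \<le> \<kappa>1" using assms by (auto simp: \<kappa>1_def)
  define q where "q = \<kappa>1 powr \<eta>"
  have q: "0 < q" "q < 1"
    using k1 assms powr_less_mono2[of \<eta> \<kappa>1 1] by (auto simp: q_def)
  \<comment> \<open>Chosen so that \<open>q * (1 + \<delta>)\<close> lies halfway between
    \<open>q\<close> and one.\<close>
  define \<delta> where "\<delta> = (1 - q) / (2 * q)"
  have \<delta>: "0 < \<delta>" "q * (1 + \<delta>) = (1 + q) / 2" using q by (auto simp: \<delta>_def field_simps)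
  have le: "norm (\<kappa> ^ nat \<lfloor>\<eta> * real n\<rfloor> * (1 + \<delta>)^n) \<le> 1 / \<kappa>1 * ((1 + q) / 2)^n" for n
  proof -
    have "\<kappa> ^ nat \<lfloor>\<eta> * real n\<rfloor> \<le> \<kappa>1 ^ nat \<lfloor>\<eta> * real n\<rfloor>" using assms k1 by (intro power_mono) auto
    also have "\<dots> = \<kappa>1 powr (real (nat \<lfloor>\<eta> * real n\<rfloor>))" using k1 by (simp add: powr_realpow)
    also have "\<dots> \<le> \<kappa>1 powr (\<eta> * real n - 1)"
    proof (rule powr_mono')
      show "\<eta> * real n - 1 \<le> real (nat \<lfloor>\<eta> * real n\<rfloor>)"
        using assms(3) real_of_int_floor_gt_diff_one[of "\<eta> * real n"] by (simp add: of_nat_nat)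
    qed (use k1 in auto)
    also have "\<dots> = 1 / \<kappa>1 * q ^ n"
    proof -
      have "\<kappa>1 powr (\<eta> * real n) = q ^ n"
        using q(1) unfolding q_def by (simp only: powr_powr[symmetric] powr_realpow)
      then show ?thesis using k1 by (simp add: powr_diff)
    qed
    finally have "\<kappa> ^ nat \<lfloor>\<eta> * real n\<rfloor> * (1 + \<delta>)^n \<le> 1 / \<kappa>1 * q ^ n * (1 + \<delta>)^n"
      using \<delta> by (intro mult_right_mono) auto
    also have "\<dots> = 1 / \<kappa>1 * ((1 + q) / 2)^n"
      by (simp only: \<delta>(2)[symmetric] power_mult_distrib mult.assoc)
    finally show ?thesis using assms \<delta> by simp
  qed
  have "(\<lambda>n. ((1 + q) / 2)^n) \<longlonglongrightarrow> 0" using q by (intro LIMSEQ_realpow_zero) auto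
  then have "(\<lambda>n. 1 / \<kappa>1 * ((1 + q) / 2)^n) \<longlonglongrightarrow> 0" by (rule tendsto_mult_right_zero)
  from Lim_null_comparison[OF always_eventually[OF allI[OF le]] this]
  have "(\<lambda>n. \<kappa> ^ nat \<lfloor>\<eta> * real n\<rfloor> * (1 + \<delta>)^n) \<longlonglongrightarrow> 0" .
  then show ?thesis using that \<delta>(1) by blast
qed

text \<open>The order of choices matters: \<open>\<gamma>\<close> from the tolerance, the peak
  proportion \<open>\<eta>\<close> from \<open>\<gamma>\<close>, the radius \<open>\<delta>\<close>
  from the density, and only then the growth rate \<open>\<delta>2\<close>, which depends on
  \<open>\<eta>\<close> and \<open>\<delta>\<close>.\<close>

theorem kern_asymptotics:
  assumes \<mu>: "circle_prob_measure \<mu>" and op: "opuc \<mu> \<phi>" and rec: "recurrence_coeffs \<phi> \<alpha>" and lim: "\<alpha> \<longlonglongrightarrow> 0"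
    and S: "compact S" "S \<subseteq> unit_circle" and ac: "ac_pos_cont_density_on \<mu> S"
  obtains W :: "complex \<Rightarrow> real" where "\<And>z. z \<in> S \<Longrightarrow> 0 < W z"
    "\<And>R \<epsilon>. 0 < \<epsilon> \<Longrightarrow> \<forall>\<^sub>F n in sequentially. \<forall>z\<in>S. \<forall>u. cmod u \<le> R \<longrightarrow>
        \<bar>W z * kern \<phi> n (z * exp (u / of_nat n)) / real n - ref_sum n n (Re u) / real n\<bar> \<le> \<epsilon>"
proof -
  have sys: "circle_system \<mu> \<phi>" by (rule circle_system_opuc[OF \<mu> op])
  note arc = circle_system_arclength
  have \<mu>1: "measure \<mu> UNIV = 1"
    using \<mu> sets_eq_imp_space_eq[of \<mu> borel] prob_space.prob_space[of \<mu>]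
    by (simp add: circle_prob_measure_def)
  have \<mu>2: "sets \<mu> = sets borel" "AE z in \<mu>. z \<in> unit_circle"
    using \<mu> unfolding circle_prob_measure_def by blast+
  obtain w W0 W1 where W: "0 < W0" "\<And>z. z \<in> S \<Longrightarrow> W0 \<le> w z" "\<And>z. z \<in> S \<Longrightarrow> w z \<le> W1"
    and dens: "\<And>\<epsilon>::real. 0 < \<epsilon> \<Longrightarrow> \<exists>\<delta>>0. \<delta> \<le> 1 \<and> (\<forall>z\<in>S. density_comparable \<mu> (ball z \<delta>) (w z - \<epsilon>) (w z + \<epsilon>))"
    by (rule local_density_bounds[OF ac S \<mu>2]) (rule that, assumption+)
  show ?thesis
  \<comment> \<open>The factor \<open>2 * pi\<close> undoes the normalisation of
    \<open>circle_monom\<close>, leaving \<open>ref_sum\<close> alone.\<close>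
  proof (rule that[of "\<lambda>z. 2 * pi * w z"])
    show "0 < 2 * pi * w z" if "z \<in> S" for z using W(1) W(2)[OF that] by simp
    fix R0 \<epsilon> :: real assume \<epsilon>: "0 < \<epsilon>"
    define R where "R = max R0 1"
    define A where "A = 2 * exp (4 * R)"
    have R: "1 \<le> R" by (simp add: R_def)
    then have "1 \<le> exp (4 * R)" by simp
    then have A: "1 \<le> A" unfolding A_def by linarith
    define \<gamma> where "\<gamma> = min (1 / 2) (\<epsilon> / (6 * A + 6))"
    have \<gamma>2: "\<gamma> \<le> \<epsilon> / (6 * A + 6)" unfolding \<gamma>_def by (rule min.cobounded2)
    have A6: "0 < 6 * A + 6" using A by linarith
    have \<gamma>: "0 < \<gamma>" "\<gamma> \<le> 1 / 2" "\<gamma> * (6 * A + 6) \<le> \<epsilon>"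
      subgoal using A6 \<epsilon> by (simp add: \<gamma>_def)
      subgoal unfolding \<gamma>_def by (rule min.cobounded1)
      subgoal using \<gamma>2 A6 by (simp only: pos_le_divide_eq)
      done
    \<comment> \<open>The peak degree will be about \<open>\<eta> * n\<close>. The three bounds make
      it at most \<open>n\<close>, make the change of degree cost at most
      \<open>\<gamma> * n\<close> in \<open>ref_sum\<close>, and keep the peak power above
      \<open>1 - \<gamma>\<close>.\<close>
    define \<eta> where "\<eta> = min (1 / 2) (min (\<gamma> / (exp (4 * R))) (\<gamma> / (2 * R)))"
    have \<eta>12: "\<eta> \<le> \<gamma> / exp (4 * R)" "\<eta> \<le> \<gamma> / (2 * R)" "\<eta> \<le> 1 / 2" "0 < \<eta>"
      subgoal unfolding \<eta>_def by (rule min.coboundedI2[OF min.cobounded1])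
      subgoal unfolding \<eta>_def by (rule min.coboundedI2[OF min.cobounded2])
      subgoal unfolding \<eta>_def by (rule min.cobounded1)
      subgoal using \<gamma>(1) R unfolding \<eta>_def by simp
      done
    have "\<eta> * exp (4 * R) \<le> \<gamma>" using \<eta>12(1) by (simp only: pos_le_divide_eq exp_gt_zero)
    moreover have "0 < 2 * R" using R by linarith
    then have "\<eta> * (2 * R) \<le> \<gamma>" using \<eta>12(2) by (simp only: pos_le_divide_eq)
    ultimately have \<eta>: "0 < \<eta>" "\<eta> \<le> 1 / 2" "\<eta> * exp (4 * R) \<le> \<gamma>" "2 * R * \<eta> \<le> \<gamma>"
      using \<eta>12(3,4) by (simp_all only: mult.commute)
    \<comment> \<open>Small relative to \<open>w z \<ge> W0\<close>: both
      \<open>w z / (w z - \<epsilon>1)\<close> and \<open>(w z + \<epsilon>1) / w z\<close> are at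
      most \<open>1 + \<gamma> / 2\<close>.\<close>
    define \<epsilon>1 where "\<epsilon>1 = W0 * \<gamma> / 4"
    have \<epsilon>1: "0 < \<epsilon>1" "\<epsilon>1 < W0" using W(1) \<gamma> by (auto simp: \<epsilon>1_def)
    obtain \<delta> where \<delta>: "0 < \<delta>" "\<delta> \<le> 1"
      and up: "\<And>z f. z \<in> S \<Longrightarrow> f \<in> borel_measurable borel \<Longrightarrow>
         (\<integral>\<^sup>+y. f y * indicator (ball z \<delta>) y \<partial>\<mu>) \<le> ennreal (w z + \<epsilon>1) * (\<integral>\<^sup>+y. f y * indicator (ball z \<delta>) y \<partial>arclength)"
      and lo: "\<And>z f. z \<in> S \<Longrightarrow> f \<in> borel_measurable borel \<Longrightarrow>
         ennreal (w z - \<epsilon>1) * (\<integral>\<^sup>+y. f y * indicator (ball z \<delta>) y \<partial>arclength) \<le> (\<integral>\<^sup>+y. f y * indicator (ball z \<delta>) y \<partial>\<mu>)"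
      using dens[OF \<epsilon>1(1)] unfolding density_comparable_def by blast
    define \<kappa> where "\<kappa> = 1 - \<delta>\<^sup>2 / 4"
    have \<kappa>: "0 \<le> \<kappa>" "\<kappa> < 1" using \<delta> power_le_one[of \<delta> 2] by (auto simp: \<kappa>_def)
    define m where "m n = nat \<lfloor>\<eta> * real n\<rfloor>" for n
    have m: "real (m n) \<le> \<eta> * real n" for n using \<eta>(1) by (simp add: m_def of_nat_nat)
    have mn: "m n \<le> n" for n
    proof -
      have "real (m n) \<le> \<eta> * real n" by (rule m)
      also have "\<dots> \<le> 1 * real n" using \<eta> by (intro mult_right_mono) auto
      finally show ?thesis by simp
    qed
    obtain \<delta>2 where \<delta>2: "0 < \<delta>2" "(\<lambda>n. \<kappa> ^ m n * (1 + \<delta>2)^n) \<longlonglongrightarrow> 0"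
      using power_decay[OF \<kappa> \<eta>(1)] unfolding m_def by blast
    obtain C where C: "0 \<le> C" "\<And>n z. z \<in> unit_circle \<Longrightarrow> kern \<phi> n z \<le> C * (1 + \<delta>2)^n"
      using kern_subexponential[OF rec lim \<delta>2(1)] by metis
    \<comment> \<open>Error from outside the ball when the trial polynomial is integrated against
      \<open>arclength\<close>; \<open>o2\<close> is its counterpart for \<open>\<mu>\<close>, where
      the crude bound on the model kernel is linear in \<open>n\<close>.\<close>
    define o1 where "o1 n = \<kappa> ^ m n * (2 * pi) * (C * (1 + \<delta>2)^n)" for n
    have "(\<lambda>n. (2 * pi * C) * (\<kappa> ^ m n * (1 + \<delta>2)^n)) \<longlonglongrightarrow> (2 * pi * C) * 0"
      by (intro tendsto_intros \<delta>2)
    then have "o1 \<longlonglongrightarrow> 0" by (simp add: o1_def[abs_def] mult_ac)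
    then have "(\<lambda>n. W1 * o1 n) \<longlonglongrightarrow> W1 * 0" by (intro tendsto_intros)
    then have ev1: "\<forall>\<^sub>F n in sequentially. W1 * o1 n < \<gamma> / 2"
      using \<gamma> by (intro order_tendstoD) auto
    define o2 where "o2 n = \<kappa> ^ m n * (real n + 1)" for n
    obtain D where D: "\<And>n. real n + 1 \<le> D * (1 + \<delta>2)^n" "0 \<le> D"
    proof
      fix n
      have "1 + real n * \<delta>2 \<le> (1 + \<delta>2)^n" using \<delta>2(1) by (intro Bernoulli_inequality) auto
      moreover have "1 \<le> (1 + \<delta>2)^n" using \<delta>2 by (intro one_le_power) auto
      ultimately have "real n \<le> (1 + \<delta>2)^n / \<delta>2" "1 \<le> (1 + \<delta>2)^n"
        using \<delta>2(1) by (simp_all only: pos_le_divide_eq)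
      then show "real n + 1 \<le> (1 / \<delta>2 + 1) * (1 + \<delta>2)^n"
        by (simp only: distrib_right mult_1 times_divide_eq_left)
    qed (use \<delta>2 in auto)
    have "norm (o2 n) \<le> D * (\<kappa> ^ m n * (1 + \<delta>2)^n)" for n
    proof -
      have "\<kappa> ^ m n * (real n + 1) \<le> \<kappa> ^ m n * (D * (1 + \<delta>2)^n)"
        using \<kappa> by (intro mult_left_mono D) auto
      then show ?thesis using \<kappa> by (simp add: o2_def mult_ac)
    qed
    from Lim_null_comparison[OF always_eventually[OF allI[OF this]] tendsto_mult_right_zero[OF \<delta>2(2)]]
    have "o2 \<longlonglongrightarrow> 0" .
    then have ev2: "\<forall>\<^sub>F n in sequentially. o2 n < W0 * \<gamma> / 2"
      using \<gamma> W by (intro order_tendstoD) auto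
    have ev3: "\<forall>\<^sub>F n in sequentially. 2 * R \<le> real n \<and> 0 < n"
      using eventually_ge_at_top[of "nat \<lceil>2 * R\<rceil>"] eventually_gt_at_top[of 0]
      by eventually_elim linarith
    show "\<forall>\<^sub>F n in sequentially. \<forall>z\<in>S. \<forall>u. cmod u \<le> R0 \<longrightarrow>
        \<bar>2 * pi * w z * kern \<phi> n (z * exp (u / of_nat n)) / real n - ref_sum n n (Re u) / real n\<bar> \<le> \<epsilon>"
      using ev1 ev2 ev3
    proof eventually_elim
      case (elim n)
      have n: "2 * R \<le> real n" "0 < n" "W1 * o1 n < \<gamma> / 2" "o2 n < W0 * \<gamma> / 2" using elim by auto
      show ?case
      proof (intro ballI allI impI)
        fix z u assume z: "z \<in> S" and u: "cmod u \<le> R0"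
        have uR: "cmod u \<le> R" "\<bar>Re u\<bar> \<le> R" using u abs_Re_le_cmod[of u] by (auto simp: R_def)
        have zc: "z \<in> unit_circle" using z S by auto
        define \<zeta> where "\<zeta> = z * exp (u / of_nat n)"
        define pk where "pk = cmod (poly (peak z) \<zeta>) ^ (2 * m n)"
        have pk: "1 - \<gamma> \<le> pk"
        proof -
          have "2 * real (m n) * R / real n \<le> 2 * (\<eta> * real n) * R / real n"
            using m[of n] n by (intro divide_right_mono mult_right_mono) (auto simp: R_def)
          also have "\<dots> = 2 * R * \<eta>" using n by simp
          finally show ?thesis
            using peak_near[OF zc uR(1) n(1,2), of "m n"] \<eta>(4) unfolding pk_def \<zeta>_def by linarith
        qed
        define K where "K = kern \<phi> n \<zeta>"
        have K: "0 \<le> K" by (simp add: K_def kern_nonneg)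
        have wz: "W0 \<le> w z" "w z \<le> W1" "0 < w z - \<epsilon>1" "0 < w z" using W z \<epsilon>1 by fastforce+
        define T where "T N = ref_sum N n (Re u)" for N
        have kT: "kern circle_monom N \<zeta> = T N / (2 * pi)" for N
          unfolding \<zeta>_def T_def by (rule kern_circle_monom_exp[OF zc])
        have mexp: "real (m n) * exp (4 * R) \<le> \<gamma> * real n"
        proof -
          have "real (m n) * exp (4 * R) \<le> \<eta> * real n * exp (4 * R)" by (intro mult_right_mono m) simp
          also have "\<dots> = \<eta> * exp (4 * R) * real n" by (simp only: mult_ac)
          also have "\<dots> \<le> \<gamma> * real n" by (intro mult_right_mono \<eta>) simp
          finally show ?thesis .
        qed
        have Tup: "T (n + m n) \<le> T n + \<gamma> * real n"
          using ref_sum_diff(2)[of n "n + m n" n "Re u" R] mn[of n] uR n mexp by (simp add: T_def)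
        have Tlo: "T n - \<gamma> * real n \<le> T (n - m n)"
          using ref_sum_diff(2)[of "n - m n" n n "Re u" R] mn[of n] uR n mexp by (simp add: T_def)
        have T0: "0 \<le> T N" for N by (simp add: T_def ref_sum_def sum_nonneg)
        \<comment> \<open>Upper bound for \<open>K\<close>: \<open>\<mu>\<close> supplies the
          extremal polynomial, and the model kernel has the larger degree.\<close>
        have "pk * K \<le> kern circle_monom (n + m n) \<zeta> *
           (1 / (w z - \<epsilon>1) + (1 - \<delta>\<^sup>2 / 4) ^ m n * measure arclength UNIV * (C * (1 + \<delta>2)^n))"
          unfolding pk_def K_def
        proof (rule kern_comparison[OF sys arc zc \<delta>])
          fix f :: "complex \<Rightarrow> ennreal" assume f: "f \<in> borel_measurable borel"
          let ?a = "\<integral>\<^sup>+y. f y * indicator (ball z \<delta>) y \<partial>arclength"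
          have "?a = ennreal (1 / (w z - \<epsilon>1)) * (ennreal (w z - \<epsilon>1) * ?a)"
            using wz(3) by (simp add: mult.assoc[symmetric] ennreal_mult[symmetric])
          also have "\<dots> \<le> ennreal (1 / (w z - \<epsilon>1)) * (\<integral>\<^sup>+y. f y * indicator (ball z \<delta>) y \<partial>\<mu>)"
            by (intro mult_left_mono lo z f) auto
          finally show "?a \<le> ennreal (1 / (w z - \<epsilon>1)) * (\<integral>\<^sup>+y. f y * indicator (ball z \<delta>) y \<partial>\<mu>)" .
        qed (use wz(3) C(2) in auto)
        also have "\<dots> = T (n + m n) / (2 * pi) * (1 / (w z - \<epsilon>1) + o1 n)"
          by (simp add: kT \<kappa>_def[symmetric] measure_arclength_UNIV o1_def)
        finally have U1: "pk * K \<le> T (n + m n) / (2 * pi) * (1 / (w z - \<epsilon>1) + o1 n)" .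
        have o1: "0 \<le> o1 n" using \<kappa> C \<delta>2 by (simp add: o1_def)
        have "w z * (1 / (w z - \<epsilon>1)) \<le> 1 + \<gamma> / 2"
        proof -
          have "\<epsilon>1 * (1 + \<gamma> / 2) \<le> W0 * \<gamma> / 4 * 2"
            unfolding \<epsilon>1_def using W(1) \<gamma> by (intro mult_mono) auto
          also have "\<dots> \<le> w z * \<gamma> / 2" using wz \<gamma> by simp
          finally show ?thesis using wz(3) by (simp add: field_simps)
        qed
        moreover have "w z * o1 n \<le> \<gamma> / 2"
          using mult_right_mono[OF wz(2) o1] n(3) by linarith
        ultimately have U2: "w z * (1 / (w z - \<epsilon>1) + o1 n) \<le> 1 + \<gamma>"
          by (simp add: distrib_left)
        have "(1 - \<gamma>) * (2 * pi * w z * K / n) \<le> pk * (2 * pi * w z * K / n)"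
          using pk wz K by (intro mult_right_mono) auto
        also have "\<dots> = 2 * pi * w z / n * (pk * K)" by simp
        also have "\<dots> \<le> 2 * pi * w z / n * (T (n + m n) / (2 * pi) * (1 / (w z - \<epsilon>1) + o1 n))"
          using wz by (intro mult_left_mono U1) auto
        also have "\<dots> = T (n + m n) / n * (w z * (1 / (w z - \<epsilon>1) + o1 n))" by simp
        also have "\<dots> \<le> (T n / n + \<gamma>) * (1 + \<gamma>)"
        proof (intro mult_mono U2)
          show "T (n + m n) / n \<le> T n / n + \<gamma>" using Tup n(2) by (simp add: field_simps)
          show "0 \<le> T n / n + \<gamma>" using T0[of n] \<gamma> by simp
        qed (use wz o1 in auto)
        finally have U: "(1 - \<gamma>) * (2 * pi * w z * K / n) \<le> (T n / n + \<gamma>) * (1 + \<gamma>)" .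
        \<comment> \<open>Lower bound for \<open>K\<close>: the roles are exchanged, starting from
          degree \<open>n - m n\<close> so that the trial polynomial has degree at most
          \<open>n\<close>.\<close>
        have "pk * kern circle_monom (n - m n) \<zeta> \<le> kern \<phi> (n - m n + m n) \<zeta> *
           ((w z + \<epsilon>1) + (1 - \<delta>\<^sup>2 / 4) ^ m n * measure \<mu> UNIV * (real n + 1))"
          unfolding pk_def
        proof (rule kern_comparison[OF arc sys zc \<delta>])
          fix y :: complex assume y: "y \<in> unit_circle"
          have "kern circle_monom (n - m n) y \<le> kern circle_monom n y" by (rule kern_mono) simp
          also have "\<dots> = (real n + 1) / (2 * pi)" using y by (simp add: kern_circle_monom)
          also have "\<dots> \<le> (real n + 1) / 1" using pi_gt3 by (intro divide_left_mono) auto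
          finally show "kern circle_monom (n - m n) y \<le> real n + 1" by simp
        next
          show "0 \<le> w z + \<epsilon>1" using wz \<epsilon>1 by linarith
        qed (rule up[OF z])
        also have "\<dots> = K * (w z + \<epsilon>1 + o2 n)"
          using mn[of n] by (simp add: \<kappa>_def[symmetric] \<mu>1 o2_def K_def)
        finally have L1: "pk * (T (n - m n) / (2 * pi)) \<le> K * (w z + \<epsilon>1 + o2 n)" by (simp only: kT)
        have "W0 * \<gamma> \<le> w z * \<gamma>" "0 < W0 * \<gamma>" using wz(1) \<gamma>(1) W(1) by auto
        then have "\<epsilon>1 \<le> w z * \<gamma> / 2" "o2 n \<le> w z * \<gamma> / 2"
          using n(4) unfolding \<epsilon>1_def by linarith+
        then have L2: "w z + \<epsilon>1 + o2 n \<le> w z * (1 + \<gamma>)" by (simp add: algebra_simps)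
        have "(T n / n - \<gamma>) * (1 - \<gamma>) \<le> (T (n - m n) / n) * pk"
        proof -
          have "(T n / n - \<gamma>) * (1 - \<gamma>) \<le> (T (n - m n) / n) * (1 - \<gamma>)"
          proof (rule mult_right_mono)
            have "(T n - \<gamma> * real n) / n \<le> T (n - m n) / n" by (intro divide_right_mono Tlo) simp
            then show "T n / n - \<gamma> \<le> T (n - m n) / n" using n(2) by (simp add: diff_divide_distrib)
          qed (use \<gamma> in simp)
          also have "\<dots> \<le> (T (n - m n) / n) * pk" using T0 pk by (intro mult_left_mono) auto
          finally show ?thesis .
        qed
        also have "\<dots> = 2 * pi / n * (pk * (T (n - m n) / (2 * pi)))" by simp
        also have "\<dots> \<le> 2 * pi / n * (K * (w z * (1 + \<gamma>)))"
          using L1 mult_left_mono[OF L2 K] by (intro mult_left_mono) auto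
        also have "\<dots> = (2 * pi * w z * K / n) * (1 + \<gamma>)" by simp
        finally have L: "(T n / n - \<gamma>) * (1 - \<gamma>) \<le> (2 * pi * w z * K / n) * (1 + \<gamma>)" .
        have "T n / n \<le> A"
          using ref_sum_le[OF uR(2) n(2)] n(2) by (simp add: T_def A_def divide_le_eq mult.commute)
        then have "\<bar>2 * pi * w z * K / n - T n / n\<bar> \<le> \<gamma> * (6 * A + 6)"
          using U L T0[of n] wz K \<gamma> by (intro squeeze_estimate) auto
        then show "\<bar>2 * pi * w z * kern \<phi> n (z * exp (u / of_nat n)) / real n - ref_sum n n (Re u) / real n\<bar> \<le> \<epsilon>"
          using \<gamma>(3) by (simp add: K_def T_def \<zeta>_def)
      qed
    qed
  qed
qed

section \<open>Logarithmic moments of complex Gaussian sums\<close>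

text \<open>\<open>Re (c * X)\<close> is a combination of the two independent parts. Purely real or
  imaginary \<open>c\<close> is split off because a normal law of variance zero has no
  density.\<close>

lemma (in prob_space) distributed_Re_cmult_gaussian:
  assumes X: "complex_std_gaussian M X" and c: "c \<noteq> 0"
  shows "distributed M lborel (\<lambda>\<omega>. Re (c * X \<omega>)) (normal_density 0 (cmod c))"
proof -
  have re: "distributed M lborel (\<lambda>\<omega>. Re (X \<omega>)) std_normal_density"
    and im: "distributed M lborel (\<lambda>\<omega>. Im (X \<omega>)) std_normal_density"
    and ind: "indep_var borel (\<lambda>\<omega>. Re (X \<omega>)) borel (\<lambda>\<omega>. Im (X \<omega>))"
    using X unfolding complex_std_gaussian_def by blast+
  have 1: "distributed M lborel (\<lambda>\<omega>. Re c * Re (X \<omega>)) (normal_density 0 \<bar>Re c\<bar>)" if "Re c \<noteq> 0"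
    using normal_density_affine[OF re _ that, of 0] by simp
  have 2: "distributed M lborel (\<lambda>\<omega>. - Im c * Im (X \<omega>)) (normal_density 0 \<bar>Im c\<bar>)" if "Im c \<noteq> 0"
    using normal_density_affine[OF im, of "- Im c" 0] that by simp
  consider "Re c = 0" "Im c \<noteq> 0" | "Im c = 0" "Re c \<noteq> 0" | "Re c \<noteq> 0" "Im c \<noteq> 0"
    using c by (auto simp: complex_eq_iff)
  then show ?thesis
  proof cases
    case 1 then show ?thesis using 2 by (simp add: cmod_def)
  next
    case 2 then show ?thesis using 1 by (simp add: cmod_def)
  next
    case 3
    have "indep_var borel ((\<lambda>x. Re c * x) \<circ> (\<lambda>\<omega>. Re (X \<omega>))) borel ((\<lambda>x. - Im c * x) \<circ> (\<lambda>\<omega>. Im (X \<omega>)))"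
      by (rule indep_var_compose[OF ind]) auto
    then have "distributed M lborel (\<lambda>\<omega>. Re c * Re (X \<omega>) + - Im c * Im (X \<omega>))
        (normal_density (0 + 0) (sqrt (\<bar>Re c\<bar>\<^sup>2 + \<bar>Im c\<bar>\<^sup>2)))"
      using 3 1 2 by (intro add_indep_normal) (auto simp: comp_def)
    then show ?thesis by (simp add: cmod_def)
  qed
qed

lemma (in prob_space) distributed_Re_sum_gaussian:
  assumes \<eta>: "iid_complex_std_gaussian M \<eta>" and c: "j \<le> n" "c j \<noteq> 0"
  shows "distributed M lborel (\<lambda>\<omega>. Re (\<Sum>j\<le>n. c j * \<eta> j \<omega>)) (normal_density 0 (sqrt (\<Sum>j\<le>n. (cmod (c j))\<^sup>2)))"
proof -
  \<comment> \<open>Vanishing coefficients would give degenerate summands without density, so they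
    are dropped before adding.\<close>
  define J where "J = {j. j \<le> n \<and> c j \<noteq> 0}"
  have J: "finite J" "J \<noteq> {}" "J \<subseteq> {..n}" using c by (auto simp: J_def)
  have ind: "indep_vars (\<lambda>_. borel) \<eta> UNIV" and g: "\<And>j. complex_std_gaussian M (\<eta> j)"
    using \<eta> by (auto simp: iid_complex_std_gaussian_def)
  have "indep_vars (\<lambda>_. borel) (\<lambda>j \<omega>. Re (c j * \<eta> j \<omega>)) UNIV"
    by (rule indep_vars_compose2[OF ind]) measurable
  then have "indep_vars (\<lambda>_. borel) (\<lambda>j \<omega>. Re (c j * \<eta> j \<omega>)) J"
    by (rule indep_vars_subset) simp
  then have "distributed M lborel (\<lambda>\<omega>. \<Sum>j\<in>J. Re (c j * \<eta> j \<omega>))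
      (normal_density (\<Sum>j\<in>J. 0) (sqrt (\<Sum>j\<in>J. (cmod (c j))\<^sup>2)))"
    using J by (intro sum_indep_normal distributed_Re_cmult_gaussian g) (auto simp: J_def)
  moreover have "(\<Sum>j\<in>J. Re (c j * \<eta> j \<omega>)) = Re (\<Sum>j\<le>n. c j * \<eta> j \<omega>)" for \<omega>
    using J unfolding Re_sum by (intro sum.mono_neutral_left) (auto simp: J_def)
  moreover have "(\<Sum>j\<in>J. (cmod (c j))\<^sup>2) = (\<Sum>j\<le>n. (cmod (c j))\<^sup>2)"
    using J by (intro sum.mono_neutral_left) (auto simp: J_def)
  ultimately show ?thesis by simp
qed

section \<open>Logarithm of a normal variable\<close>

lemma set_integrable_ln: "set_integrable lborel {0<..<1} (\<lambda>x::real. - ln x)"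
proof -
  have "set_integrable lborel (einterval 0 1) (\<lambda>x::real. - ln x)"
  proof (rule interval_integral_FTC_nonneg(1)[where F = "\<lambda>x. x - x * ln x" and A = 0 and B = 1])
    show "((((\<lambda>x. x - x * ln x) \<circ> real_of_ereal) \<longlongrightarrow> 0) (at_right 0))"
      unfolding zero_ereal_def ereal_tendsto_simps by real_asymp
    show "((((\<lambda>x. x - x * ln x) \<circ> real_of_ereal) \<longlongrightarrow> 1) (at_left 1))"
      unfolding one_ereal_def ereal_tendsto_simps by real_asymp
    fix x :: real assume x: "0 < ereal x" "ereal x < 1"
    show "((\<lambda>x. x - x * ln x) has_real_derivative - ln x) (at x)"
      using x by (auto intro!: derivative_eq_intros)
    show "isCont (\<lambda>x. - ln x) x" using x by (auto intro!: continuous_intros)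
  qed (auto intro!: AE_I2)
  moreover have "einterval 0 1 = {0<..<1::real}"
    by (auto simp: einterval_def)
  ultimately show ?thesis by simp
qed

text \<open>On \<open>(-1, 1)\<close> the density is at most one and \<open>- ln |x|\<close> is
  integrable; outside, \<open>ln |x| \<le> |x|\<close> and the first absolute moment is
  finite.\<close>

lemma integrable_normal_ln:
  "integrable lborel (\<lambda>x. std_normal_density x * ln \<bar>x\<bar>)"
proof -
  define f where "f x = indicator {0<..<1} x *\<^sub>R (- ln x)" for x :: real
  have f: "integrable lborel f" using set_integrable_ln by (simp add: f_def[abs_def] set_integrable_def)
  have f': "integrable lborel (\<lambda>x. f (- x))"
    using lborel_integrable_real_affine[OF f, of "-1" 0] by simp
  have "integrable lborel (\<lambda>x. std_normal_density x * \<bar>x\<bar>^1)" by (rule integrable_std_normal_moment_abs)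
  then have "integrable lborel (\<lambda>x. f x + f (- x) + std_normal_density x * \<bar>x\<bar>)" using f f' by simp
  then show ?thesis
  proof (rule Bochner_Integration.integrable_bound, goal_cases)
    case 2
    have "\<bar>std_normal_density x * ln \<bar>x\<bar>\<bar> \<le> f x + f (- x) + std_normal_density x * \<bar>x\<bar>" for x
    proof -
      have d: "0 \<le> std_normal_density x" "std_normal_density x \<le> 1"
      proof -
        have "1 \<le> sqrt (2 * pi)" using pi_gt3 by simp
        moreover have "exp (- x\<^sup>2 / 2) \<le> 1" by simp
        ultimately show "std_normal_density x \<le> 1"
          unfolding std_normal_density_def by (intro mult_le_one) auto
      qed simp
      consider "x = 0" | "0 < \<bar>x\<bar>" "\<bar>x\<bar> < 1" | "1 \<le> \<bar>x\<bar>" by linarith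
      then show ?thesis
      proof cases
        case 1 then show ?thesis by (simp add: f_def)
      next
        case 2
        then have l: "ln \<bar>x\<bar> < 0" by simp
        have "\<bar>std_normal_density x * ln \<bar>x\<bar>\<bar> \<le> 1 * (- ln \<bar>x\<bar>)"
          using d l by (simp add: abs_mult mult_left_le_one_le)
        also have "\<dots> \<le> f x + f (- x)" using 2 by (cases "x > 0") (auto simp: f_def)
        finally show ?thesis using d by (simp add: add_increasing2)
      next
        case 3
        then have "0 < \<bar>x\<bar>" by linarith
        then have "ln \<bar>x\<bar> \<le> \<bar>x\<bar> - 1" by (rule ln_le_minus_one)
        then have l: "0 \<le> ln \<bar>x\<bar>" "ln \<bar>x\<bar> \<le> \<bar>x\<bar>" using 3 by auto
        have "\<bar>std_normal_density x * ln \<bar>x\<bar>\<bar> \<le> std_normal_density x * \<bar>x\<bar>"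
          using d l by (simp add: abs_mult mult_left_mono)
        moreover have "f x = 0" "f (- x) = 0" using 3 by (auto simp: f_def indicator_def)
        ultimately show ?thesis by simp
      qed
    qed
    then show ?case by (intro always_eventually) (auto intro: order.trans[OF _ abs_ge_self])
  qed simp
qed

definition gauss_ln :: real where "gauss_ln = (\<integral>x. std_normal_density x * ln \<bar>x\<bar> \<partial>lborel)"
definition gauss_abs_ln :: real where "gauss_abs_ln = (\<integral>x. std_normal_density x * \<bar>ln \<bar>x\<bar>\<bar> \<partial>lborel)"
definition gauss_abs :: real where "gauss_abs = (\<integral>x. std_normal_density x * \<bar>x\<bar> \<partial>lborel)"

lemma (in prob_space) normal_logarithm:
  assumes X: "distributed M lborel X (normal_density 0 \<sigma>)" and \<sigma>: "0 < \<sigma>"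
  shows "AE \<omega> in M. X \<omega> \<noteq> 0" "integrable M (\<lambda>\<omega>. ln \<bar>X \<omega>\<bar>)" "integrable M X"
    "expectation (\<lambda>\<omega>. ln \<bar>X \<omega>\<bar>) = ln \<sigma> + gauss_ln"
    "expectation (\<lambda>\<omega>. \<bar>ln \<bar>X \<omega>\<bar>\<bar>) \<le> \<bar>ln \<sigma>\<bar> + gauss_abs_ln"
    "expectation (\<lambda>\<omega>. \<bar>X \<omega>\<bar>) = \<sigma> * gauss_abs"
proof -
  have [measurable]: "X \<in> borel_measurable M" using X by (auto simp: distributed_def)
  define Z where "Z \<omega> = X \<omega> / \<sigma>" for \<omega>
  have Z: "distributed M lborel Z std_normal_density"
    using normal_standard_normal_convert[of \<sigma> X 0] X \<sigma> by (simp add: Z_def[abs_def])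
  have [measurable]: "Z \<in> borel_measurable M" using Z by (auto simp: distributed_def)
  have XZ: "X \<omega> = \<sigma> * Z \<omega>" for \<omega> using \<sigma> by (simp add: Z_def)
  have "AE x in lborel. 0 < ennreal (std_normal_density x) \<longrightarrow> x \<noteq> 0"
    using AE_lborel_singleton[of 0] by eventually_elim simp
  then have "AE \<omega> in M. Z \<omega> \<noteq> 0"
    using distributed_AE2[OF Z, of "\<lambda>x. x \<noteq> 0"] by simp
  then show ne: "AE \<omega> in M. X \<omega> \<noteq> 0" by eventually_elim (use \<sigma> in \<open>simp add: XZ\<close>)
  note dI = distributed_integrable[OF Z, simplified] and dE = distributed_integral[OF Z, simplified]
  have iZ: "integrable M (\<lambda>\<omega>. ln \<bar>Z \<omega>\<bar>)"
    using dI[of "\<lambda>x. ln \<bar>x\<bar>"] integrable_normal_ln by simp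
  have eZ: "expectation (\<lambda>\<omega>. ln \<bar>Z \<omega>\<bar>) = gauss_ln"
    using dE[of "\<lambda>x. ln \<bar>x\<bar>"] by (simp add: gauss_ln_def)
  have aZ: "expectation (\<lambda>\<omega>. \<bar>ln \<bar>Z \<omega>\<bar>\<bar>) = gauss_abs_ln"
    using dE[of "\<lambda>x. \<bar>ln \<bar>x\<bar>\<bar>"] by (simp add: gauss_abs_ln_def)
  have iA: "integrable M Z"
    using dI[of "\<lambda>x. x"] integrable_std_normal_moment[of 1] by simp
  have eA: "expectation (\<lambda>\<omega>. \<bar>Z \<omega>\<bar>) = gauss_abs"
    using dE[of "\<lambda>x. \<bar>x\<bar>"] by (simp add: gauss_abs_def)
  have AE: "AE \<omega> in M. ln \<bar>X \<omega>\<bar> = ln \<sigma> + ln \<bar>Z \<omega>\<bar>"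
    using ne by eventually_elim (use \<sigma> in \<open>simp add: XZ abs_mult ln_mult\<close>)
  have iL: "integrable M (\<lambda>\<omega>. ln \<sigma> + ln \<bar>Z \<omega>\<bar>)" using iZ by simp
  show iX: "integrable M (\<lambda>\<omega>. ln \<bar>X \<omega>\<bar>)"
    by (rule integrable_cong_AE_imp[OF iL]) (use AE in auto)
  show "integrable M X" using iA unfolding XZ[abs_def] by simp
  have "expectation (\<lambda>\<omega>. ln \<bar>X \<omega>\<bar>) = expectation (\<lambda>\<omega>. ln \<sigma> + ln \<bar>Z \<omega>\<bar>)"
    by (rule integral_cong_AE) (use AE in auto)
  also have "\<dots> = ln \<sigma> + gauss_ln" using iZ eZ prob_space by simp
  finally show "expectation (\<lambda>\<omega>. ln \<bar>X \<omega>\<bar>) = ln \<sigma> + gauss_ln" .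
  have "expectation (\<lambda>\<omega>. \<bar>ln \<bar>X \<omega>\<bar>\<bar>) \<le> expectation (\<lambda>\<omega>. \<bar>ln \<sigma>\<bar> + \<bar>ln \<bar>Z \<omega>\<bar>\<bar>)"
    using iX iZ AE by (intro integral_mono_AE) auto
  also have "\<dots> = \<bar>ln \<sigma>\<bar> + gauss_abs_ln" using iZ aZ prob_space by simp
  finally show "expectation (\<lambda>\<omega>. \<bar>ln \<bar>X \<omega>\<bar>\<bar>) \<le> \<bar>ln \<sigma>\<bar> + gauss_abs_ln" .
  show "expectation (\<lambda>\<omega>. \<bar>X \<omega>\<bar>) = \<sigma> * gauss_abs"
    using \<sigma> eA by (simp add: XZ abs_mult)
qed

lemma nn_integral_periodic_shift:
  fixes F :: "real \<Rightarrow> ennreal"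
  assumes [measurable]: "F \<in> borel_measurable borel" and per: "\<And>t. F (t + 2 * pi) = F t"
    and \<theta>: "0 \<le> \<theta>" "\<theta> \<le> 2 * pi"
  shows "(\<integral>\<^sup>+t. F (t + \<theta>) * indicator {-pi..<pi} t \<partial>lborel) = (\<integral>\<^sup>+t. F t * indicator {-pi..<pi} t \<partial>lborel)"
proof -
  have "(\<integral>\<^sup>+t. F (t + \<theta>) * indicator {-pi..<pi} t \<partial>lborel)
      = (\<integral>\<^sup>+t. F t * indicator {\<theta> - pi..<\<theta> + pi} t \<partial>lborel)"
    by (subst nn_integral_real_affine[where c = 1 and t = \<theta>])
       (auto intro!: nn_integral_cong simp: indicator_def add.commute)
  also have "\<dots> = (\<integral>\<^sup>+t. F t * indicator {\<theta> - pi..<pi} t + F t * indicator {pi..<\<theta> + pi} t \<partial>lborel)"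
    using \<theta> by (intro nn_integral_cong) (auto simp: indicator_def)
  also have "\<dots> = (\<integral>\<^sup>+t. F t * indicator {\<theta> - pi..<pi} t \<partial>lborel) + (\<integral>\<^sup>+t. F t * indicator {pi..<\<theta> + pi} t \<partial>lborel)"
    by (rule nn_integral_add) auto
  also have "(\<integral>\<^sup>+t. F t * indicator {pi..<\<theta> + pi} t \<partial>lborel) = (\<integral>\<^sup>+t. F t * indicator {-pi..<\<theta> - pi} t \<partial>lborel)"
    by (subst nn_integral_real_affine[where c = 1 and t = "2 * pi"])
       (auto intro!: nn_integral_cong simp: indicator_def add.commute[of "2 * pi"] per)
  also have "(\<integral>\<^sup>+t. F t * indicator {\<theta> - pi..<pi} t \<partial>lborel) + (\<integral>\<^sup>+t. F t * indicator {-pi..<\<theta> - pi} t \<partial>lborel)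
     = (\<integral>\<^sup>+t. F t * indicator {\<theta> - pi..<pi} t + F t * indicator {-pi..<\<theta> - pi} t \<partial>lborel)"
    by (rule nn_integral_add[symmetric]) auto
  also have "\<dots> = (\<integral>\<^sup>+t. F t * indicator {-pi..<pi} t \<partial>lborel)"
    using \<theta> by (intro nn_integral_cong) (auto simp: indicator_def)
  finally show ?thesis .
qed

text \<open>Its value is \<open>2 * pi * ln 2\<close>, but only that it is a finite constant
  matters, and finiteness will follow from the Gaussian moments.\<close>

definition cos_defect :: ennreal where
  "cos_defect = (\<integral>\<^sup>+t. ennreal (- ln \<bar>cos t\<bar>) * indicator {-pi..<pi} t \<partial>lborel)"

text \<open>\<open>Re (cis t * x) = cmod x * cos (t + \<theta>)\<close>, so the modulus cancels and
  the phase is removed by periodicity. The value \<open>0\<close> at a vanishing real part matches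
  the convention \<open>ln 0 = 0\<close>.\<close>

lemma nn_integral_ln_Re_rotation:
  assumes "x \<noteq> 0"
  shows "(\<integral>\<^sup>+t. ennreal (if Re (cis t * x) = 0 then 0 else ln (cmod x) - ln \<bar>Re (cis t * x)\<bar>) * indicator {-pi..<pi} t \<partial>lborel) = cos_defect"
proof -
  define \<theta> where "\<theta> = Arg2pi x"
  have \<theta>: "0 \<le> \<theta>" "\<theta> \<le> 2 * pi" "x = of_real (cmod x) * cis \<theta>"
    using Arg2pi[of x] by (auto simp: \<theta>_def cis_conv_exp mult_ac is_Arg_def)
  have Re: "Re (cis t * x) = cmod x * cos (t + \<theta>)" for t
    by (subst \<theta>(3)) (simp add: cos_add algebra_simps)
  have "(if Re (cis t * x) = 0 then 0 else ln (cmod x) - ln \<bar>Re (cis t * x)\<bar>) = - ln \<bar>cos (t + \<theta>)\<bar>" for t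
    unfolding Re using assms by (auto simp: abs_mult ln_mult)
  then show ?thesis unfolding cos_defect_def
    by (simp only:) (rule nn_integral_periodic_shift[where F = "\<lambda>t. ennreal (- ln \<bar>cos t\<bar>)"], use \<theta> in auto)
qed

text \<open>The modulus of a rotationally invariant variable is recovered by averaging over all
  rotations of its real part, so that only one-dimensional normal laws are needed.\<close>

definition gauss_const :: real where
  "gauss_const = gauss_ln + enn2real cos_defect / (2 * pi)"

lemma (in prob_space) expectation_ln_gaussian_sum:
  assumes \<eta>: "iid_complex_std_gaussian M \<eta>" and c: "j \<le> n" "c j \<noteq> 0"
  defines "X \<equiv> \<lambda>\<omega>. \<Sum>j\<le>n. c j * \<eta> j \<omega>" and "\<sigma> \<equiv> sqrt (\<Sum>j\<le>n. (cmod (c j))\<^sup>2)"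
  shows "AE \<omega> in M. X \<omega> \<noteq> 0" "integrable M (\<lambda>\<omega>. ln (cmod (X \<omega>)))"
    "expectation (\<lambda>\<omega>. ln (cmod (X \<omega>))) = ln \<sigma> + gauss_const"
    "expectation (\<lambda>\<omega>. \<bar>ln (cmod (X \<omega>))\<bar>) \<le> \<bar>ln \<sigma>\<bar> + gauss_abs_ln + 2 * \<sigma> * gauss_abs"
proof -
  have [measurable]: "\<eta> j \<in> borel_measurable M" for j
    using \<eta> unfolding iid_complex_std_gaussian_def indep_vars_def by auto
  have [measurable]: "X \<in> borel_measurable M" unfolding X_def by measurable
  have "0 < (cmod (c j))\<^sup>2" using c by simp
  also have "\<dots> \<le> (\<Sum>j\<le>n. (cmod (c j))\<^sup>2)" by (rule member_le_sum) (use c in auto)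
  finally have \<sigma>: "0 < \<sigma>" by (simp add: \<sigma>_def)
  \<comment> \<open>A unimodular factor leaves every \<open>cmod (c j)\<close>, and hence the law of
    the real part, unchanged.\<close>
  have dist: "distributed M lborel (\<lambda>\<omega>. Re (a * X \<omega>)) (normal_density 0 \<sigma>)" if "cmod a = 1" for a
  proof -
    have "a \<noteq> 0" using that by auto
    then have "distributed M lborel (\<lambda>\<omega>. Re (\<Sum>j\<le>n. a * c j * \<eta> j \<omega>))
        (normal_density 0 (sqrt (\<Sum>j\<le>n. (cmod (a * c j))\<^sup>2)))"
      using c by (intro distributed_Re_sum_gaussian[OF \<eta> c(1)]) auto
    then show ?thesis
      by (simp only: X_def \<sigma>_def sum_distrib_left mult.assoc norm_mult that mult_1)
  qed
  note rot = normal_logarithm[OF dist \<sigma>]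
  have d1: "distributed M lborel (\<lambda>\<omega>. Re (X \<omega>)) (normal_density 0 \<sigma>)" using dist[of 1] by simp
  have d2: "distributed M lborel (\<lambda>\<omega>. Im (X \<omega>)) (normal_density 0 \<sigma>)" using dist[of "-\<i>"] by simp
  note re = normal_logarithm[OF d1 \<sigma>] and im = normal_logarithm[OF d2 \<sigma>]
  show ne: "AE \<omega> in M. X \<omega> \<noteq> 0" using re(1) by eventually_elim auto
  \<comment> \<open>For modulus at most one the real part alone bounds the logarithm from below;
    above one, the logarithm is at most the modulus.\<close>
  have bd: "AE \<omega> in M. \<bar>ln (cmod (X \<omega>))\<bar> \<le> \<bar>ln \<bar>Re (X \<omega>)\<bar>\<bar> + \<bar>Re (X \<omega>)\<bar> + \<bar>Im (X \<omega>)\<bar>"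
    using re(1)
  proof eventually_elim
    case (elim \<omega>)
    show ?case
    proof (cases "cmod (X \<omega>) \<le> 1")
      case True
      have "ln \<bar>Re (X \<omega>)\<bar> \<le> ln (cmod (X \<omega>))" using elim abs_Re_le_cmod[of "X \<omega>"] by (intro ln_mono) auto
      moreover have "ln (cmod (X \<omega>)) \<le> 0" using True elim by (subst ln_le_zero_iff) auto
      ultimately show ?thesis by linarith
    next
      case False
      then have "0 < cmod (X \<omega>)" by linarith
      then have "ln (cmod (X \<omega>)) \<le> cmod (X \<omega>) - 1" by (rule ln_le_minus_one)
      then have "0 \<le> ln (cmod (X \<omega>))" "ln (cmod (X \<omega>)) \<le> cmod (X \<omega>)" using False by auto
      then show ?thesis using cmod_le[of "X \<omega>"] by linarith
    qed
  qed
  have iB: "integrable M (\<lambda>\<omega>. \<bar>ln \<bar>Re (X \<omega>)\<bar>\<bar> + \<bar>Re (X \<omega>)\<bar> + \<bar>Im (X \<omega>)\<bar>)"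
    using re(2,3) im(3) by simp
  show iX: "integrable M (\<lambda>\<omega>. ln (cmod (X \<omega>)))"
    by (rule Bochner_Integration.integrable_bound[OF iB]) (use bd in \<open>auto elim!: eventually_mono\<close>)
  have "expectation (\<lambda>\<omega>. \<bar>ln (cmod (X \<omega>))\<bar>) \<le> expectation (\<lambda>\<omega>. \<bar>ln \<bar>Re (X \<omega>)\<bar>\<bar> + \<bar>Re (X \<omega>)\<bar> + \<bar>Im (X \<omega>)\<bar>)"
    using iX iB bd by (intro integral_mono_AE) auto
  also have "\<dots> \<le> \<bar>ln \<sigma>\<bar> + gauss_abs_ln + \<sigma> * gauss_abs + \<sigma> * gauss_abs"
    using re im by simp
  finally show "expectation (\<lambda>\<omega>. \<bar>ln (cmod (X \<omega>))\<bar>) \<le> \<bar>ln \<sigma>\<bar> + gauss_abs_ln + 2 * \<sigma> * gauss_abs"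
    by (simp add: mult_ac)
  define h where "h \<omega> t = (if Re (cis t * X \<omega>) = 0 then 0 else ln (cmod (X \<omega>)) - ln \<bar>Re (cis t * X \<omega>)\<bar>)" for \<omega> t
  have [measurable]: "cis \<in> borel_measurable borel"
    by (intro borel_measurable_continuous_onI continuous_intros)
  have [measurable]: "(\<lambda>p. h (fst p) (snd p)) \<in> borel_measurable (M \<Otimes>\<^sub>M lborel)"
    unfolding h_def by measurable
  have h0: "0 \<le> h \<omega> t" for \<omega> t
    using abs_Re_le_cmod[of "cis t * X \<omega>"] by (auto simp: h_def norm_mult intro!: ln_mono simp del: complex_Re_le_cmod)
  define e where "e = expectation (\<lambda>\<omega>. ln (cmod (X \<omega>))) - (ln \<sigma> + gauss_ln)"
  \<comment> \<open>By \<open>dist\<close> the law of \<open>Re (cis t * X)\<close> is the same for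
    all \<open>t\<close>, so the expected defect is one number \<open>e\<close>.\<close>
  have inner: "(\<integral>\<^sup>+\<omega>. ennreal (h \<omega> t) \<partial>M) = ennreal e" "0 \<le> e" for t
  proof -
    have r: "AE \<omega> in M. Re (cis t * X \<omega>) \<noteq> 0" "integrable M (\<lambda>\<omega>. ln \<bar>Re (cis t * X \<omega>)\<bar>)"
      "expectation (\<lambda>\<omega>. ln \<bar>Re (cis t * X \<omega>)\<bar>) = ln \<sigma> + gauss_ln"
      using rot(1,2,4)[of "cis t"] by simp_all
    have AE: "AE \<omega> in M. h \<omega> t = ln (cmod (X \<omega>)) - ln \<bar>Re (cis t * X \<omega>)\<bar>"
      using r(1) by eventually_elim (simp add: h_def)
    have "integrable M (\<lambda>\<omega>. ln (cmod (X \<omega>)) - ln \<bar>Re (cis t * X \<omega>)\<bar>)" using iX r by simp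
    then have ih: "integrable M (\<lambda>\<omega>. h \<omega> t)"
    proof (rule integrable_cong_AE_imp)
      show "(\<lambda>\<omega>. h \<omega> t) \<in> borel_measurable M" unfolding h_def by measurable
      show "AE \<omega> in M. ln (cmod (X \<omega>)) - ln \<bar>Re (cis t * X \<omega>)\<bar> = h \<omega> t"
        using AE by eventually_elim simp
    qed
    have eh: "expectation (\<lambda>\<omega>. h \<omega> t) = e"
    proof -
      have "expectation (\<lambda>\<omega>. h \<omega> t) = expectation (\<lambda>\<omega>. ln (cmod (X \<omega>)) - ln \<bar>Re (cis t * X \<omega>)\<bar>)"
        by (rule integral_cong_AE[OF _ _ AE]) (use ih in measurable)
      then show ?thesis
        using iX r by (simp only: e_def Bochner_Integration.integral_diff)
    qed
    show "(\<integral>\<^sup>+\<omega>. ennreal (h \<omega> t) \<partial>M) = ennreal e"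
      unfolding eh[symmetric] by (rule nn_integral_eq_integral[OF ih]) (simp add: h0)
    show "0 \<le> e" unfolding eh[symmetric] by (rule integral_nonneg_AE) (simp add: h0)
  qed
  interpret L: pair_sigma_finite M lborel ..
  \<comment> \<open>One double integral, two evaluations: over \<open>t\<close> first it is
    \<open>cos_defect\<close>, over the outcome first it is \<open>e * (2 * pi)\<close>. This also
    shows that \<open>cos_defect\<close> is finite.\<close>
  have "(\<integral>\<^sup>+\<omega>. \<integral>\<^sup>+t. ennreal (h \<omega> t) * indicator {-pi..<pi} t \<partial>lborel \<partial>M) = (\<integral>\<^sup>+\<omega>. cos_defect \<partial>M)"
  proof (rule nn_integral_cong_AE)
    show "AE \<omega> in M. (\<integral>\<^sup>+t. ennreal (h \<omega> t) * indicator {-pi..<pi} t \<partial>lborel) = cos_defect"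
      unfolding h_def using ne by eventually_elim (rule nn_integral_ln_Re_rotation)
  qed
  also have "\<dots> = cos_defect" by (simp add: emeasure_space_1)
  finally have "cos_defect = (\<integral>\<^sup>+\<omega>. \<integral>\<^sup>+t. ennreal (h \<omega> t) * indicator {-pi..<pi} t \<partial>lborel \<partial>M)" by simp
  also have "\<dots> = (\<integral>\<^sup>+t. \<integral>\<^sup>+\<omega>. ennreal (h \<omega> t) * indicator {-pi..<pi} t \<partial>M \<partial>lborel)"
    by (rule L.Fubini'[symmetric]) measurable
  also have "\<dots> = (\<integral>\<^sup>+t. ennreal e * indicator {-pi..<pi} t \<partial>lborel)"
  proof (rule nn_integral_cong)
    fix t :: real
    have "(\<lambda>\<omega>. ennreal (h \<omega> t)) \<in> borel_measurable M" unfolding h_def by measurable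
    then show "(\<integral>\<^sup>+\<omega>. ennreal (h \<omega> t) * indicator {-pi..<pi} t \<partial>M) = ennreal e * indicator {-pi..<pi} t"
      by (subst nn_integral_multc) (simp_all only: inner(1))
  qed
  also have "\<dots> = ennreal (e * (2 * pi))"
    using inner(2) by (simp add: nn_integral_cmult_indicator ennreal_mult)
  finally have cd: "cos_defect = ennreal (e * (2 * pi))" .
  have "enn2real cos_defect = e * (2 * pi)"
    unfolding cd using inner(2) by (intro enn2real_ennreal) auto
  then show "expectation (\<lambda>\<omega>. ln (cmod (X \<omega>))) = ln \<sigma> + gauss_const"
    by (simp add: gauss_const_def e_def)
qed

section \<open>A Jensen-type formula with angular weights\<close>

lemma integrable_arclength:
  fixes f :: "complex \<Rightarrow> 'b::{banach, second_countable_topology}"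
  assumes "continuous_on unit_circle f" and [measurable]: "f \<in> borel_measurable borel"
  shows "integrable arclength f"
proof -
  have "compact (f ` unit_circle)" using assms by (intro compact_continuous_image) auto
  then obtain B where B: "\<And>z. z \<in> unit_circle \<Longrightarrow> norm (f z) \<le> B"
    by (force simp: bounded_iff dest!: compact_imp_bounded)
  show ?thesis
    by (rule finite_measure.integrable_const_bound[OF finite_measure_arclength, where B = B])
       (use AE_arclength B in auto)
qed

lemma borel_measurable_poly [measurable]: "poly p \<in> borel_measurable (borel :: complex measure)"
  by (intro borel_measurable_continuous_onI continuous_intros)

lemma arclength_orthogonality:
  "(\<integral>z. z ^ m * cnj (z ^ k) \<partial>arclength) = (if m = k then 2 * pi else 0)"
proof -
  have "z ^ m * cnj (z ^ k) = (2 * pi) * (poly (circle_monom m) z * cnj (poly (circle_monom k) z))" for z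
    by (simp add: circle_monom_def poly_monom field_simps flip: of_real_mult)
  then show ?thesis
    using circle_system.orthonormal[OF circle_system_arclength, of m k] by simp
qed

lemma integral_Re_mult_Re:
  fixes b c :: complex
  shows "(\<integral>z. Re (b * z ^ m) * Re (c * z ^ k) \<partial>arclength) =
     (if m = k then pi * Re (b * cnj c) else 0) + (if m + k = 0 then pi * Re (b * c) else 0)"
proof -
  have i: "integrable arclength (\<lambda>z. b * c * (z ^ (m + k) * cnj (z ^ 0)))"
    "integrable arclength (\<lambda>z. b * cnj c * (z ^ m * cnj (z ^ k)))"
    by (intro integrable_arclength borel_measurable_continuous_onI continuous_intros)+
  have "Re (b * z ^ m) * Re (c * z ^ k) =
      Re (b * c * (z ^ (m + k) * cnj (z ^ 0)) + b * cnj c * (z ^ m * cnj (z ^ k))) / 2" for z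
  proof -
    have "Re u * Re v = Re (u * v + u * cnj v) / 2" for u v by simp
    moreover have "(b * z ^ m) * (c * z ^ k) = b * c * (z ^ (m + k) * cnj (z ^ 0))"
      "(b * z ^ m) * cnj (c * z ^ k) = b * cnj c * (z ^ m * cnj (z ^ k))"
      by (simp_all add: power_add mult_ac)
    ultimately show ?thesis by (simp only:)
  qed
  then have "(\<integral>z. Re (b * z ^ m) * Re (c * z ^ k) \<partial>arclength)
     = Re (\<integral>z. b * c * (z ^ (m + k) * cnj (z ^ 0)) + b * cnj c * (z ^ m * cnj (z ^ k)) \<partial>arclength) / 2"
    using i by (simp only: integral_divide_zero integral_Re Bochner_Integration.integrable_add)
  also have "\<dots> = Re (b * c * (if m + k = 0 then 2 * pi else 0) + b * cnj c * (if m = k then 2 * pi else 0)) / 2"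
    using i by (simp only: Bochner_Integration.integral_add integral_mult_right_zero arclength_orthogonality)
  finally show ?thesis by (auto simp: algebra_simps)
qed

lemma integral_Re_power: "(\<integral>z. Re (c * z ^ k) \<partial>arclength) = (if k = 0 then 2 * pi * Re c else 0)"
  using integral_Re_mult_Re[of 1 0 c k] by (auto split: if_splits)

text \<open>The series of \<open>ln (cmod (1 - b * z))\<close> is integrated term by term, dominated
  by a geometric series; orthogonality leaves only the term of index \<open>k\<close>.\<close>

lemma integral_ln_one_minus:
  fixes b c :: complex
  assumes b: "cmod b < 1"
  shows "(\<integral>z. ln (cmod (1 - b * z)) * Re (c * z ^ k) \<partial>arclength) =
      (if k = 0 then 0 else - (pi / k) * Re (b ^ k * cnj c))"
proof -
  \<comment> \<open>Division by zero makes the term \<open>m = 0\<close> vanish, in accordance with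
    a series that starts at one.\<close>
  define f where "f m z = Re (- (b ^ m) / of_nat m * z ^ m) * Re (c * z ^ k)" for m z
  have fb: "norm (f m z) \<le> cmod b ^ m * cmod c" if "z \<in> unit_circle" for m z
  proof -
    have z: "cmod z = 1" using that by simp
    have "\<bar>Re (- (b ^ m) / of_nat m * z ^ m)\<bar> \<le> cmod b ^ m / real m"
      by (rule order.trans[OF abs_Re_le_cmod]) (simp add: norm_mult norm_divide norm_power z)
    also have "\<dots> \<le> cmod b ^ m"
      using divide_left_mono[of 1 "real m" "cmod b ^ m"] by (cases "m = 0") auto
    finally have 1: "\<bar>Re (- (b ^ m) / of_nat m * z ^ m)\<bar> \<le> cmod b ^ m" .
    have 2: "\<bar>Re (c * z ^ k)\<bar> \<le> cmod c"
      by (rule order.trans[OF abs_Re_le_cmod]) (simp add: norm_mult norm_power z)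
    show ?thesis using mult_mono[OF 1 2] by (simp add: f_def abs_mult)
  qed
  have fi: "integrable arclength (f m)" for m
    unfolding f_def by (intro integrable_arclength borel_measurable_continuous_onI continuous_intros)
  have geo: "summable (\<lambda>m. cmod b ^ m * cmod c)"
    using b by (intro summable_mult2 summable_geometric) auto
  have S: "(\<lambda>m. integral\<^sup>L arclength (f m)) sums (\<integral>z. (\<Sum>m. f m z) \<partial>arclength)"
  proof (rule sums_integral[OF fi])
    show "AE z in arclength. summable (\<lambda>m. norm (f m z))"
      using AE_arclength
      by eventually_elim (use fb in \<open>auto intro: summable_comparison_test'[OF geo]\<close>)
    show "summable (\<lambda>m. \<integral>z. norm (f m z) \<partial>arclength)"
    proof (rule summable_comparison_test'[OF summable_mult2[OF geo, of "2 * pi"]])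
      fix m
      have "(\<integral>z. norm (f m z) \<partial>arclength) \<le> (\<integral>z. cmod b ^ m * cmod c \<partial>arclength)"
      proof (rule integral_mono_AE)
        show "AE z in arclength. norm (f m z) \<le> cmod b ^ m * cmod c"
          using AE_arclength by eventually_elim (rule fb)
      qed (use fi in \<open>auto intro: finite_measure.integrable_const[OF finite_measure_arclength]\<close>)
      also have "\<dots> = cmod b ^ m * cmod c * (2 * pi)"
        using measure_arclength_UNIV sets_eq_imp_space_eq[OF sets_arclength] by simp
      finally show "norm (\<integral>z. norm (f m z) \<partial>arclength) \<le> cmod b ^ m * cmod c * (2 * pi)" by simp
    qed
  qed
  have "(\<integral>z. (\<Sum>m. f m z) \<partial>arclength) = (\<integral>z. ln (cmod (1 - b * z)) * Re (c * z ^ k) \<partial>arclength)"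
  proof (rule integral_cong_AE)
    show "AE z in arclength. (\<Sum>m. f m z) = ln (cmod (1 - b * z)) * Re (c * z ^ k)"
      using AE_arclength
    proof eventually_elim
      case (elim z)
      have bz: "cmod (- (b * z)) < 1" using b elim by (simp add: norm_mult)
      then have "1 - b * z \<noteq> 0" by (metis add.inverse_inverse add_uminus_conv_diff eq_iff_diff_eq_0 less_irrefl norm_minus_cancel norm_one)
      have "(\<lambda>m. Re (- ((- (- (b * z))) ^ m) / of_nat m)) sums Re (ln (1 + - (b * z)))"
        by (rule sums_Re[OF Ln_series'[OF bz]])
      then have "(\<lambda>m. Re (- (b ^ m) / of_nat m * z ^ m)) sums ln (cmod (1 - b * z))"
        using \<open>1 - b * z \<noteq> 0\<close> by (simp add: power_mult_distrib)
      from sums_mult2[OF this, of "Re (c * z ^ k)"] show ?case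
        unfolding f_def by (simp add: sums_iff)
    qed
    show "(\<lambda>z. \<Sum>m. f m z) \<in> borel_measurable arclength"
      using fi by measurable
  qed measurable
  with S have S': "(\<lambda>m. integral\<^sup>L arclength (f m)) sums (\<integral>z. ln (cmod (1 - b * z)) * Re (c * z ^ k) \<partial>arclength)"
    by simp
  have "integral\<^sup>L arclength (f m) = (if m = k then (if k = 0 then 0 else - (pi / k) * Re (b ^ k * cnj c)) else 0)" for m
    unfolding f_def integral_Re_mult_Re by (cases "m = 0") (auto simp: Re_divide_of_nat field_simps)
  then have "(\<lambda>m. integral\<^sup>L arclength (f m)) sums (if k = 0 then 0 else - (pi / k) * Re (b ^ k * cnj c))"
    using sums_single[of k "\<lambda>m. if k = 0 then 0 else - (pi / k) * Re (b ^ k * cnj c)"] by simp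
  with S' show ?thesis using sums_unique2 by blast
qed

text \<open>\<open>log_kernel k\<close> is a fundamental solution of \<open>u'' - k\<^sup>2 u = \<delta>\<close>; it is the \<open>k\<close>-th Fourier mode of
  \<open>ln \<bar>e\<^sup>x z - a\<bar>\<close>.\<close>

definition log_kernel :: "nat \<Rightarrow> real \<Rightarrow> real \<Rightarrow> real" where
  "log_kernel k x p = (if k = 0 then max x p else - exp (- real k * \<bar>x - p\<bar>) / (2 * real k))"

lemma ln_cmod_diff_integrable:
  assumes "a = 0 \<or> x \<noteq> ln (cmod a)"
  shows "integrable arclength (\<lambda>z. ln (cmod (of_real (exp x) * z - a)) * Re (c * z ^ k))"
proof (rule integrable_arclength)
  have "of_real (exp x) * z - a \<noteq> 0" if "cmod z = 1" for z
  proof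
    assume "of_real (exp x) * z - a = 0"
    then have "cmod (of_real (exp x) * z) = cmod a" by simp
    then have "exp x = cmod a" using that by (simp add: norm_mult)
    then show False using assms by (metis exp_not_eq_zero ln_exp norm_zero)
  qed
  then show "continuous_on unit_circle (\<lambda>z. ln (cmod (of_real (exp x) * z - a)) * Re (c * z ^ k))"
    by (intro continuous_intros) auto
qed measurable

text \<open>Pulling the larger of \<open>exp x * z\<close> and \<open>a\<close> out of the
  difference leaves \<open>1 - b * z\<close>, or its conjugate, with
  \<open>cmod b = exp (- \<bar>x - ln (cmod a)\<bar>) < 1\<close>; the modulus is the same in both
  cases.\<close>

lemma integral_ln_cmod_diff:
  assumes a: "a \<noteq> 0" and x: "x \<noteq> ln (cmod a)"
  shows "(\<integral>z. ln (cmod (of_real (exp x) * z - a)) * Re (c * z ^ k) \<partial>arclength)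
     = 2 * pi * log_kernel k x (ln (cmod a)) * Re (c * sgn a ^ k)"
proof -
  have pos: "0 < cmod a" using a by simp
  define M where "M = max x (ln (cmod a))"
  define b where "b = of_real (exp (- \<bar>x - ln (cmod a)\<bar>)) * cnj (sgn a)"
  have sg: "cmod (sgn a) = 1" using a by (simp add: norm_sgn)
  have b: "cmod b < 1" using x sg by (simp add: b_def norm_mult)
  have ea: "exp (ln (cmod a)) = cmod a" using pos by simp
  have asg: "a = of_real (cmod a) * sgn a" using a by (simp add: sgn_eq)
  have key: "ln (cmod (of_real (exp x) * z - a)) = M + ln (cmod (1 - b * z))" if z: "z \<in> unit_circle" for z
  proof -
    have z1: "cmod z = 1" using z by simp
    have nz: "1 - b * z \<noteq> 0"
      using b z1 by (metis eq_iff_diff_eq_0 less_irrefl mult.right_neutral norm_mult norm_one)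
    have "cmod (of_real (exp x) * z - a) = exp M * cmod (1 - b * z)"
    proof (cases "x < ln (cmod a)")
      case True
      have sc: "sgn a * cnj (sgn a) = 1" using sg by (simp add: complex_norm_square[symmetric])
      have "exp (- \<bar>x - ln (cmod a)\<bar>) = exp x / cmod a" using True ea by (simp add: exp_diff)
      then have "of_real (cmod a) * sgn a * (1 - b * z) = of_real (cmod a) * sgn a - of_real (exp x) * z * (sgn a * cnj (sgn a))"
        using pos by (simp add: b_def algebra_simps)
      then have "a - of_real (exp x) * z = of_real (cmod a) * sgn a * (1 - b * z)"
        using asg sc by simp
      then have "cmod (a - of_real (exp x) * z) = cmod a * cmod (1 - b * z)"
        using sg by (simp add: norm_mult)
      then show ?thesis using True ea by (simp add: M_def norm_minus_commute)
    next
      case False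
      have zc: "z * cnj z = 1" using z1 by (simp add: complex_norm_square[symmetric])
      have "exp (- \<bar>x - ln (cmod a)\<bar>) = cmod a / exp x" using False ea by (simp add: exp_diff)
      then have "of_real (exp x) * (z * (1 - cnj b * cnj z)) = of_real (exp x) * z - of_real (cmod a) * sgn a * (z * cnj z)"
        by (simp add: b_def algebra_simps)
      then have "of_real (exp x) * z - a = of_real (exp x) * (z * cnj (1 - b * z))"
        using asg zc by simp
      then have "cmod (of_real (exp x) * z - a) = exp x * cmod (1 - b * z)"
        using z1 by (simp only: norm_mult complex_mod_cnj norm_of_real) simp
      then show ?thesis using False by (simp add: M_def max_def)
    qed
    then show ?thesis using nz by (simp add: ln_mult)
  qed
  have i1: "integrable arclength (\<lambda>z. M * Re (c * z ^ k))"
    by (intro integrable_arclength borel_measurable_continuous_onI continuous_intros)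
  have i2: "integrable arclength (\<lambda>z. ln (cmod (1 - b * z)) * Re (c * z ^ k))"
  proof (rule integrable_arclength)
    have "1 - b * z \<noteq> 0" if "cmod z = 1" for z
      using b that by (metis eq_iff_diff_eq_0 less_irrefl mult.right_neutral norm_mult norm_one)
    then show "continuous_on unit_circle (\<lambda>z. ln (cmod (1 - b * z)) * Re (c * z ^ k))"
      by (intro continuous_intros) auto
  qed measurable
  have "(\<integral>z. ln (cmod (of_real (exp x) * z - a)) * Re (c * z ^ k) \<partial>arclength)
      = (\<integral>z. M * Re (c * z ^ k) + ln (cmod (1 - b * z)) * Re (c * z ^ k) \<partial>arclength)"
  proof (intro integral_cong_AE)
    show "AE z in arclength. ln (cmod (of_real (exp x) * z - a)) * Re (c * z ^ k)
        = M * Re (c * z ^ k) + ln (cmod (1 - b * z)) * Re (c * z ^ k)"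
      using AE_arclength
      by eventually_elim (simp only: key distrib_right)
  qed measurable
  also have "\<dots> = M * (\<integral>z. Re (c * z ^ k) \<partial>arclength) + (\<integral>z. ln (cmod (1 - b * z)) * Re (c * z ^ k) \<partial>arclength)"
    using i1 i2 by (simp only: Bochner_Integration.integral_add integral_mult_right_zero)
  also have "\<dots> = 2 * pi * log_kernel k x (ln (cmod a)) * Re (c * sgn a ^ k)"
  proof (cases "k = 0")
    case True
    then show ?thesis
      unfolding integral_Re_power integral_ln_one_minus[OF b] log_kernel_def M_def by simp
  next
    case False
    have bk: "b ^ k * cnj c = of_real (exp (- real k * \<bar>x - ln (cmod a)\<bar>)) * cnj (c * sgn a ^ k)"
      by (simp add: b_def power_mult_distrib exp_of_nat_mult[symmetric] mult_ac flip: of_real_power)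
    have "Re (of_real r * cnj v) = r * Re v" for r v by simp
    then have "Re (b ^ k * cnj c) = exp (- real k * \<bar>x - ln (cmod a)\<bar>) * Re (c * sgn a ^ k)"
      unfolding bk by (simp only:)
    then show ?thesis using False
      by (simp only: integral_Re_power integral_ln_one_minus[OF b] log_kernel_def if_False) (simp add: field_simps)
  qed
  finally show ?thesis .
qed

text \<open>For an integrand with a kink at \<open>p\<close>. Both primitives vanish at both ends,
  so nothing remains when \<open>p\<close> lies outside the interval.\<close>

lemma has_integral_split_primitive:
  fixes F G h :: "real \<Rightarrow> real"
  assumes "\<alpha> \<le> \<beta>"
    and d1: "\<And>x. x \<in> {\<alpha>..\<beta>} \<Longrightarrow> x \<le> p \<Longrightarrow> (F has_real_derivative hl x) (at x within {\<alpha>..\<beta>})"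
    and d2: "\<And>x. x \<in> {\<alpha>..\<beta>} \<Longrightarrow> p \<le> x \<Longrightarrow> (G has_real_derivative hr x) (at x within {\<alpha>..\<beta>})"
    and eq1: "\<And>x. x \<in> {\<alpha>..\<beta>} \<Longrightarrow> x \<le> p \<Longrightarrow> h x = hl x"
    and eq2: "\<And>x. x \<in> {\<alpha>..\<beta>} \<Longrightarrow> p \<le> x \<Longrightarrow> h x = hr x"
    and bd: "F \<alpha> = 0" "F \<beta> = 0" "G \<alpha> = 0" "G \<beta> = 0"
  shows "(h has_integral (if p \<in> {\<alpha>..\<beta>} then F p - G p else 0)) {\<alpha>..\<beta>}"
proof -
  have A: "(h has_integral (F v - F u)) {u..v}" if "\<alpha> \<le> u" "u \<le> v" "v \<le> \<beta>" "v \<le> p" for u v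
  proof -
    have "(hl has_integral (F v - F u)) {u..v}"
      using that by (intro fundamental_theorem_of_calculus)
        (auto intro!: DERIV_subset[OF d1] simp flip: has_real_derivative_iff_has_vector_derivative)
    then show ?thesis by (rule has_integral_eq[rotated]) (use that in \<open>auto simp: eq1\<close>)
  qed
  have B: "(h has_integral (G v - G u)) {u..v}" if "\<alpha> \<le> u" "u \<le> v" "v \<le> \<beta>" "p \<le> u" for u v
  proof -
    have "(hr has_integral (G v - G u)) {u..v}"
      using that by (intro fundamental_theorem_of_calculus)
        (auto intro!: DERIV_subset[OF d2] simp flip: has_real_derivative_iff_has_vector_derivative)
    then show ?thesis by (rule has_integral_eq[rotated]) (use that in \<open>auto simp: eq2\<close>)
  qed
  consider "p < \<alpha>" | "\<beta> < p" | "p \<in> {\<alpha>..\<beta>}" by force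
  then show ?thesis
  proof cases
    case 1 then show ?thesis using B[of \<alpha> \<beta>] assms(1) bd by simp
  next
    case 2 then show ?thesis using A[of \<alpha> \<beta>] assms(1) bd by simp
  next
    case 3
    then show ?thesis
      using has_integral_combine[OF _ _ A[of \<alpha> p] B[of p \<beta>]] bd by simp
  qed
qed

text \<open>Value and slope vanish at both ends, so the extension by zero is continuously
  differentiable, while \<open>g2\<close> may jump there. That is just enough for two integrations
  by parts without boundary terms.\<close>

locale bump =
  fixes \<alpha> \<beta> :: real and g g1 g2 :: "real \<Rightarrow> real"
  assumes ab: "\<alpha> < \<beta>"
    and g1: "\<And>x. x \<in> {\<alpha>..\<beta>} \<Longrightarrow> (g has_real_derivative g1 x) (at x within {\<alpha>..\<beta>})"
    and g2: "\<And>x. x \<in> {\<alpha>..\<beta>} \<Longrightarrow> (g1 has_real_derivative g2 x) (at x within {\<alpha>..\<beta>})"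
    and g2_cont: "continuous_on {\<alpha>..\<beta>} g2"
    and bd: "g \<alpha> = 0" "g \<beta> = 0" "g1 \<alpha> = 0" "g1 \<beta> = 0"
begin

definition gt :: "real \<Rightarrow> real" where "gt x = (if x \<in> {\<alpha>..\<beta>} then g x else 0)"

lemma g_cont: "continuous_on {\<alpha>..\<beta>} g" "continuous_on {\<alpha>..\<beta>} g1"
  by (auto intro!: DERIV_continuous_on g1 g2)

text \<open>Two integrations by parts on each side of \<open>p\<close>. The kernel solves the
  homogeneous equation there, and the unit jump of its slope at \<open>p\<close> leaves exactly
  \<open>g p\<close>.\<close>

lemma log_kernel_has_integral:
  "((\<lambda>x. (g2 x - (real k)\<^sup>2 * g x) * log_kernel k x p) has_integral gt p) {\<alpha>..\<beta>}"
proof (cases "k = 0")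
  case True
  have "((\<lambda>x. (g2 x - (real k)\<^sup>2 * g x) * log_kernel k x p) has_integral
     (if p \<in> {\<alpha>..\<beta>} then p * g1 p - (p * g1 p - g p) else 0)) {\<alpha>..\<beta>}"
    by (rule has_integral_split_primitive[where F = "\<lambda>x. p * g1 x" and hl = "\<lambda>x. p * g2 x"
         and G = "\<lambda>x. x * g1 x - g x" and hr = "\<lambda>x. x * g2 x"])
       (use True ab bd in \<open>auto intro!: derivative_eq_intros g1 g2 simp: log_kernel_def\<close>)
  then show ?thesis by (cases "p \<in> {\<alpha>..\<beta>}") (auto simp: gt_def)
next
  case False
  define K where "K = real k"
  have K: "0 < K" using False by (simp add: K_def)
  have "((\<lambda>x. (g2 x - K\<^sup>2 * g x) * log_kernel k x p) has_integral
     (if p \<in> {\<alpha>..\<beta>} then - (g1 p - K * g p) * exp (K * (p - p)) / (2 * K)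
         - (- (g1 p + K * g p) * exp (- K * (p - p)) / (2 * K)) else 0)) {\<alpha>..\<beta>}"
    by (rule has_integral_split_primitive[where
           F = "\<lambda>x. - (g1 x - K * g x) * exp (K * (x - p)) / (2 * K)"
           and hl = "\<lambda>x. - (g2 x - K\<^sup>2 * g x) * exp (K * (x - p)) / (2 * K)"
           and G = "\<lambda>x. - (g1 x + K * g x) * exp (- K * (x - p)) / (2 * K)"
           and hr = "\<lambda>x. - (g2 x - K\<^sup>2 * g x) * exp (- K * (x - p)) / (2 * K)"])
       (use False K ab bd in \<open>auto intro!: derivative_eq_intros g1 g2
           simp: log_kernel_def K_def[symmetric] field_simps power2_eq_square\<close>)
  also have "(if p \<in> {\<alpha>..\<beta>} then - (g1 p - K * g p) * exp (K * (p - p)) / (2 * K)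
         - (- (g1 p + K * g p) * exp (- K * (p - p)) / (2 * K)) else 0) = gt p"
    using K by (simp add: gt_def field_simps)
  finally show ?thesis by (simp add: K_def)
qed

text \<open>Second derivatives of bumps annihilate affine functions. This removes the leading
  coefficient and the zeros at the origin, whose logarithm is linear in \<open>x\<close>.\<close>

lemma affine_has_integral: "((\<lambda>x. g2 x * (A + B * x)) has_integral 0) {\<alpha>..\<beta>}"
proof -
  have "((\<lambda>x. g2 x * (A + B * x)) has_integral
     ((A + B * \<beta>) * g1 \<beta> - B * g \<beta>) - ((A + B * \<alpha>) * g1 \<alpha> - B * g \<alpha>)) {\<alpha>..\<beta>}"
    using ab by (intro fundamental_theorem_of_calculus)
      (auto intro!: derivative_eq_intros g1 g2 simp flip: has_real_derivative_iff_has_vector_derivative)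
  then show ?thesis by (simp add: bd)
qed

end

lemma integrable_indicator_mult:
  fixes h :: "real \<Rightarrow> real"
  assumes "continuous_on {a..b} h"
  shows "integrable lborel (\<lambda>x. indicator {a..b} x * h x)"
  using borel_integrable_atLeastAtMost'[OF assms] by (simp add: set_integrable_def)

lemma lborel_integral_of_has_integral:
  fixes h :: "real \<Rightarrow> real"
  assumes "(h has_integral I) {a..b}" "continuous_on {a..b} h"
  shows "integrable lborel (\<lambda>x. indicator {a..b} x * h x)" "(\<integral>x. indicator {a..b} x * h x \<partial>lborel) = I"
proof -
  have s: "set_integrable lborel {a..b} h" by (rule borel_integrable_atLeastAtMost'[OF assms(2)])
  then show "integrable lborel (\<lambda>x. indicator {a..b} x * h x)" by (simp add: set_integrable_def)
  have "(LINT x:{a..b}|lborel. h x) = I"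
    using set_borel_integral_eq_integral(2)[OF s] assms(1) by (simp add: integral_unique)
  then show "(\<integral>x. indicator {a..b} x * h x \<partial>lborel) = I" by (simp add: set_lebesgue_integral_def)
qed

context bump
begin

definition gt2 :: "real \<Rightarrow> real" where "gt2 x = (if x \<in> {\<alpha>..\<beta>} then g2 x else 0)"

lemma gt_measurable [measurable]: "gt \<in> borel_measurable borel" "gt2 \<in> borel_measurable borel"
proof -
  have "(\<lambda>x. indicator {\<alpha>..\<beta>} x *\<^sub>R g x) \<in> borel_measurable borel"
    "(\<lambda>x. indicator {\<alpha>..\<beta>} x *\<^sub>R g2 x) \<in> borel_measurable borel"
    by (rule borel_measurable_continuous_on_indicator; simp add: g_cont g2_cont)+
  moreover have "(\<lambda>x. indicator {\<alpha>..\<beta>} x *\<^sub>R g x) = gt" "(\<lambda>x. indicator {\<alpha>..\<beta>} x *\<^sub>R g2 x) = gt2"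
    by (auto simp: gt_def gt2_def fun_eq_iff)
  ultimately show "gt \<in> borel_measurable borel" "gt2 \<in> borel_measurable borel" by simp_all
qed

lemma gt_indicator: "gt2 x - K * gt x = indicator {\<alpha>..\<beta>} x * (g2 x - K * g x)"
  by (simp add: gt_def gt2_def)

lemma log_kernel_integral:
  "integrable lborel (\<lambda>x. (gt2 x - (real k)\<^sup>2 * gt x) * log_kernel k x p)"
  "(\<integral>x. (gt2 x - (real k)\<^sup>2 * gt x) * log_kernel k x p \<partial>lborel) = gt p"
proof -
  have "continuous_on {\<alpha>..\<beta>} (\<lambda>x. (g2 x - (real k)\<^sup>2 * g x) * log_kernel k x p)"
    unfolding log_kernel_def by (cases "k = 0") (auto intro!: continuous_intros g2_cont g_cont)
  from lborel_integral_of_has_integral[OF log_kernel_has_integral this]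
  show "integrable lborel (\<lambda>x. (gt2 x - (real k)\<^sup>2 * gt x) * log_kernel k x p)"
    "(\<integral>x. (gt2 x - (real k)\<^sup>2 * gt x) * log_kernel k x p \<partial>lborel) = gt p"
    unfolding gt_indicator by (simp_all only: mult.assoc)
qed

lemma affine_integral:
  "integrable lborel (\<lambda>x. gt2 x * (A + B * x))" "(\<integral>x. gt2 x * (A + B * x) \<partial>lborel) = 0"
proof -
  have "continuous_on {\<alpha>..\<beta>} (\<lambda>x. g2 x * (A + B * x))" by (intro continuous_intros g2_cont)
  from lborel_integral_of_has_integral[OF affine_has_integral this]
  show "integrable lborel (\<lambda>x. gt2 x * (A + B * x))" "(\<integral>x. gt2 x * (A + B * x) \<partial>lborel) = 0"
    using gt_indicator[of _ 0] by (simp_all add: mult.assoc)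
qed

end

text \<open>Zeros are tested in logarithmic polar coordinates, which the origin does not have. For
  the zero polynomial the index set is infinite and the sum is \<open>0\<close> by convention, so
  the quantity makes sense for every outcome.\<close>

definition zero_sum :: "(real \<Rightarrow> real) \<Rightarrow> (complex \<Rightarrow> real) \<Rightarrow> complex poly \<Rightarrow> real" where
  "zero_sum G f p = (\<Sum>a | poly p a = 0 \<and> a \<noteq> 0. real (order a p) * (G (ln (cmod a)) * f (sgn a)))"

lemma ln_cmod_poly:
  assumes p: "p \<noteq> 0" and x: "poly p x \<noteq> 0"
  shows "ln (cmod (poly p x)) = ln (cmod (lead_coeff p)) + (\<Sum>a | poly p a = 0. real (order a p) * ln (cmod (x - a)))"
proof -
  have fin: "finite {a. poly p a = 0}" by (rule poly_roots_finite[OF p])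
  have ne: "x - a \<noteq> 0" if "poly p a = 0" for a using x that by auto
  have "poly p x = lead_coeff p * (\<Prod>a | poly p a = 0. (x - a) ^ order a p)"
    by (subst (1) complex_poly_decompose[symmetric]) (simp add: poly_prod poly_power)
  then have "ln (cmod (poly p x)) = ln (cmod (lead_coeff p) * (\<Prod>a | poly p a = 0. cmod (x - a) ^ order a p))"
    by (simp add: norm_mult norm_power prod_norm[symmetric])
  also have "\<dots> = ln (cmod (lead_coeff p)) + ln (\<Prod>a | poly p a = 0. cmod (x - a) ^ order a p)"
    using p ne fin by (intro ln_mult_pos) (auto intro!: prod_pos)
  also have "ln (\<Prod>a | poly p a = 0. cmod (x - a) ^ order a p) = (\<Sum>a | poly p a = 0. ln (cmod (x - a) ^ order a p))"
    using ne fin by (intro ln_prod) auto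
  also have "\<dots> = (\<Sum>a | poly p a = 0. real (order a p) * ln (cmod (x - a)))"
    by (intro sum.cong refl ln_realpow)
  finally show ?thesis .
qed

text \<open>The factorisation turns the logarithm into a sum over zeros. The origin is treated
  separately: it contributes \<open>x\<close>, which is constant on the circle and pairs only with
  \<open>k = 0\<close>.\<close>

lemma integral_ln_cmod_poly:
  assumes p: "p \<noteq> 0" and x: "\<And>a. poly p a = 0 \<Longrightarrow> a \<noteq> 0 \<Longrightarrow> x \<noteq> ln (cmod a)"
  shows "(\<integral>z. ln (cmod (poly p (of_real (exp x) * z))) * Re (c * z ^ k) \<partial>arclength)
     = (ln (cmod (lead_coeff p)) + real (order 0 p) * x) * (if k = 0 then 2 * pi * Re c else 0)
       + 2 * pi * (\<Sum>a | poly p a = 0 \<and> a \<noteq> 0. real (order a p) * (log_kernel k x (ln (cmod a)) * Re (c * sgn a ^ k)))"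
proof -
  define R where "R = {a. poly p a = 0}"
  have fin: "finite R" unfolding R_def by (rule poly_roots_finite[OF p])
  define I where "I a z = ln (cmod (of_real (exp x) * z - a)) * Re (c * z ^ k)" for a z
  have ne: "poly p (of_real (exp x) * z) \<noteq> 0" if "z \<in> unit_circle" for z
  proof
    assume 0: "poly p (of_real (exp x) * z) = 0"
    have "of_real (exp x) * z \<noteq> 0" using that by auto
    from x[OF 0 this] show False using that by (simp add: norm_mult)
  qed
  have [measurable]: "I a \<in> borel_measurable borel" for a unfolding I_def by measurable
  have Ii: "integrable arclength (I a)" if "a \<in> R" for a
    unfolding I_def using x that by (intro ln_cmod_diff_integrable) (auto simp: R_def)
  have lci: "integrable arclength (\<lambda>z. ln (cmod (lead_coeff p)) * Re (c * z ^ k))"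
    by (intro integrable_arclength borel_measurable_continuous_onI continuous_intros)
  have I0: "integral\<^sup>L arclength (I 0) = x * (if k = 0 then 2 * pi * Re c else 0)"
  proof -
    have "integral\<^sup>L arclength (I 0) = (\<integral>z. x * Re (c * z ^ k) \<partial>arclength)"
    proof (intro integral_cong_AE)
      show "AE z in arclength. I 0 z = x * Re (c * z ^ k)"
        using AE_arclength
        by eventually_elim (simp add: I_def norm_mult)
    qed measurable
    then show ?thesis by (simp only: integral_mult_right_zero integral_Re_power)
  qed
  have "(\<integral>z. ln (cmod (poly p (of_real (exp x) * z))) * Re (c * z ^ k) \<partial>arclength)
     = (\<integral>z. ln (cmod (lead_coeff p)) * Re (c * z ^ k) + (\<Sum>a\<in>R. real (order a p) * I a z) \<partial>arclength)"
  proof (intro integral_cong_AE)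
    show "AE z in arclength. ln (cmod (poly p (of_real (exp x) * z))) * Re (c * z ^ k) =
        ln (cmod (lead_coeff p)) * Re (c * z ^ k) + (\<Sum>a\<in>R. real (order a p) * I a z)"
      using AE_arclength
    proof eventually_elim
      case (elim z)
      show ?case
        by (simp only: ln_cmod_poly[OF p ne[OF elim]] I_def R_def distrib_right sum_distrib_right mult.assoc)
    qed
  qed measurable
  also have "\<dots> = ln (cmod (lead_coeff p)) * (if k = 0 then 2 * pi * Re c else 0)
      + (\<Sum>a\<in>R. real (order a p) * integral\<^sup>L arclength (I a))"
    using lci Ii by (subst Bochner_Integration.integral_add)
      (auto simp: Bochner_Integration.integral_sum integral_Re_power simp del: times_complex.sel)
  also have "(\<Sum>a\<in>R. real (order a p) * integral\<^sup>L arclength (I a)) =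
      real (order 0 p) * integral\<^sup>L arclength (I 0) + (\<Sum>a\<in>R - {0}. real (order a p) * integral\<^sup>L arclength (I a))"
  proof (cases "0 \<in> R")
    case True then show ?thesis using fin by (simp add: sum.remove)
  next
    case False
    then have "order 0 p = 0" by (simp add: R_def order_0I)
    then show ?thesis using False by simp
  qed
  also have "(\<Sum>a\<in>R - {0}. real (order a p) * integral\<^sup>L arclength (I a))
      = (\<Sum>a\<in>R - {0}. 2 * pi * (real (order a p) * (log_kernel k x (ln (cmod a)) * Re (c * sgn a ^ k))))"
    unfolding I_def using x by (intro sum.cong refl, subst integral_ln_cmod_diff) (auto simp: R_def)
  also have "R - {0} = {a. poly p a = 0 \<and> a \<noteq> 0}" by (auto simp: R_def)
  finally show ?thesis by (simp only: I0 sum_distrib_left distrib_right mult.assoc add.assoc)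
qed

context bump
begin

text \<open>The weak form of the fact that the Laplacian of \<open>ln |p|\<close> is
  \<open>2 * pi\<close> times the point masses at the zeros; on \<open>Re (c * z ^ k)\<close> its
  angular part acts as \<open>- k^2\<close>. Leading coefficient and origin enter for
  \<open>k = 0\<close> only, affinely in \<open>x\<close>, and are killed by
  \<open>gt2\<close>.\<close>

theorem zero_sum_log_potential:
  assumes p: "p \<noteq> 0"
  shows "zero_sum gt (\<lambda>z. Re (c * z ^ k)) p = 1 / (2 * pi) *
    (\<integral>x. (gt2 x - (real k)\<^sup>2 * gt x) * (\<integral>z. ln (cmod (poly p (of_real (exp x) * z))) * Re (c * z ^ k) \<partial>arclength) \<partial>lborel)"
proof -
  interpret arc: finite_measure arclength by (rule finite_measure_arclength)
  define R where "R = {a. poly p a = 0 \<and> a \<noteq> 0}"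
  have fin: "finite R" unfolding R_def by (rule finite_subset[OF _ poly_roots_finite[OF p]]) auto
  define cst where "cst x = (if k = 0 then gt2 x * (2 * pi * Re c * ln (cmod (lead_coeff p)) + 2 * pi * Re c * real (order 0 p) * x) else 0)" for x
  have cst: "integrable lborel cst" "integral\<^sup>L lborel cst = 0"
    using affine_integral by (cases "k = 0"; simp add: cst_def[abs_def])+
  define tm where "tm a x = 2 * pi * real (order a p) * Re (c * sgn a ^ k) * ((gt2 x - (real k)\<^sup>2 * gt x) * log_kernel k x (ln (cmod a)))" for a x
  have tm: "integrable lborel (tm a)"
     "integral\<^sup>L lborel (tm a) = 2 * pi * (real (order a p) * (gt (ln (cmod a)) * Re (c * sgn a ^ k)))" for a
    unfolding tm_def using log_kernel_integral[of k "ln (cmod a)"]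
    by (simp_all only: integrable_mult_right integral_mult_right_zero) simp
  have "(\<integral>x. (gt2 x - (real k)\<^sup>2 * gt x) * (\<integral>z. ln (cmod (poly p (of_real (exp x) * z))) * Re (c * z ^ k) \<partial>arclength) \<partial>lborel)
     = (\<integral>x. cst x + (\<Sum>a\<in>R. tm a x) \<partial>lborel)"
  proof (rule integral_cong_AE)
    \<comment> \<open>Circles passing through a zero are excluded; there are finitely many.\<close>
    have "AE x in lborel. x \<notin> (\<lambda>a. ln (cmod a)) ` R"
      using fin by (intro AE_not_in finite_imp_null_set_lborel) auto
    then show "AE x in lborel. (gt2 x - (real k)\<^sup>2 * gt x) * (\<integral>z. ln (cmod (poly p (of_real (exp x) * z))) * Re (c * z ^ k) \<partial>arclength)
        = cst x + (\<Sum>a\<in>R. tm a x)"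
    proof eventually_elim
      case (elim x)
      have "(\<integral>z. ln (cmod (poly p (of_real (exp x) * z))) * Re (c * z ^ k) \<partial>arclength)
     = (ln (cmod (lead_coeff p)) + real (order 0 p) * x) * (if k = 0 then 2 * pi * Re c else 0)
       + 2 * pi * (\<Sum>a\<in>R. real (order a p) * (log_kernel k x (ln (cmod a)) * Re (c * sgn a ^ k)))"
        unfolding R_def using elim by (intro integral_ln_cmod_poly[OF p]) (auto simp: R_def)
      moreover have "(gt2 x - (real k)\<^sup>2 * gt x) * ((ln (cmod (lead_coeff p)) + real (order 0 p) * x) * (if k = 0 then 2 * pi * Re c else 0)) = cst x"
        by (simp add: cst_def algebra_simps)
      moreover have "(gt2 x - (real k)\<^sup>2 * gt x) * (2 * pi * (\<Sum>a\<in>R. real (order a p) * (log_kernel k x (ln (cmod a)) * Re (c * sgn a ^ k)))) = (\<Sum>a\<in>R. tm a x)"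
        unfolding sum_distrib_left tm_def by (intro sum.cong refl) (simp only: mult_ac)
      ultimately show ?case by (simp only: distrib_left)
    qed
    show "(\<lambda>x. cst x + (\<Sum>a\<in>R. tm a x)) \<in> borel_measurable lborel"
      using cst tm by measurable
    show "(\<lambda>x. (gt2 x - (real k)\<^sup>2 * gt x) * (\<integral>z. ln (cmod (poly p (of_real (exp x) * z))) * Re (c * z ^ k) \<partial>arclength)) \<in> borel_measurable lborel"
      by measurable
  qed
  also have "\<dots> = (\<Sum>a\<in>R. integral\<^sup>L lborel (tm a))"
    using cst tm by (simp add: Bochner_Integration.integral_sum)
  also have "\<dots> = 2 * pi * zero_sum gt (\<lambda>z. Re (c * z ^ k)) p"
    by (simp only: tm zero_sum_def R_def sum_distrib_left)
  finally show ?thesis by simp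
qed

end

lemma zero_sum_0 [simp]: "zero_sum G f 0 = 0"
proof -
  have "infinite {a :: complex. a \<noteq> 0}"
    using infinite_UNIV_char_0[where 'a = complex] by (simp add: Collect_neg_eq)
  then show ?thesis by (simp add: zero_sum_def)
qed

text \<open>Multiplicities add up to at most the degree. The bound does not depend on the outcome
  and later serves as a dominating constant.\<close>

lemma zero_sum_bound:
  assumes deg: "degree p \<le> n" and bd: "\<And>a. a \<noteq> 0 \<Longrightarrow> \<bar>G (ln (cmod a)) * f (sgn a)\<bar> \<le> B" and B: "0 \<le> B"
  shows "\<bar>zero_sum G f p\<bar> \<le> real n * B"
proof (cases "p = 0")
  case True then show ?thesis using B by simp
next
  case False
  have "\<bar>zero_sum G f p\<bar> \<le> (\<Sum>a | poly p a = 0 \<and> a \<noteq> 0. real (order a p) * B)"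
    unfolding zero_sum_def by (rule order.trans[OF sum_abs]) (auto intro!: sum_mono mult_left_mono simp: abs_mult bd[unfolded abs_mult])
  also have "\<dots> \<le> (\<Sum>a | poly p a = 0. real (order a p) * B)"
    using B poly_roots_finite[OF False] by (intro sum_mono2) auto
  also have "\<dots> = real (\<Sum>a | poly p a = 0. order a p) * B" by (simp add: sum_distrib_right)
  also have "\<dots> \<le> real n * B"
    using order.trans[OF sum_order_le_degree[OF False] deg] B by (intro mult_right_mono of_nat_mono)
  finally show ?thesis .
qed

section \<open>Derivatives of the logarithm of the kernel\<close>

text \<open>The operator \<open>z d/dz\<close>, that is, differentiation in \<open>w\<close> for
  \<open>z = exp w\<close>.\<close>

definition euler_op :: "complex poly \<Rightarrow> complex poly" where
  "euler_op p = pCons 0 (pderiv p)"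

text \<open>A sesquilinear version of \<open>kern\<close>, so that derivatives stay within one kind
  of sum: \<open>euler_op\<close> is applied to one of the two families.\<close>

definition kmix :: "(nat \<Rightarrow> complex poly) \<Rightarrow> (nat \<Rightarrow> complex poly) \<Rightarrow> nat \<Rightarrow> complex \<Rightarrow> complex" where
  "kmix \<phi> \<psi> n z = (\<Sum>j\<le>n. poly (\<phi> j) z * cnj (poly (\<psi> j) z))"

lemma kern_kmix: "kern \<phi> n z = Re (kmix \<phi> \<phi> n z)"
  by (simp add: kern_def kmix_def cmod_power2) (simp add: power2_eq_square)

lemma kmix_cnj: "cnj (kmix \<phi> \<psi> n z) = kmix \<psi> \<phi> n z"
  by (simp add: kmix_def mult.commute)

lemma continuous_on_kmix [continuous_intros]:
  "continuous_on A f \<Longrightarrow> continuous_on A (\<lambda>x. kmix \<phi> \<psi> n (f x))"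
  unfolding kmix_def by (intro continuous_intros)

lemma continuous_on_kern [continuous_intros]:
  "continuous_on A f \<Longrightarrow> continuous_on A (\<lambda>x. kern \<phi> n (f x))"
  unfolding kern_kmix by (intro continuous_intros)

lemma measurable_kmix [measurable]: "kmix \<phi> \<psi> n \<in> borel_measurable borel"
  by (intro borel_measurable_continuous_onI continuous_intros)

lemma measurable_kern [measurable]: "kern \<phi> n \<in> borel_measurable borel"
  by (intro borel_measurable_continuous_onI continuous_intros)

abbreviation D_fam :: "(nat \<Rightarrow> complex poly) \<Rightarrow> nat \<Rightarrow> complex poly" where
  "D_fam \<phi> \<equiv> \<lambda>j. euler_op (\<phi> j)"

lemma poly_along_curve:
  "((\<lambda>t. poly p (z * exp (e * of_real t))) has_vector_derivative
     e * poly (euler_op p) (z * exp (e * of_real t))) (at t within T)"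
proof -
  have "((\<lambda>w. poly p (z * exp (e * w))) has_field_derivative
     e * poly (euler_op p) (z * exp (e * of_real t))) (at (of_real t))"
    by (auto intro!: derivative_eq_intros simp: euler_op_def algebra_simps)
  from has_vector_derivative_real_field[OF this] show ?thesis .
qed

lemma kmix_along_curve:
  "((\<lambda>t. kmix \<phi> \<psi> n (z * exp (e * of_real t))) has_vector_derivative
     e * kmix (D_fam \<phi>) \<psi> n (z * exp (e * of_real t)) + cnj e * kmix \<phi> (D_fam \<psi>) n (z * exp (e * of_real t))) (at t within T)"
  unfolding kmix_def sum_distrib_left sum.distrib[symmetric]
proof (rule has_vector_derivative_sum)
  fix j
  have "((\<lambda>t. poly (\<phi> j) (z * exp (e * of_real t)) * cnj (poly (\<psi> j) (z * exp (e * of_real t)))) has_vector_derivative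
     poly (\<phi> j) (z * exp (e * of_real t)) * cnj (e * poly (euler_op (\<psi> j)) (z * exp (e * of_real t)))
     + e * poly (euler_op (\<phi> j)) (z * exp (e * of_real t)) * cnj (poly (\<psi> j) (z * exp (e * of_real t)))) (at t within T)"
    by (intro has_vector_derivative_mult has_vector_derivative_cnj poly_along_curve)
  then show "((\<lambda>t. poly (\<phi> j) (z * exp (e * of_real t)) * cnj (poly (\<psi> j) (z * exp (e * of_real t)))) has_vector_derivative
     e * (poly (euler_op (\<phi> j)) (z * exp (e * of_real t)) * cnj (poly (\<psi> j) (z * exp (e * of_real t))))
     + cnj e * (poly (\<phi> j) (z * exp (e * of_real t)) * cnj (poly (euler_op (\<psi> j)) (z * exp (e * of_real t))))) (at t within T)"
    by (simp add: algebra_simps)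
qed

lemma has_real_derivative_Re:
  "(f has_vector_derivative D) (at t within T) \<Longrightarrow> ((\<lambda>t. Re (f t)) has_real_derivative Re D) (at t within T)"
  unfolding has_real_derivative_iff_has_vector_derivative
  by (rule bounded_linear.has_vector_derivative[OF bounded_linear_Re])

text \<open>The derivative of \<open>kern\<close> along \<open>z * exp (e * t)\<close>, with
  \<open>kern_d2\<close> the second one. Direction \<open>e = 1\<close> is radial,
  \<open>e = \<i>\<close> is angular.\<close>

definition kern_d1 :: "complex \<Rightarrow> (nat \<Rightarrow> complex poly) \<Rightarrow> nat \<Rightarrow> complex \<Rightarrow> real" where
  "kern_d1 e \<phi> n z = 2 * Re (e * kmix (D_fam \<phi>) \<phi> n z)"

definition kern_d2 :: "complex \<Rightarrow> (nat \<Rightarrow> complex poly) \<Rightarrow> nat \<Rightarrow> complex \<Rightarrow> real" where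
  "kern_d2 e \<phi> n z = 2 * Re (e\<^sup>2 * kmix (D_fam (D_fam \<phi>)) \<phi> n z) + 2 * (cmod e)\<^sup>2 * kern (D_fam \<phi>) n z"

lemma kern_along_curve:
  "((\<lambda>t. kern \<phi> n (z * exp (e * of_real t))) has_real_derivative kern_d1 e \<phi> n (z * exp (e * of_real t))) (at t within T)"
proof -
  have "Re (e * kmix (D_fam \<phi>) \<phi> n w + cnj e * kmix \<phi> (D_fam \<phi>) n w) = kern_d1 e \<phi> n w" for w
    unfolding kern_d1_def kmix_cnj[of "D_fam \<phi>" \<phi>, symmetric] by simp
  then show ?thesis
    using has_real_derivative_Re[OF kmix_along_curve[of \<phi> \<phi> n z e t T]] unfolding kern_kmix by (simp only:)
qed

lemma kern_d1_along_curve: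
  "((\<lambda>t. kern_d1 e \<phi> n (z * exp (e * of_real t))) has_real_derivative kern_d2 e \<phi> n (z * exp (e * of_real t))) (at t within T)"
proof -
  let ?w = "z * exp (e * of_real t)"
  have "((\<lambda>t. 2 * (e * kmix (D_fam \<phi>) \<phi> n (z * exp (e * of_real t)))) has_vector_derivative
     2 * (e * (e * kmix (D_fam (D_fam \<phi>)) \<phi> n ?w + cnj e * kmix (D_fam \<phi>) (D_fam \<phi>) n ?w))) (at t within T)"
    by (intro has_vector_derivative_mult_right kmix_along_curve)
  note d = has_real_derivative_Re[OF this]
  have R2: "Re (2 * w) = 2 * Re w" for w by simp
  have key: "Re (e * (e * kmix (D_fam (D_fam \<phi>)) \<phi> n ?w + cnj e * kmix (D_fam \<phi>) (D_fam \<phi>) n ?w))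
     = Re (e\<^sup>2 * kmix (D_fam (D_fam \<phi>)) \<phi> n ?w) + (cmod e)\<^sup>2 * kern (D_fam \<phi>) n ?w"
  proof -
    have "e * (e * a + cnj e * b) = e\<^sup>2 * a + of_real ((cmod e)\<^sup>2) * b" for a b
      by (simp only: complex_norm_square) (simp add: algebra_simps power2_eq_square)
    moreover have "Re (v + of_real s * b) = Re v + s * Re b" for v b s by simp
    ultimately show ?thesis by (simp only: kern_kmix)
  qed
  show ?thesis
    using d unfolding R2 key kern_d1_def kern_d2_def by (simp only: distrib_left mult.assoc)
qed

definition log_d1 :: "complex \<Rightarrow> (nat \<Rightarrow> complex poly) \<Rightarrow> nat \<Rightarrow> complex \<Rightarrow> real" where
  "log_d1 e \<phi> n z = kern_d1 e \<phi> n z / kern \<phi> n z"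

definition log_d2 :: "complex \<Rightarrow> (nat \<Rightarrow> complex poly) \<Rightarrow> nat \<Rightarrow> complex \<Rightarrow> real" where
  "log_d2 e \<phi> n z = kern_d2 e \<phi> n z / kern \<phi> n z - (kern_d1 e \<phi> n z / kern \<phi> n z)\<^sup>2"

text \<open>The Laplacian of \<open>ln (kern \<phi> n z)\<close> in the coordinates
  \<open>x\<close>, \<open>t\<close> of \<open>z = exp (x + \<i> * t)\<close>, written as four times
  a mixed derivative in \<open>w\<close> and \<open>cnj w\<close>.\<close>

definition log_laplace :: "(nat \<Rightarrow> complex poly) \<Rightarrow> nat \<Rightarrow> complex \<Rightarrow> real" where
  "log_laplace \<phi> n z = 4 * (kern \<phi> n z * kern (D_fam \<phi>) n z - (cmod (kmix (D_fam \<phi>) \<phi> n z))\<^sup>2) / (kern \<phi> n z)\<^sup>2"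

text \<open>The terms with \<open>e\<^sup>2\<close> cancel between \<open>e = 1\<close> and
  \<open>e = \<i>\<close>, and the two squared first derivatives add up to a squared
  modulus.\<close>

lemma log_laplace_eq:
  assumes "kern \<phi> n z \<noteq> 0"
  shows "log_d2 1 \<phi> n z + log_d2 \<i> \<phi> n z = log_laplace \<phi> n z"
proof -
  have "kern_d2 1 \<phi> n z + kern_d2 \<i> \<phi> n z = 4 * kern (D_fam \<phi>) n z" by (simp add: kern_d2_def)
  moreover have "(kern_d1 1 \<phi> n z)\<^sup>2 + (kern_d1 \<i> \<phi> n z)\<^sup>2 = 4 * (cmod (kmix (D_fam \<phi>) \<phi> n z))\<^sup>2"
    by (simp add: kern_d1_def cmod_power2)
  moreover have "log_d2 1 \<phi> n z + log_d2 \<i> \<phi> n z = (kern_d2 1 \<phi> n z + kern_d2 \<i> \<phi> n z) / kern \<phi> n z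
     - ((kern_d1 1 \<phi> n z)\<^sup>2 + (kern_d1 \<i> \<phi> n z)\<^sup>2) / (kern \<phi> n z)\<^sup>2"
    by (simp add: log_d2_def power_divide add_divide_distrib)
  ultimately show ?thesis using assms by (simp add: log_laplace_def field_simps power2_eq_square)
qed

lemma log_along_curve:
  assumes "\<And>z. 0 < kern \<phi> n z"
  shows "((\<lambda>t. ln (kern \<phi> n (z * exp (e * of_real t)))) has_real_derivative log_d1 e \<phi> n (z * exp (e * of_real t))) (at t within T)"
   "((\<lambda>t. log_d1 e \<phi> n (z * exp (e * of_real t))) has_real_derivative log_d2 e \<phi> n (z * exp (e * of_real t))) (at t within T)"
proof -
  have "kern \<phi> n w \<noteq> 0" for w using assms[of w] by simp
  then show "((\<lambda>t. ln (kern \<phi> n (z * exp (e * of_real t)))) has_real_derivative log_d1 e \<phi> n (z * exp (e * of_real t))) (at t within T)"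
   "((\<lambda>t. log_d1 e \<phi> n (z * exp (e * of_real t))) has_real_derivative log_d2 e \<phi> n (z * exp (e * of_real t))) (at t within T)"
    unfolding log_d1_def log_d2_def
    by (auto intro!: derivative_eq_intros kern_along_curve kern_d1_along_curve simp: assms)
       (simp add: field_simps power2_eq_square)
qed

lemma continuous_on_log_d:
  assumes "\<And>z. 0 < kern \<phi> n z" and "continuous_on A f"
  shows "continuous_on A (\<lambda>x. ln (kern \<phi> n (f x)))" "continuous_on A (\<lambda>x. log_d1 e \<phi> n (f x))"
    "continuous_on A (\<lambda>x. log_d2 e \<phi> n (f x))" "continuous_on A (\<lambda>x. log_laplace \<phi> n (f x))"
proof -
  have "kern \<phi> n w \<noteq> 0" for w using assms(1)[of w] by simp
  then show "continuous_on A (\<lambda>x. ln (kern \<phi> n (f x)))" "continuous_on A (\<lambda>x. log_d1 e \<phi> n (f x))"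
    "continuous_on A (\<lambda>x. log_d2 e \<phi> n (f x))" "continuous_on A (\<lambda>x. log_laplace \<phi> n (f x))"
    unfolding log_d1_def log_d2_def kern_d1_def kern_d2_def log_laplace_def
    by (auto intro!: continuous_intros assms(2))
qed

lemma measurable_log_d [measurable]:
  "log_d2 e \<phi> n \<in> borel_measurable borel" "log_laplace \<phi> n \<in> borel_measurable borel"
  unfolding log_d2_def[abs_def] log_laplace_def[abs_def] kern_d2_def kern_d1_def by measurable

lemma integral_arclength_cis:
  fixes f :: "complex \<Rightarrow> real"
  assumes [measurable]: "f \<in> borel_measurable borel"
  shows "(\<integral>z. f z \<partial>arclength) = (\<integral>t. indicator {-pi..pi} t * f (cis t) \<partial>lborel)"
proof -
  have "(\<integral>z. f z \<partial>arclength) = (\<integral>t. indicator {-pi<..pi} t * f (cis t) \<partial>lborel)"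
    unfolding arclength_def
    by (subst integral_distr) (auto intro!: measurable_restrict_space1 simp: integral_restrict_space)
  also have "\<dots> = (\<integral>t. indicator {-pi..pi} t * f (cis t) \<partial>lborel)"
  proof (rule integral_cong_AE)
    show "AE t in lborel. indicator {-pi<..pi} t * f (cis t) = indicator {-pi..pi} t * f (cis t)"
      using AE_lborel_singleton[of "-pi"] by eventually_elim (auto simp: indicator_def)
  qed measurable
  finally show ?thesis .
qed

text \<open>Two integrations by parts over the full circle; the boundary terms cancel by periodicity.\<close>

lemma angular_parts:
  assumes pos: "\<And>z. 0 < kern \<phi> n z"
  shows "(\<integral>z. Re (c * z ^ k) * log_d2 \<i> \<phi> n (of_real r * z) \<partial>arclength)
     = (\<integral>z. - (real k)\<^sup>2 * (Re (c * z ^ k) * (ln (kern \<phi> n (of_real r * z)) + C)) \<partial>arclength)"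
proof -
  define q where "q t = Re (c * exp (\<i> * of_nat k * of_real t))" for t
  define q1 where "q1 t = Re (\<i> * of_nat k * c * exp (\<i> * of_nat k * of_real t))" for t
  have ex: "((\<lambda>t. exp (\<i> * of_nat k * of_real t)) has_vector_derivative \<i> * of_nat k * exp (\<i> * of_nat k * of_real t)) (at t within T)" for t T
    by (rule has_vector_derivative_real_field) (auto intro!: derivative_eq_intros)
  have dq: "(q has_real_derivative q1 t) (at t within T)" for t T
    using has_real_derivative_Re[OF has_vector_derivative_mult_right[OF ex, of c]]
    by (simp add: q_def[abs_def] q1_def mult_ac)
  have dq1: "(q1 has_real_derivative - (real k)\<^sup>2 * q t) (at t within T)" for t T
  proof -
    have "Re (\<i> * of_nat k * c * (\<i> * of_nat k * w)) = - (real k)\<^sup>2 * Re (c * w)" for w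
      by (simp add: power2_eq_square algebra_simps)
    then show ?thesis
      using has_real_derivative_Re[OF has_vector_derivative_mult_right[OF ex, of "\<i> * of_nat k * c"]]
      by (simp only: q_def[abs_def] q1_def[abs_def])
  qed
  let ?w = "\<lambda>t. of_real r * exp (\<i> * of_real t)"
  define h where "h t = - (real k)\<^sup>2 * q t * (ln (kern \<phi> n (?w t)) + C) - q t * log_d2 \<i> \<phi> n (?w t)" for t
  define A where "A t = q1 t * (ln (kern \<phi> n (?w t)) + C) - q t * log_d1 \<i> \<phi> n (?w t)" for t
  have "(h has_integral A pi - A (-pi)) {-pi..pi}"
  proof (rule fundamental_theorem_of_calculus)
    fix t
    show "(A has_vector_derivative h t) (at t within {-pi..pi})"
      unfolding A_def h_def has_real_derivative_iff_has_vector_derivative[symmetric]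
      by (rule DERIV_cong[OF DERIV_diff[OF DERIV_mult[OF dq1 DERIV_add[OF log_along_curve(1)[OF pos] DERIV_const]]
            DERIV_mult[OF dq log_along_curve(2)[OF pos]]]]) (simp add: algebra_simps)
  qed simp
  moreover have e1: "exp (\<i> * complex_of_real (- pi)) = exp (\<i> * complex_of_real pi)"
    by (simp add: exp_minus)
  moreover have e2: "exp (\<i> * of_nat k * complex_of_real (- pi)) = exp (\<i> * of_nat k * complex_of_real pi)"
  proof -
    have "exp (\<i> * of_nat k * complex_of_real pi) = (-1) ^ k"
      by (subst exp_pi_i[symmetric], subst exp_of_nat_mult[symmetric]) (simp add: mult_ac)
    then show ?thesis by (cases "even k") (simp_all add: exp_minus)
  qed
  moreover have "A (- pi) = A pi" unfolding A_def q_def q1_def e1 e2 ..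
  ultimately have hi: "(h has_integral 0) {-pi..pi}" by simp
  have hc: "continuous_on {-pi..pi} h"
    unfolding h_def q_def by (intro continuous_intros continuous_on_log_d[OF pos])
  have "(\<integral>t. indicator {-pi..pi} t * h t \<partial>lborel) = 0"
    by (rule lborel_integral_of_has_integral[OF hi hc])
  have qc: "q t = Re (c * cis t ^ k)" for t
    by (simp add: q_def cis_conv_exp exp_of_nat_mult[symmetric] mult_ac)
  let ?F = "\<lambda>z. - (real k)\<^sup>2 * (Re (c * z ^ k) * (ln (kern \<phi> n (of_real r * z)) + C))"
  let ?G = "\<lambda>z. Re (c * z ^ k) * log_d2 \<i> \<phi> n (of_real r * z)"
  have iF: "integrable arclength ?F" and iG: "integrable arclength ?G"
    by (intro integrable_arclength continuous_intros continuous_on_log_d[OF pos]; measurable)+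
  have "(\<integral>z. ?F z - ?G z \<partial>arclength) = (\<integral>t. indicator {-pi..pi} t * h t \<partial>lborel)"
    by (subst integral_arclength_cis, measurable)
       (simp only: h_def qc cis_conv_exp mult.assoc)
  then have "(\<integral>z. ?F z \<partial>arclength) - (\<integral>z. ?G z \<partial>arclength) = 0"
    using iF iG \<open>(\<integral>t. indicator {-pi..pi} t * h t \<partial>lborel) = 0\<close> by (simp only: Bochner_Integration.integral_diff)
  then show ?thesis by simp
qed

text \<open>Boundary terms vanish with \<open>g\<close> and \<open>g1\<close>. Any constant
  \<open>C\<close> may be added because \<open>gt2\<close> has integral zero; this disposes of the
  Gaussian constant.\<close>

lemma (in bump) radial_parts:
  assumes pos: "\<And>z. 0 < kern \<phi> n z"
  shows "(\<integral>x. gt x * log_d2 1 \<phi> n (of_real (exp x) * z) \<partial>lborel)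
     = (\<integral>x. gt2 x * (ln (kern \<phi> n (of_real (exp x) * z)) + C) \<partial>lborel)"
proof -
  let ?w = "\<lambda>x. z * exp (1 * complex_of_real x)"
  have w: "of_real (exp x) * z = ?w x" for x by (simp add: exp_of_real)
  define h where "h x = g2 x * (ln (kern \<phi> n (?w x)) + C) - g x * log_d2 1 \<phi> n (?w x)" for x
  define A where "A x = g1 x * (ln (kern \<phi> n (?w x)) + C) - g x * log_d1 1 \<phi> n (?w x)" for x
  have "(h has_integral A \<beta> - A \<alpha>) {\<alpha>..\<beta>}"
  proof (rule fundamental_theorem_of_calculus)
    fix x assume x: "x \<in> {\<alpha>..\<beta>}"
    show "(A has_vector_derivative h x) (at x within {\<alpha>..\<beta>})"
      unfolding A_def h_def has_real_derivative_iff_has_vector_derivative[symmetric]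
      by (rule DERIV_cong[OF DERIV_diff[OF DERIV_mult[OF g2[OF x] DERIV_add[OF log_along_curve(1)[OF pos] DERIV_const]]
            DERIV_mult[OF g1[OF x] log_along_curve(2)[OF pos]]]]) (simp add: algebra_simps)
  qed (use ab in simp)
  then have hi: "(h has_integral 0) {\<alpha>..\<beta>}" by (simp add: A_def bd)
  have hc: "continuous_on {\<alpha>..\<beta>} h"
    unfolding h_def by (intro continuous_intros continuous_on_log_d[OF pos] g2_cont g_cont)
  have 0: "(\<integral>x. indicator {\<alpha>..\<beta>} x * h x \<partial>lborel) = 0"
    by (rule lborel_integral_of_has_integral[OF hi hc])
  have c1: "integrable lborel (\<lambda>x. indicator {\<alpha>..\<beta>} x * (g2 x * (ln (kern \<phi> n (?w x)) + C)))"
    and c2: "integrable lborel (\<lambda>x. indicator {\<alpha>..\<beta>} x * (g x * log_d2 1 \<phi> n (?w x)))"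
    by (intro integrable_indicator_mult continuous_intros continuous_on_log_d[OF pos] g2_cont g_cont)+
  have e1: "gt2 x * (ln (kern \<phi> n (?w x)) + C) = indicator {\<alpha>..\<beta>} x * (g2 x * (ln (kern \<phi> n (?w x)) + C))"
    and e2: "gt x * log_d2 1 \<phi> n (?w x) = indicator {\<alpha>..\<beta>} x * (g x * log_d2 1 \<phi> n (?w x))" for x
    by (auto simp: gt_def gt2_def)
  have "(\<integral>x. gt2 x * (ln (kern \<phi> n (?w x)) + C) \<partial>lborel) - (\<integral>x. gt x * log_d2 1 \<phi> n (?w x) \<partial>lborel)
     = (\<integral>x. indicator {\<alpha>..\<beta>} x * h x \<partial>lborel)"
    unfolding e1 e2 h_def right_diff_distrib by (rule Bochner_Integration.integral_diff[OF c1 c2, symmetric])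
  then show ?thesis unfolding w using 0 by simp
qed

section \<open>The expected zero measure\<close>

interpretation arc: finite_measure arclength by (rule finite_measure_arclength)
interpretation box: pair_sigma_finite lborel arclength ..

text \<open>A pair \<open>(x, z)\<close> stands for the point \<open>exp x * z\<close>. The measure
  is flat in \<open>x\<close> and the angle, not the area measure of the plane.\<close>

abbreviation polar_measure :: "(real \<times> complex) measure" where
  "polar_measure \<equiv> lborel \<Otimes>\<^sub>M arclength"

lemma AE_polar_circle: "AE y in polar_measure. snd y \<in> unit_circle"
proof (rule box.AE_pair_measure)
  have [measurable]: "unit_circle \<in> sets borel" by simp
  show "{x \<in> space polar_measure. snd x \<in> unit_circle} \<in> sets polar_measure" by measurable
  show "AE x in lborel. AE z in arclength. snd (x, z) \<in> unit_circle"
    using AE_arclength by simp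
qed

lemma polar_integrable_bounded:
  fixes h :: "real \<times> complex \<Rightarrow> real"
  assumes [measurable]: "h \<in> borel_measurable polar_measure"
    and bd: "\<And>x z. z \<in> unit_circle \<Longrightarrow> \<bar>h (x, z)\<bar> \<le> C * indicator {\<alpha>..\<beta>} x"
  shows "integrable polar_measure h"
proof -
  have "emeasure polar_measure ({\<alpha>..\<beta>} \<times> UNIV) = emeasure lborel {\<alpha>..\<beta>} * emeasure arclength UNIV"
    by (rule arc.emeasure_pair_measure_Times) auto
  also have "\<dots> < \<infinity>"
    by (simp add: arc.emeasure_eq_measure ennreal_mult_less_top emeasure_lborel_Icc_eq)
  finally have "integrable polar_measure (indicat_real ({\<alpha>..\<beta>} \<times> UNIV))"
    by (intro integrable_real_indicator) auto
  then have i: "integrable polar_measure (\<lambda>y. C * indicat_real ({\<alpha>..\<beta>} \<times> UNIV) y)" by simp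
  show ?thesis
  proof (rule Bochner_Integration.integrable_bound[OF i])
    show "AE y in polar_measure. norm (h y) \<le> norm (C * indicat_real ({\<alpha>..\<beta>} \<times> UNIV) y)"
      using AE_polar_circle
    proof eventually_elim
      case (elim y)
      then show ?case using bd[of "snd y" "fst y"] by (cases y) (auto simp: indicator_def split: if_splits)
    qed
  qed measurable
qed

lemma polar_bound:
  fixes h :: "real \<times> complex \<Rightarrow> real"
  assumes "continuous_on ({\<alpha>..\<beta>} \<times> unit_circle) h"
  obtains C where "0 \<le> C" "\<And>x z. x \<in> {\<alpha>..\<beta>} \<Longrightarrow> z \<in> unit_circle \<Longrightarrow> \<bar>h (x, z)\<bar> \<le> C"
proof -
  have "compact (h ` ({\<alpha>..\<beta>} \<times> unit_circle))"
    by (intro compact_continuous_image assms compact_Times) auto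
  then obtain B where B: "\<And>y. y \<in> h ` ({\<alpha>..\<beta>} \<times> unit_circle) \<Longrightarrow> norm y \<le> B"
    using compact_imp_bounded bounded_iff by metis
  show ?thesis
  proof (rule that[of "max B 0"])
    fix x z assume "x \<in> {\<alpha>..\<beta>}" "z \<in> unit_circle"
    then have "norm (h (x, z)) \<le> B" by (intro B) auto
    then show "\<bar>h (x, z)\<bar> \<le> max B 0" by simp
  qed simp
qed

lemma polar_integrable_dominated:
  fixes h :: "real \<times> complex \<Rightarrow> real"
  assumes "continuous_on ({\<alpha>..\<beta>} \<times> unit_circle) h" and "h0 \<in> borel_measurable polar_measure"
    and le: "\<And>x z. \<bar>h0 (x, z)\<bar> \<le> indicator {\<alpha>..\<beta>} x * \<bar>h (x, z)\<bar>"
  shows "integrable polar_measure h0"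
proof -
  obtain C where C: "0 \<le> C" "\<And>x z. x \<in> {\<alpha>..\<beta>} \<Longrightarrow> z \<in> unit_circle \<Longrightarrow> \<bar>h (x, z)\<bar> \<le> C"
    using polar_bound[OF assms(1)] by metis
  show ?thesis
  proof (rule polar_integrable_bounded[OF assms(2), of C \<alpha> \<beta>])
    fix x z assume z: "z \<in> unit_circle"
    show "\<bar>h0 (x, z)\<bar> \<le> C * indicator {\<alpha>..\<beta>} x"
      using le[of x z] C(2)[OF _ z, of x] by (cases "x \<in> {\<alpha>..\<beta>}") auto
  qed
qed

lemma polar_integrable_continuous:
  fixes h :: "real \<times> complex \<Rightarrow> real"
  assumes "continuous_on ({\<alpha>..\<beta>} \<times> unit_circle) h" and "h0 \<in> borel_measurable polar_measure"
    and "\<And>x z. h0 (x, z) = indicator {\<alpha>..\<beta>} x * h (x, z)"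
  shows "integrable polar_measure h0"
  by (rule polar_integrable_dominated[OF assms(1,2)]) (simp add: assms(3) abs_mult)

locale random_zeros = prob_space M for M :: "'w measure" +
  fixes \<eta> :: "nat \<Rightarrow> 'w \<Rightarrow> complex" and \<nu> :: "complex measure" and \<phi> :: "nat \<Rightarrow> complex poly"
  assumes iid: "iid_complex_std_gaussian M \<eta>" and sys: "circle_system \<nu> \<phi>"
begin

abbreviation P :: "nat \<Rightarrow> 'w \<Rightarrow> complex poly" where
  "P \<equiv> random_poly \<eta> \<phi>"

lemma eta_measurable [measurable]: "\<eta> j \<in> borel_measurable M"
  using iid unfolding iid_complex_std_gaussian_def indep_vars_def by auto

lemma kern_positive: "0 < kern \<phi> n z"
  by (rule circle_system.kern_pos[OF sys])

lemma poly_random_poly: "poly (P n \<omega>) z = (\<Sum>j\<le>n. poly (\<phi> j) z * \<eta> j \<omega>)"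
  by (simp add: random_poly_def poly_sum mult.commute)

lemma degree_random_poly: "degree (P n \<omega>) \<le> n"
  unfolding random_poly_def using circle_system.degree_phi[OF sys]
  by (intro degree_sum_le) (auto intro: order.trans[OF degree_smult_le])

text \<open>Finitely many coefficients decide, which makes the event measurable.\<close>

lemma random_poly_eq_0_iff: "P n \<omega> = 0 \<longleftrightarrow> (\<forall>i\<le>n. (\<Sum>j\<le>n. \<eta> j \<omega> * coeff (\<phi> j) i) = 0)"
proof -
  have c: "coeff (P n \<omega>) i = (\<Sum>j\<le>n. \<eta> j \<omega> * coeff (\<phi> j) i)" for i
    by (simp add: random_poly_def coeff_sum)
  show ?thesis unfolding c[symmetric]
    using degree_random_poly[of n \<omega>] by (metis coeff_0 coeff_eq_0 le_degree not_le poly_eqI order_trans)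
qed

lemma random_poly_eq_0_measurable [measurable]: "Measurable.pred M (\<lambda>\<omega>. P n \<omega> = 0)"
  unfolding random_poly_eq_0_iff by measurable

lemma ln_random_poly:
  "AE \<omega> in M. poly (P n \<omega>) z \<noteq> 0"
  "integrable M (\<lambda>\<omega>. ln (cmod (poly (P n \<omega>) z)))"
  "expectation (\<lambda>\<omega>. ln (cmod (poly (P n \<omega>) z))) = (ln (kern \<phi> n z) + 2 * gauss_const) / 2"
  "expectation (\<lambda>\<omega>. \<bar>ln (cmod (poly (P n \<omega>) z))\<bar>)
     \<le> \<bar>ln (sqrt (kern \<phi> n z))\<bar> + gauss_abs_ln + 2 * sqrt (kern \<phi> n z) * gauss_abs"
proof -
  have "kern \<phi> 0 z > 0" by (rule kern_positive)
  then have "poly (\<phi> 0) z \<noteq> 0" by (auto simp: kern_def)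
  note E = expectation_ln_gaussian_sum[OF iid, of 0 n "\<lambda>j. poly (\<phi> j) z", OF _ this]
  have s: "(\<Sum>j\<le>n. (cmod (poly (\<phi> j) z))\<^sup>2) = kern \<phi> n z" by (simp add: kern_def)
  show "AE \<omega> in M. poly (P n \<omega>) z \<noteq> 0"
    "integrable M (\<lambda>\<omega>. ln (cmod (poly (P n \<omega>) z)))"
    "expectation (\<lambda>\<omega>. \<bar>ln (cmod (poly (P n \<omega>) z))\<bar>)
     \<le> \<bar>ln (sqrt (kern \<phi> n z))\<bar> + gauss_abs_ln + 2 * sqrt (kern \<phi> n z) * gauss_abs"
    using E unfolding poly_random_poly s by simp_all
  have "expectation (\<lambda>\<omega>. ln (cmod (poly (P n \<omega>) z))) = ln (sqrt (kern \<phi> n z)) + gauss_const"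
    using E unfolding poly_random_poly s by simp
  then show "expectation (\<lambda>\<omega>. ln (cmod (poly (P n \<omega>) z))) = (ln (kern \<phi> n z) + 2 * gauss_const) / 2"
    using kern_positive[of n z] by (simp add: ln_sqrt)
qed

lemma AE_random_poly_nz: "AE \<omega> in M. P n \<omega> \<noteq> 0"
  using ln_random_poly(1)[of n 0] by eventually_elim auto

end

locale random_bump = random_zeros M \<eta> \<nu> \<phi> + bump \<alpha> \<beta> g g1 g2
  for M :: "'w measure" and \<eta> \<nu> \<phi> \<alpha> \<beta> g g1 g2
begin

text \<open>Instead of following individual zeros, the sum is expressed by
  \<open>zero_sum_log_potential\<close> as an integral of a jointly measurable function.\<close>

lemma zero_sum_power_measurable [measurable]:
  "(\<lambda>\<omega>. zero_sum gt (\<lambda>z. Re (c * z ^ k)) (P n \<omega>)) \<in> borel_measurable M"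
proof -
  have "(\<lambda>\<omega>. if P n \<omega> = 0 then 0 else 1 / (2 * pi) *
    (\<integral>x. (gt2 x - (real k)\<^sup>2 * gt x) * (\<integral>z. ln (cmod (poly (P n \<omega>) (of_real (exp x) * z))) * Re (c * z ^ k) \<partial>arclength) \<partial>lborel)) \<in> borel_measurable M"
    unfolding poly_random_poly by measurable
  also have "(\<lambda>\<omega>. if P n \<omega> = 0 then 0 else 1 / (2 * pi) *
    (\<integral>x. (gt2 x - (real k)\<^sup>2 * gt x) * (\<integral>z. ln (cmod (poly (P n \<omega>) (of_real (exp x) * z))) * Re (c * z ^ k) \<partial>arclength) \<partial>lborel))
    = (\<lambda>\<omega>. zero_sum gt (\<lambda>z. Re (c * z ^ k)) (P n \<omega>))"
    by (intro ext) (simp add: zero_sum_log_potential del: times_complex.sel)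
  finally show ?thesis .
qed

text \<open>Fubini for the potential formula, followed by the expected logarithm at each fixed
  point.\<close>

lemma expectation_zero_sum_potential:
  "expectation (\<lambda>\<omega>. zero_sum gt (\<lambda>z. Re (c * z ^ k)) (P n \<omega>)) = 1 / (2 * pi) *
    (\<integral>y. (gt2 (fst y) - (real k)\<^sup>2 * gt (fst y)) * Re (c * snd y ^ k) *
       ((ln (kern \<phi> n (of_real (exp (fst y)) * snd y)) + 2 * gauss_const) / 2) \<partial>polar_measure)"
proof -
  interpret QM: pair_sigma_finite polar_measure M ..
  define \<kappa> where "\<kappa> x = gt2 x - (real k)\<^sup>2 * gt x" for x
  have [measurable]: "\<kappa> \<in> borel_measurable borel" unfolding \<kappa>_def by measurable
  define lnP where "lnP \<omega> y = ln (cmod (poly (P n \<omega>) (of_real (exp (fst y)) * snd y)))" for \<omega> and y :: "real \<times> complex"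
  define F where "F y \<omega> = \<kappa> (fst y) * Re (c * snd y ^ k) * lnP \<omega> y" for y \<omega>
  have Fm[measurable]: "case_prod F \<in> borel_measurable (polar_measure \<Otimes>\<^sub>M M)"
    unfolding F_def lnP_def poly_random_poly by measurable
  have lnP: "integrable M (\<lambda>\<omega>. lnP \<omega> y)"
     "expectation (\<lambda>\<omega>. lnP \<omega> y) = (ln (kern \<phi> n (of_real (exp (fst y)) * snd y)) + 2 * gauss_const) / 2" for y
    unfolding lnP_def using ln_random_poly by blast+
  \<comment> \<open>A majorant of the expected absolute logarithm. It is continuous since
    \<open>kern\<close> is positive everywhere, hence bounded on the compact box; this justifies
    Fubini.\<close>
  define B where "B y = \<bar>ln (sqrt (kern \<phi> n (of_real (exp (fst y)) * snd y)))\<bar> + gauss_abs_ln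
      + 2 * sqrt (kern \<phi> n (of_real (exp (fst y)) * snd y)) * gauss_abs" for y :: "real \<times> complex"
  have lnPB: "expectation (\<lambda>\<omega>. \<bar>lnP \<omega> y\<bar>) \<le> B y" for y
    unfolding lnP_def B_def by (rule ln_random_poly)
  have kne: "kern \<phi> n w \<noteq> 0" for w using kern_positive[of n w] by simp
  have "continuous_on ({\<alpha>..\<beta>} \<times> unit_circle) (\<lambda>y. (g2 (fst y) - (real k)\<^sup>2 * g (fst y)) * Re (c * snd y ^ k) * B y)"
    unfolding B_def using kne
    by (intro continuous_intros continuous_on_compose2[OF g2_cont] continuous_on_compose2[OF g_cont(1)]) auto
  then obtain C where C: "0 \<le> C" "\<And>x z. x \<in> {\<alpha>..\<beta>} \<Longrightarrow> z \<in> unit_circle \<Longrightarrow>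
      \<bar>(g2 x - (real k)\<^sup>2 * g x) * Re (c * z ^ k) * B (x, z)\<bar> \<le> C"
    by (rule polar_bound) simp
  have iF: "integrable M (F y)" for y
    unfolding F_def using lnP(1) by simp
  have eF: "expectation (\<lambda>\<omega>. norm (F y \<omega>)) = \<bar>\<kappa> (fst y) * Re (c * snd y ^ k)\<bar> * expectation (\<lambda>\<omega>. \<bar>lnP \<omega> y\<bar>)" for y
    by (simp only: F_def real_norm_def abs_mult[of _ "lnP _ y"] integral_mult_right_zero)
  have i1: "integrable polar_measure (\<lambda>y. expectation (\<lambda>\<omega>. norm (case_prod F (y, \<omega>))))"
  proof (rule polar_integrable_bounded[where C = C])
    fix x z assume z: "z \<in> unit_circle"
    show "\<bar>expectation (\<lambda>\<omega>. norm (case_prod F ((x, z), \<omega>)))\<bar> \<le> C * indicator {\<alpha>..\<beta>} x"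
    proof (cases "x \<in> {\<alpha>..\<beta>}")
      case True
      have "expectation (\<lambda>\<omega>. norm (F (x, z) \<omega>)) \<le> \<bar>\<kappa> x * Re (c * z ^ k)\<bar> * B (x, z)"
        unfolding eF by (simp only: fst_conv snd_conv) (intro mult_left_mono lnPB, simp)
      also have "\<dots> \<le> \<bar>(g2 x - (real k)\<^sup>2 * g x) * Re (c * z ^ k) * B (x, z)\<bar>"
        using True by (simp add: \<kappa>_def gt_def gt2_def abs_mult mult_left_mono del: times_complex.sel)
      also have "\<dots> \<le> C" by (rule C(2)[OF True z])
      finally show ?thesis using True by (simp add: integral_nonneg_AE)
    next
      case False
      then have "\<kappa> x = 0" unfolding \<kappa>_def gt_indicator by simp
      then have "F (x, z) \<omega> = 0" for \<omega> by (simp add: F_def)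
      then show ?thesis using False by simp
    qed
  qed measurable
  have int: "integrable (polar_measure \<Otimes>\<^sub>M M) (case_prod F)"
    by (rule QM.Fubini_integrable[OF Fm i1]) (simp add: iF)
  have "expectation (\<lambda>\<omega>. zero_sum gt (\<lambda>z. Re (c * z ^ k)) (P n \<omega>))
      = expectation (\<lambda>\<omega>. 1 / (2 * pi) * (\<integral>y. F y \<omega> \<partial>polar_measure))"
  proof (rule integral_cong_AE)
    show "AE \<omega> in M. zero_sum gt (\<lambda>z. Re (c * z ^ k)) (P n \<omega>) = 1 / (2 * pi) * (\<integral>y. F y \<omega> \<partial>polar_measure)"
      using AE_random_poly_nz[of n] QM.AE_integrable_snd[OF int]
    proof eventually_elim
      case (elim \<omega>)
      have "(\<integral>y. F y \<omega> \<partial>polar_measure) = (\<integral>x. (\<integral>z. F (x, z) \<omega> \<partial>arclength) \<partial>lborel)"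
        by (rule box.integral_fst'[OF elim(2), symmetric])
      also have "\<dots> = (\<integral>x. (gt2 x - (real k)\<^sup>2 * gt x) * (\<integral>z. ln (cmod (poly (P n \<omega>) (of_real (exp x) * z))) * Re (c * z ^ k) \<partial>arclength) \<partial>lborel)"
      proof (intro Bochner_Integration.integral_cong refl)
        fix x
        have "F (x, z) \<omega> = (gt2 x - (real k)\<^sup>2 * gt x) * (ln (cmod (poly (P n \<omega>) (of_real (exp x) * z))) * Re (c * z ^ k))" for z
          by (simp only: F_def lnP_def \<kappa>_def fst_conv snd_conv mult_ac)
        then show "(\<integral>z. F (x, z) \<omega> \<partial>arclength) = (gt2 x - (real k)\<^sup>2 * gt x) * (\<integral>z. ln (cmod (poly (P n \<omega>) (of_real (exp x) * z))) * Re (c * z ^ k) \<partial>arclength)"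
          by (simp only: integral_mult_right_zero)
      qed
      finally show ?case by (simp only: zero_sum_log_potential[OF elim(1)])
    qed
  qed measurable
  also have "\<dots> = 1 / (2 * pi) * (\<integral>\<omega>. (\<integral>y. F y \<omega> \<partial>polar_measure) \<partial>M)" by simp
  also have "(\<integral>\<omega>. (\<integral>y. F y \<omega> \<partial>polar_measure) \<partial>M) = (\<integral>y. (\<integral>\<omega>. F y \<omega> \<partial>M) \<partial>polar_measure)"
    by (rule QM.Fubini_integral[OF int])
  finally show ?thesis
    by (simp only: F_def integral_mult_right_zero lnP(2) \<kappa>_def)
qed

text \<open>The derivatives move from the test function to \<open>ln (kern \<phi> n z)\<close>,
  radially for \<open>gt2\<close> and angularly for \<open>- k^2\<close>. The factor is
  \<open>1 / (2 * pi)\<close> times the \<open>1 / 2\<close> from the square root of the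
  kernel.\<close>

theorem expectation_zero_sum_power:
  "expectation (\<lambda>\<omega>. zero_sum gt (\<lambda>z. Re (c * z ^ k)) (P n \<omega>)) = 1 / (4 * pi) *
    (\<integral>y. gt (fst y) * Re (c * snd y ^ k) * log_laplace \<phi> n (of_real (exp (fst y)) * snd y) \<partial>polar_measure)"
proof -
  note pos = kern_positive[of n]
  define C where "C = 2 * gauss_const"
  define w where "w y = of_real (exp (fst y)) * snd y" for y :: "real \<times> complex"
  have [measurable]: "w \<in> borel_measurable polar_measure" unfolding w_def by measurable
  define q where "q z = Re (c * z ^ k)" for z
  have [measurable]: "q \<in> borel_measurable borel" unfolding q_def by measurable
  have contq: "continuous_on A (\<lambda>y. q (f y))" if "continuous_on A f" for f :: "real \<times> complex \<Rightarrow> complex" and A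
    unfolding q_def by (intro continuous_intros that)
  have wc: "continuous_on A w" for A unfolding w_def by (intro continuous_intros)
  have gc: "continuous_on ({\<alpha>..\<beta>} \<times> unit_circle) (\<lambda>y. g (fst y))" "continuous_on ({\<alpha>..\<beta>} \<times> unit_circle) (\<lambda>y. g2 (fst y))"
    by (auto intro!: continuous_on_compose2[OF g2_cont] continuous_on_compose2[OF g_cont(1)] continuous_intros)
  note cc = continuous_intros contq gc wc continuous_on_log_d[OF pos]
  have A1: "integrable polar_measure (\<lambda>y. gt2 (fst y) * q (snd y) * (ln (kern \<phi> n (w y)) + C))"
    by (rule polar_integrable_continuous[of \<alpha> \<beta> "\<lambda>y. g2 (fst y) * q (snd y) * (ln (kern \<phi> n (w y)) + C)"])
       (intro cc, measurable, simp add: gt2_def)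
  have A2: "integrable polar_measure (\<lambda>y. gt (fst y) * (- (real k)\<^sup>2 * (q (snd y) * (ln (kern \<phi> n (w y)) + C))))"
    by (rule polar_integrable_continuous[of \<alpha> \<beta> "\<lambda>y. g (fst y) * (- (real k)\<^sup>2 * (q (snd y) * (ln (kern \<phi> n (w y)) + C)))"])
       (intro cc, measurable, simp add: gt_def)
  have A3: "integrable polar_measure (\<lambda>y. gt (fst y) * q (snd y) * log_d2 e \<phi> n (w y))" for e
    by (rule polar_integrable_continuous[of \<alpha> \<beta> "\<lambda>y. g (fst y) * q (snd y) * log_d2 e \<phi> n (w y)"])
       (intro cc, measurable, simp add: gt_def)
  have B1: "(\<integral>y. gt2 (fst y) * q (snd y) * (ln (kern \<phi> n (w y)) + C) \<partial>polar_measure)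
      = (\<integral>y. gt (fst y) * q (snd y) * log_d2 1 \<phi> n (w y) \<partial>polar_measure)"
  proof -
    have "(\<integral>x. gt2 x * q z * (ln (kern \<phi> n (w (x, z))) + C) \<partial>lborel) = (\<integral>x. gt x * q z * log_d2 1 \<phi> n (w (x, z)) \<partial>lborel)" for z
    proof -
      have "(\<integral>x. gt2 x * q z * (ln (kern \<phi> n (w (x, z))) + C) \<partial>lborel) = q z * (\<integral>x. gt2 x * (ln (kern \<phi> n (of_real (exp x) * z)) + C) \<partial>lborel)"
        by (simp add: w_def mult_ac flip: integral_mult_right_zero)
      also have "\<dots> = q z * (\<integral>x. gt x * log_d2 1 \<phi> n (of_real (exp x) * z) \<partial>lborel)"
        by (simp only: radial_parts[OF pos, where z = z and C = C])
      also have "\<dots> = (\<integral>x. gt x * q z * log_d2 1 \<phi> n (w (x, z)) \<partial>lborel)"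
        by (simp add: w_def mult_ac flip: integral_mult_right_zero)
      finally show ?thesis .
    qed
    then show ?thesis
      using box.integral_snd[of "\<lambda>x z. gt2 x * q z * (ln (kern \<phi> n (w (x, z))) + C)"]
        box.integral_snd[of "\<lambda>x z. gt x * q z * log_d2 1 \<phi> n (w (x, z))"] A1 A3[of 1]
      by (simp add: case_prod_beta')
  qed
  have B2: "(\<integral>y. gt (fst y) * (- (real k)\<^sup>2 * (q (snd y) * (ln (kern \<phi> n (w y)) + C))) \<partial>polar_measure)
      = (\<integral>y. gt (fst y) * q (snd y) * log_d2 \<i> \<phi> n (w y) \<partial>polar_measure)"
  proof -
    have "(\<integral>z. gt x * (- (real k)\<^sup>2 * (q z * (ln (kern \<phi> n (w (x, z))) + C))) \<partial>arclength)
       = (\<integral>z. gt x * q z * log_d2 \<i> \<phi> n (w (x, z)) \<partial>arclength)" for x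
      using angular_parts[OF pos, of c k "exp x" C]
      by (simp only: w_def q_def fst_conv snd_conv mult.assoc integral_mult_right_zero)
    then show ?thesis
      using box.integral_fst'[OF A2] box.integral_fst'[OF A3[of \<i>]] by simp
  qed
  have "(\<integral>y. (gt2 (fst y) - (real k)\<^sup>2 * gt (fst y)) * q (snd y) * ((ln (kern \<phi> n (w y)) + C) / 2) \<partial>polar_measure)
     = (\<integral>y. (gt2 (fst y) * q (snd y) * (ln (kern \<phi> n (w y)) + C) + gt (fst y) * (- (real k)\<^sup>2 * (q (snd y) * (ln (kern \<phi> n (w y)) + C)))) / 2 \<partial>polar_measure)"
    by (intro Bochner_Integration.integral_cong refl) (simp add: algebra_simps diff_divide_distrib add_divide_distrib)
  also have "\<dots> = ((\<integral>y. gt (fst y) * q (snd y) * log_d2 1 \<phi> n (w y) \<partial>polar_measure)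
      + (\<integral>y. gt (fst y) * q (snd y) * log_d2 \<i> \<phi> n (w y) \<partial>polar_measure)) / 2"
    by (simp only: integral_divide_zero Bochner_Integration.integral_add[OF A1 A2] B1 B2)
  also have "\<dots> = (\<integral>y. gt (fst y) * q (snd y) * log_d2 1 \<phi> n (w y) + gt (fst y) * q (snd y) * log_d2 \<i> \<phi> n (w y) \<partial>polar_measure) / 2"
    by (simp only: Bochner_Integration.integral_add[OF A3 A3])
  also have "\<dots> = (\<integral>y. gt (fst y) * q (snd y) * log_laplace \<phi> n (w y) \<partial>polar_measure) / 2"
  proof -
    have "log_d2 1 \<phi> n v + log_d2 \<i> \<phi> n v = log_laplace \<phi> n v" for v
      using pos[of v] by (intro log_laplace_eq) simp
    then show ?thesis by (simp only: distrib_left[symmetric])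
  qed
  finally show ?thesis
    unfolding expectation_zero_sum_potential q_def w_def C_def by simp
qed

end

section \<open>Trigonometric approximation\<close>

text \<open>Agreement on the circle is all that is asked; real parts of polynomials suffice because
  there negative powers are conjugates of positive ones.\<close>

definition trig_poly :: "(complex \<Rightarrow> real) \<Rightarrow> bool" where
  "trig_poly f \<longleftrightarrow> (\<exists>p. \<forall>z\<in>unit_circle. f z = Re (poly p z))"

lemma trig_poly_add: "trig_poly f \<Longrightarrow> trig_poly h \<Longrightarrow> trig_poly (\<lambda>z. f z + h z)"
  unfolding trig_poly_def
proof (elim exE)
  fix p q assume "\<forall>z\<in>unit_circle. f z = Re (poly p z)" "\<forall>z\<in>unit_circle. h z = Re (poly q z)"
  then show "\<exists>p. \<forall>z\<in>unit_circle. f z + h z = Re (poly p z)"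
    by (intro exI[of _ "p + q"]) simp
qed

lemma trig_poly_sum: "finite A \<Longrightarrow> (\<And>i. i \<in> A \<Longrightarrow> trig_poly (f i)) \<Longrightarrow> trig_poly (\<lambda>z. \<Sum>i\<in>A. f i z)"
proof (induction A rule: finite_induct)
  case empty
  show ?case unfolding trig_poly_def by (rule exI[of _ 0]) simp
qed (auto intro: trig_poly_add)

lemma trig_poly_Re_power: "trig_poly (\<lambda>z. Re (c * z ^ k))"
  unfolding trig_poly_def by (rule exI[of _ "monom c k"]) (simp add: poly_monom)

lemma trig_poly_cong: "trig_poly f \<Longrightarrow> (\<And>z. z \<in> unit_circle \<Longrightarrow> h z = f z) \<Longrightarrow> trig_poly h"
  unfolding trig_poly_def by auto

text \<open>Product-to-sum formula. On the circle \<open>z ^ i * cnj (z ^ k)\<close> is a power of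
  \<open>z\<close> or the conjugate of one, depending on the sign of \<open>i - k\<close>.\<close>

lemma trig_poly_Re_mult_power:
  "trig_poly (\<lambda>z. Re (b * z ^ i) * Re (c * z ^ k))"
proof -
  have "trig_poly (\<lambda>z. Re (b * cnj c / 2 * (z ^ i * cnj (z ^ k))))"
  proof (cases "k \<le> i")
    case True
    show ?thesis
    proof (rule trig_poly_cong[OF trig_poly_Re_power[of "b * cnj c / 2" "i - k"]])
      fix z :: complex assume "z \<in> unit_circle"
      then have z: "z * cnj z = 1" by (simp add: complex_norm_square[symmetric])
      have "z ^ i = z ^ (i - k) * z ^ k" using True by (simp flip: power_add)
      moreover have "z ^ k * cnj (z ^ k) = 1" using z by (simp flip: power_mult_distrib)
      ultimately have "z ^ i * cnj (z ^ k) = z ^ (i - k)" by (simp only: mult.assoc mult_1_right)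
      then show "Re (b * cnj c / 2 * (z ^ i * cnj (z ^ k))) = Re (b * cnj c / 2 * z ^ (i - k))"
        by (simp only:)
    qed
  next
    case False
    show ?thesis
    proof (rule trig_poly_cong[OF trig_poly_Re_power[of "cnj (b * cnj c / 2)" "k - i"]])
      fix z :: complex assume "z \<in> unit_circle"
      then have z: "z * cnj z = 1" by (simp add: complex_norm_square[symmetric])
      have "z ^ k = z ^ i * z ^ (k - i)" using False by (simp flip: power_add)
      moreover have "z ^ i * cnj (z ^ i) = 1" using z by (simp flip: power_mult_distrib)
      ultimately have "z ^ i * cnj (z ^ k) = cnj (z ^ (k - i))"
        by (simp only: complex_cnj_mult mult.assoc[symmetric] mult_1_left)
      then have "b * cnj c / 2 * (z ^ i * cnj (z ^ k)) = cnj (cnj (b * cnj c / 2) * z ^ (k - i))"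
        by simp
      then show "Re (b * cnj c / 2 * (z ^ i * cnj (z ^ k))) = Re (cnj (b * cnj c / 2) * z ^ (k - i))"
        by (simp only: cnj.sel)
    qed
  qed
  from trig_poly_add[OF this trig_poly_Re_power[of "b * c / 2" "i + k"]] show ?thesis
  proof (rule trig_poly_cong)
    fix z
    have "Re u * Re v = Re (u * cnj v / 2) + Re (u * v / 2)" for u v
      by (simp add: add_divide_distrib diff_divide_distrib)
    moreover have "(b * z ^ i) * cnj (c * z ^ k) / 2 = b * cnj c / 2 * (z ^ i * cnj (z ^ k))"
      "(b * z ^ i) * (c * z ^ k) / 2 = b * c / 2 * z ^ (i + k)" by (simp_all add: power_add)
    ultimately show "Re (b * z ^ i) * Re (c * z ^ k) = Re (b * cnj c / 2 * (z ^ i * cnj (z ^ k))) + Re (b * c / 2 * z ^ (i + k))"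
      by (simp only:)
  qed
qed

lemma Re_poly_altdef: "Re (poly p z) = (\<Sum>i\<le>degree p. Re (coeff p i * z ^ i))"
  by (simp only: poly_altdef Re_sum)

lemma trig_poly_mult:
  assumes "trig_poly f" "trig_poly h"
  shows "trig_poly (\<lambda>z. f z * h z)"
proof -
  obtain p where p: "\<forall>z\<in>unit_circle. f z = Re (poly p z)"
    using assms(1) unfolding trig_poly_def by (elim exE)
  obtain q where q: "\<forall>z\<in>unit_circle. h z = Re (poly q z)"
    using assms(2) unfolding trig_poly_def by (elim exE)
  have "trig_poly (\<lambda>z. \<Sum>i\<le>degree p. \<Sum>k\<le>degree q. Re (coeff p i * z ^ i) * Re (coeff q k * z ^ k))"
    by (intro trig_poly_sum trig_poly_Re_mult_power) auto
  then show ?thesis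
    by (rule trig_poly_cong) (simp only: bspec[OF p] bspec[OF q] Re_poly_altdef sum_product)
qed

text \<open>Every real-linear functional on the complex plane has the form
  \<open>Re (c * z)\<close>; sums and products are already covered.\<close>

lemma trig_poly_real_polynomial_function:
  assumes "real_polynomial_function f"
  shows "trig_poly f"
  using assms
proof (induction rule: real_polynomial_function.induct)
  case (linear f)
  interpret bounded_linear f by fact
  have "f z = Re (Complex (f 1) (- f \<i>) * z ^ 1)" for z
  proof -
    have "z = Re z *\<^sub>R 1 + Im z *\<^sub>R \<i>" by (simp add: complex_eq_iff)
    then have "f z = f (Re z *\<^sub>R 1 + Im z *\<^sub>R \<i>)" by simp
    also have "\<dots> = Re z * f 1 + Im z * f \<i>" by (simp add: add scaleR)
    finally show ?thesis by simp
  qed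
  then show ?case by (rule trig_poly_cong[OF trig_poly_Re_power])
next
  case (const c)
  show ?case unfolding trig_poly_def by (rule exI[of _ "[:of_real c:]"]) simp
qed (auto intro: trig_poly_add trig_poly_mult)

lemma trig_poly_approx:
  assumes "continuous_on unit_circle f" "0 < \<epsilon>"
  obtains p where "\<And>z. z \<in> unit_circle \<Longrightarrow> \<bar>f z - Re (poly p z)\<bar> < \<epsilon>"
proof -
  obtain h where h: "real_polynomial_function h" "\<And>z. z \<in> unit_circle \<Longrightarrow> \<bar>f z - h z\<bar> < \<epsilon>"
    using Stone_Weierstrass_real_polynomial_function[OF compact_sphere assms] by blast
  then show ?thesis
  proof -
    obtain p where p: "\<forall>z\<in>unit_circle. h z = Re (poly p z)"
      using trig_poly_real_polynomial_function[OF h(1)] unfolding trig_poly_def by (elim exE)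
    show ?thesis by (rule that[of p]) (simp only: bspec[OF p, symmetric] h(2))
  qed
qed

section \<open>From angular modes to continuous weights and indicators\<close>

lemma zero_sum_sum: "zero_sum G (\<lambda>z. \<Sum>i\<in>A. f i z) p = (\<Sum>i\<in>A. zero_sum G (f i) p)"
  unfolding zero_sum_def sum_distrib_left by (rule sum.swap)

context random_bump
begin

abbreviation polar_lap :: "nat \<Rightarrow> real \<times> complex \<Rightarrow> real" where
  "polar_lap n y \<equiv> log_laplace \<phi> n (of_real (exp (fst y)) * snd y)"

lemma polar_lap_integrable:
  assumes "continuous_on unit_circle f" and [measurable]: "f \<in> borel_measurable borel"
  shows "integrable polar_measure (\<lambda>y. gt (fst y) * f (snd y) * polar_lap n y)"
proof (rule polar_integrable_continuous[of \<alpha> \<beta> "\<lambda>y. g (fst y) * f (snd y) * polar_lap n y"])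
  show "continuous_on ({\<alpha>..\<beta>} \<times> unit_circle) (\<lambda>y. g (fst y) * f (snd y) * polar_lap n y)"
    by (intro continuous_intros continuous_on_log_d[OF kern_positive]
        continuous_on_compose2[OF assms(1)] continuous_on_compose2[OF g_cont(1)]) auto
  show "gt (fst (x, z)) * f (snd (x, z)) * polar_lap n (x, z) = indicator {\<alpha>..\<beta>} x * (g (fst (x, z)) * f (snd (x, z)) * polar_lap n (x, z))" for x z
    by (simp add: gt_def)
qed measurable

lemma gt_bounded: obtains B where "0 < B" "\<And>x. \<bar>gt x\<bar> \<le> B"
proof -
  have "compact (g ` {\<alpha>..\<beta>})" by (intro compact_continuous_image g_cont) auto
  then obtain B where B: "\<And>x. x \<in> {\<alpha>..\<beta>} \<Longrightarrow> \<bar>g x\<bar> \<le> B"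
    by (force simp: bounded_iff dest!: compact_imp_bounded)
  have "0 \<le> B" using B[of \<alpha>] ab by (simp add: bd)
  then show ?thesis by (intro that[of "B + 1"]) (auto simp: gt_def intro: order.trans[OF B])
qed

lemma zero_sum_poly:
  "(\<lambda>\<omega>. zero_sum gt (\<lambda>z. Re (poly p z)) (P n \<omega>)) \<in> borel_measurable M"
  "expectation (\<lambda>\<omega>. zero_sum gt (\<lambda>z. Re (poly p z)) (P n \<omega>)) = 1 / (4 * pi) *
    (\<integral>y. gt (fst y) * Re (poly p (snd y)) * polar_lap n y \<partial>polar_measure)"
proof -
  let ?Z = "\<lambda>i \<omega>. zero_sum gt (\<lambda>z. Re (coeff p i * z ^ i)) (P n \<omega>)"
  have eq: "zero_sum gt (\<lambda>z. Re (poly p z)) (P n \<omega>) = (\<Sum>i\<le>degree p. ?Z i \<omega>)" for \<omega>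
    unfolding Re_poly_altdef by (rule zero_sum_sum)
  show "(\<lambda>\<omega>. zero_sum gt (\<lambda>z. Re (poly p z)) (P n \<omega>)) \<in> borel_measurable M"
    unfolding eq by measurable
  obtain B where B: "0 < B" "\<And>x. \<bar>gt x\<bar> \<le> B" using gt_bounded by metis
  have int: "integrable M (?Z i)" for i
  proof (rule integrable_const_bound)
    show "AE \<omega> in M. norm (?Z i \<omega>) \<le> real n * (B * cmod (coeff p i))"
    proof (rule AE_I2, unfold real_norm_def, rule zero_sum_bound[OF degree_random_poly])
      fix a :: complex assume a: "a \<noteq> 0"
      have "\<bar>Re (coeff p i * sgn a ^ i)\<bar> \<le> cmod (coeff p i)"
        by (rule order.trans[OF abs_Re_le_cmod]) (simp add: norm_mult norm_power norm_sgn a)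
      then show "\<bar>gt (ln (cmod a)) * Re (coeff p i * sgn a ^ i)\<bar> \<le> B * cmod (coeff p i)"
        unfolding abs_mult using B by (intro mult_mono) auto
    qed (use B in auto)
  qed measurable
  have int2: "integrable polar_measure (\<lambda>y. gt (fst y) * Re (coeff p i * snd y ^ i) * polar_lap n y)" for i
    by (rule polar_lap_integrable) (intro continuous_intros, measurable)
  have "expectation (\<lambda>\<omega>. zero_sum gt (\<lambda>z. Re (poly p z)) (P n \<omega>)) = (\<Sum>i\<le>degree p. expectation (?Z i))"
    unfolding eq by (rule Bochner_Integration.integral_sum) (rule int)
  also have "\<dots> = 1 / (4 * pi) * (\<Sum>i\<le>degree p. \<integral>y. gt (fst y) * Re (coeff p i * snd y ^ i) * polar_lap n y \<partial>polar_measure)"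
    by (simp only: expectation_zero_sum_power sum_distrib_left)
  also have "(\<Sum>i\<le>degree p. \<integral>y. gt (fst y) * Re (coeff p i * snd y ^ i) * polar_lap n y \<partial>polar_measure)
     = (\<integral>y. (\<Sum>i\<le>degree p. gt (fst y) * Re (coeff p i * snd y ^ i) * polar_lap n y) \<partial>polar_measure)"
    by (rule Bochner_Integration.integral_sum[symmetric]) (rule int2)
  also have "\<dots> = (\<integral>y. gt (fst y) * Re (poly p (snd y)) * polar_lap n y \<partial>polar_measure)"
    by (simp only: Re_poly_altdef sum_distrib_left sum_distrib_right)
  finally show "expectation (\<lambda>\<omega>. zero_sum gt (\<lambda>z. Re (poly p z)) (P n \<omega>)) = 1 / (4 * pi) *
    (\<integral>y. gt (fst y) * Re (poly p (snd y)) * polar_lap n y \<partial>polar_measure)" .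
qed

text \<open>Uniform approximation of \<open>f\<close> by trigonometric polynomials. At fixed
  \<open>n\<close>, the left side is dominated by a constant multiple of \<open>n\<close>, the right
  side by a multiple of \<open>gt\<close> times the Laplacian.\<close>

theorem expectation_zero_sum:
  assumes f: "continuous_on unit_circle f" and fm[measurable]: "f \<in> borel_measurable borel"
  shows "(\<lambda>\<omega>. zero_sum gt f (P n \<omega>)) \<in> borel_measurable M"
   "expectation (\<lambda>\<omega>. zero_sum gt f (P n \<omega>)) = 1 / (4 * pi) *
    (\<integral>y. gt (fst y) * f (snd y) * polar_lap n y \<partial>polar_measure)"
proof -
  obtain B where B: "0 < B" "\<And>x. \<bar>gt x\<bar> \<le> B" using gt_bounded by metis
  have "\<exists>p. \<forall>z\<in>unit_circle. \<bar>f z - Re (poly p z)\<bar> < inverse (real (Suc m))" for m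
  proof -
    have "0 < inverse (real (Suc m))" by simp
    then show ?thesis by (rule trig_poly_approx[OF f]) (rule exI, rule ballI)
  qed
  then obtain p where p: "\<And>m z. z \<in> unit_circle \<Longrightarrow> \<bar>f z - Re (poly (p m) z)\<bar> < inverse (real (Suc m))" by metis
  have e0: "(\<lambda>m. inverse (real (Suc m))) \<longlonglongrightarrow> 0" by (rule LIMSEQ_inverse_real_of_nat)
  obtain C where C: "\<And>z. z \<in> unit_circle \<Longrightarrow> \<bar>f z\<bar> \<le> C"
  proof -
    have "compact (f ` unit_circle)" by (intro compact_continuous_image f) auto
    then obtain C where "\<forall>y\<in>f ` unit_circle. norm y \<le> C"
      using compact_imp_bounded bounded_iff by metis
    then show ?thesis by (intro that[of C]) simp
  qed
  have C1: "\<bar>Re (poly (p m) z)\<bar> \<le> C + 1" if "z \<in> unit_circle" for m z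
  proof -
    have "inverse (real (Suc m)) \<le> 1" by (simp add: inverse_le_1_iff)
    then show ?thesis using p[OF that, of m] C[OF that] by linarith
  qed
  let ?Z = "\<lambda>m \<omega>. zero_sum gt (\<lambda>z. Re (poly (p m) z)) (P n \<omega>)"
  have plim: "(\<lambda>m. Re (poly (p m) z)) \<longlonglongrightarrow> f z" if "z \<in> unit_circle" for z
  proof (rule LIM_zero_cancel, rule Lim_null_comparison[OF _ e0], rule always_eventually, rule allI)
    show "norm (Re (poly (p m) z) - f z) \<le> inverse (real (Suc m))" for m
      using p[OF that, of m] by simp
  qed
  have Zlim: "(\<lambda>m. ?Z m \<omega>) \<longlonglongrightarrow> zero_sum gt f (P n \<omega>)" for \<omega>
    unfolding zero_sum_def by (intro tendsto_intros plim) (auto simp: norm_sgn)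
  show meas: "(\<lambda>\<omega>. zero_sum gt f (P n \<omega>)) \<in> borel_measurable M"
    by (rule borel_measurable_LIMSEQ_real[OF Zlim zero_sum_poly(1)])
  have l1: "(\<lambda>m. expectation (?Z m)) \<longlonglongrightarrow> expectation (\<lambda>\<omega>. zero_sum gt f (P n \<omega>))"
  proof (rule integral_dominated_convergence[where w = "\<lambda>_. real n * (B * (C + 1))"])
    show "AE \<omega> in M. norm (?Z m \<omega>) \<le> real n * (B * (C + 1))" for m
    proof (rule AE_I2, unfold real_norm_def, rule zero_sum_bound[OF degree_random_poly])
      fix a :: complex assume a: "a \<noteq> 0"
      have "\<bar>Re (poly (p m) (sgn a))\<bar> \<le> C + 1" by (rule C1) (simp add: norm_sgn a)
      then show "\<bar>gt (ln (cmod a)) * Re (poly (p m) (sgn a))\<bar> \<le> B * (C + 1)"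
        unfolding abs_mult using B by (intro mult_mono) auto
    next
      have "0 \<le> C + 1" using C1[of 1 0] by simp
      then show "0 \<le> B * (C + 1)" using B by simp
    qed
    show "AE \<omega> in M. (\<lambda>m. ?Z m \<omega>) \<longlonglongrightarrow> zero_sum gt f (P n \<omega>)"
      by (rule AE_I2) (rule Zlim)
  qed (rule meas zero_sum_poly(1) integrable_const)+
  have l2: "(\<lambda>m. 1 / (4 * pi) * (\<integral>y. gt (fst y) * Re (poly (p m) (snd y)) * polar_lap n y \<partial>polar_measure))
     \<longlonglongrightarrow> 1 / (4 * pi) * (\<integral>y. gt (fst y) * f (snd y) * polar_lap n y \<partial>polar_measure)"
  proof (intro tendsto_mult_left integral_dominated_convergence[where w = "\<lambda>y. \<bar>gt (fst y) * (C + 1) * polar_lap n y\<bar>"])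
    show "integrable polar_measure (\<lambda>y. \<bar>gt (fst y) * (C + 1) * polar_lap n y\<bar>)"
      by (intro integrable_abs polar_lap_integrable[of "\<lambda>_. C + 1"]) auto
    show "AE y in polar_measure. (\<lambda>m. gt (fst y) * Re (poly (p m) (snd y)) * polar_lap n y) \<longlonglongrightarrow> gt (fst y) * f (snd y) * polar_lap n y"
      using AE_polar_circle
    proof eventually_elim
      case (elim y)
      show ?case by (rule tendsto_mult_right[OF tendsto_mult_left[OF plim[OF elim]]])
    qed
    show "AE y in polar_measure. norm (gt (fst y) * Re (poly (p m) (snd y)) * polar_lap n y) \<le> \<bar>gt (fst y) * (C + 1) * polar_lap n y\<bar>" for m
      using AE_polar_circle
    proof eventually_elim
      case (elim y)
      have "\<bar>Re (poly (p m) (snd y))\<bar> \<le> \<bar>C + 1\<bar>" using C1[OF elim, of m] by linarith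
      then show ?case unfolding real_norm_def abs_mult
        by (intro mult_right_mono mult_left_mono) simp_all
    qed
  qed measurable
  show "expectation (\<lambda>\<omega>. zero_sum gt f (P n \<omega>)) = 1 / (4 * pi) *
    (\<integral>y. gt (fst y) * f (snd y) * polar_lap n y \<partial>polar_measure)"
    by (rule LIMSEQ_unique[OF l1]) (unfold zero_sum_poly(2), rule l2)
qed

end

text \<open>\<open>1 - (1 - q) ^ Suc k\<close>, where \<open>q\<close> has double zeros at the ends,
  as \<open>bump\<close> demands, and the factor \<open>16 / (\<beta> - \<alpha>) ^ 4\<close> makes
  its maximum one, at the midpoint. In the limit the indicator of the open interval appears.\<close>

definition bump_poly :: "real \<Rightarrow> real \<Rightarrow> nat \<Rightarrow> real poly" where
  "bump_poly \<alpha> \<beta> k = 1 - (1 - smult (16 / (\<beta> - \<alpha>) ^ 4) (([:-\<alpha>, 1:] * [:\<beta>, -1:])\<^sup>2)) ^ Suc k"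

lemma bump_bump_poly:
  assumes "\<alpha> < \<beta>"
  shows "bump \<alpha> \<beta> (poly (bump_poly \<alpha> \<beta> k)) (poly (pderiv (bump_poly \<alpha> \<beta> k))) (poly (pderiv (pderiv (bump_poly \<alpha> \<beta> k))))"
proof
  define q where "q = [:-\<alpha>, 1:] * [:\<beta>, -1:]"
  have q: "poly q \<alpha> = 0" "poly q \<beta> = 0" by (simp_all add: q_def)
  show "poly (bump_poly \<alpha> \<beta> k) \<alpha> = 0" "poly (bump_poly \<alpha> \<beta> k) \<beta> = 0"
    unfolding bump_poly_def q_def[symmetric] by (simp_all add: q)
  show "poly (pderiv (bump_poly \<alpha> \<beta> k)) \<alpha> = 0" "poly (pderiv (bump_poly \<alpha> \<beta> k)) \<beta> = 0"
    unfolding bump_poly_def q_def[symmetric] pderiv_diff pderiv_power_Suc pderiv_smult power2_eq_square pderiv_mult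
    by (simp_all add: q)
qed (use assms in \<open>auto intro: DERIV_subset[OF poly_DERIV] intro!: continuous_intros\<close>)

lemma bump_poly_limit:
  assumes "x \<in> {\<alpha><..<\<beta>}"
  shows "\<bar>poly (bump_poly \<alpha> \<beta> k) x\<bar> \<le> 1" "(\<lambda>k. poly (bump_poly \<alpha> \<beta> k) x) \<longlonglongrightarrow> 1"
proof -
  define q where "q = 16 / (\<beta> - \<alpha>) ^ 4 * ((x - \<alpha>) * (\<beta> - x))\<^sup>2"
  have p: "poly (bump_poly \<alpha> \<beta> k) x = 1 - (1 - q) ^ Suc k" for k
    by (simp add: bump_poly_def q_def power_mult_distrib algebra_simps)
  have pos: "0 < (x - \<alpha>) * (\<beta> - x)" using assms by simp
  \<comment> \<open>The inequality of arithmetic and geometric means gives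
    \<open>q \<le> 1\<close>.\<close>
  have "4 * ((x - \<alpha>) * (\<beta> - x)) = (\<beta> - \<alpha>)\<^sup>2 - (\<alpha> + \<beta> - 2 * x)\<^sup>2"
    by (simp add: power2_eq_square algebra_simps)
  then have "4 * ((x - \<alpha>) * (\<beta> - x)) \<le> (\<beta> - \<alpha>)\<^sup>2" by simp
  then have "(4 * ((x - \<alpha>) * (\<beta> - x)))\<^sup>2 \<le> ((\<beta> - \<alpha>)\<^sup>2)\<^sup>2" using pos by (intro power_mono) auto
  then have "16 * ((x - \<alpha>) * (\<beta> - x))\<^sup>2 \<le> (\<beta> - \<alpha>) ^ 4" unfolding power_mult_distrib by simp
  moreover have "0 < (\<beta> - \<alpha>) ^ 4" using assms by simp
  ultimately have q: "0 < q" "q \<le> 1" using pos by (simp_all add: q_def field_simps)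
  have "0 \<le> (1 - q) ^ Suc k" "(1 - q) ^ Suc k \<le> 1" using q by (auto intro!: power_le_one simp del: power_Suc)
  then show "\<bar>poly (bump_poly \<alpha> \<beta> k) x\<bar> \<le> 1" unfolding p by linarith
  have "(\<lambda>k. (1 - q) ^ k) \<longlonglongrightarrow> 0" using q by (intro LIMSEQ_realpow_zero) auto
  then have "(\<lambda>k. 1 - (1 - q) ^ Suc k) \<longlonglongrightarrow> 1 - 0" by (intro tendsto_diff tendsto_const LIMSEQ_Suc)
  then show "(\<lambda>k. poly (bump_poly \<alpha> \<beta> k) x) \<longlonglongrightarrow> 1" unfolding p by simp
qed

text \<open>A continuous majorant of the indicator of \<open>S\<close>, shrinking to it because
  \<open>S\<close> is closed.\<close>

definition cone_indicator :: "complex set \<Rightarrow> nat \<Rightarrow> complex \<Rightarrow> real" where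
  "cone_indicator S k z = max 0 (1 - real k * infdist z S)"

lemma cone_indicator:
  assumes "closed S" "S \<noteq> {}"
  shows "(\<lambda>k. cone_indicator S k z) \<longlonglongrightarrow> indicator S z" "\<bar>cone_indicator S k z\<bar> \<le> 1"
    "continuous_on A (cone_indicator S k)"
proof -
  show "(\<lambda>k. cone_indicator S k z) \<longlonglongrightarrow> indicator S z"
  proof (cases "z \<in> S")
    case True then show ?thesis by (simp add: cone_indicator_def)
  next
    case False
    then have d: "0 < infdist z S"
      using assms by (metis in_closed_iff_infdist_zero infdist_nonneg less_eq_real_def)
    have "eventually (\<lambda>k. 1 / infdist z S < real k) sequentially"
      using filterlim_real_sequentially unfolding filterlim_at_top_dense by blast
    then have "eventually (\<lambda>k. cone_indicator S k z = 0) sequentially"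
      by eventually_elim (use d in \<open>simp add: cone_indicator_def field_simps\<close>)
    then show ?thesis using False by (simp add: tendsto_eventually)
  qed
  show "\<bar>cone_indicator S k z\<bar> \<le> 1" using infdist_nonneg[of z S] by (simp add: cone_indicator_def)
  show "continuous_on A (cone_indicator S k)"
    unfolding cone_indicator_def by (intro continuous_intros)
qed

context random_zeros
begin

abbreviation cone :: "complex set \<Rightarrow> real \<Rightarrow> real \<Rightarrow> complex set" where
  "cone S \<alpha> \<beta> \<equiv> {of_real (exp x) * z | x z. z \<in> S \<and> x \<in> {\<alpha><..<\<beta>}}"

text \<open>Radial bumps and angular cut-offs tend to indicators with the same index
  \<open>k\<close>. For fixed \<open>n\<close> the sums over zeros are at most \<open>n\<close>, so
  dominated convergence applies to both sides.\<close>

theorem expected_zero_count: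
  assumes S: "compact S" "S \<subseteq> unit_circle" "S \<noteq> {}" and ab: "\<alpha> < \<beta>"
  shows "expectation (\<lambda>\<omega>. real (zero_count (P n \<omega>) (cone S \<alpha> \<beta>))) = 1 / (4 * pi) *
     (\<integral>y. indicator {\<alpha><..<\<beta>} (fst y) * indicator S (snd y) * log_laplace \<phi> n (of_real (exp (fst y)) * snd y) \<partial>polar_measure)"
proof -
  have Scl: "closed S" using S(1) by (rule compact_imp_closed)
  have [measurable]: "S \<in> sets borel" using Scl by simp
  define gk where "gk k = bump.gt \<alpha> \<beta> (poly (bump_poly \<alpha> \<beta> k))" for k
  note bp = bump_bump_poly[OF ab]
  have rb: "random_bump M \<eta> \<nu> \<phi> \<alpha> \<beta> (poly (bump_poly \<alpha> \<beta> k)) (poly (pderiv (bump_poly \<alpha> \<beta> k))) (poly (pderiv (pderiv (bump_poly \<alpha> \<beta> k))))" for k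
    by (rule random_bump.intro[OF random_zeros_axioms bp])
  have gk: "gk k x = indicator {\<alpha><..<\<beta>} x * poly (bump_poly \<alpha> \<beta> k) x" for k x
    using bump.bd(1,2)[OF bp, of k] unfolding gk_def bump.gt_def[OF bp]
    by (cases "x = \<alpha> \<or> x = \<beta>") (auto simp: indicator_def)
  have gk1: "\<bar>gk k x\<bar> \<le> indicator {\<alpha><..<\<beta>} x" for k x
    using bump_poly_limit(1)[of x \<alpha> \<beta> k] by (auto simp: gk indicator_def)
  have gk2: "(\<lambda>k. gk k x) \<longlonglongrightarrow> indicator {\<alpha><..<\<beta>} x" for x
    using bump_poly_limit(2)[of x \<alpha> \<beta>] by (auto simp: gk indicator_def)
  have [measurable]: "gk k \<in> borel_measurable borel" for k
    unfolding gk_def by (rule bump.gt_measurable[OF bp])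
  let ?f = "cone_indicator S"
  note fk = cone_indicator[OF Scl S(3)]
  have [measurable]: "?f k \<in> borel_measurable borel" for k
    by (rule borel_measurable_continuous_onI[OF fk(3)])
  have cone_iff: "a \<in> cone S \<alpha> \<beta> \<longleftrightarrow> a \<noteq> 0 \<and> ln (cmod a) \<in> {\<alpha><..<\<beta>} \<and> sgn a \<in> S" for a
  proof
    assume "a \<in> cone S \<alpha> \<beta>"
    then obtain x z where xz: "a = of_real (exp x) * z" "z \<in> S" "x \<in> {\<alpha><..<\<beta>}" by blast
    then have "cmod z = 1" using S(2) by auto
    then have "cmod a = exp x" "sgn a = z" using xz(1) by (auto simp: norm_mult sgn_eq)
    then show "a \<noteq> 0 \<and> ln (cmod a) \<in> {\<alpha><..<\<beta>} \<and> sgn a \<in> S" using xz by auto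
  next
    assume a: "a \<noteq> 0 \<and> ln (cmod a) \<in> {\<alpha><..<\<beta>} \<and> sgn a \<in> S"
    then have "a = of_real (exp (ln (cmod a))) * sgn a" by (simp add: sgn_eq)
    then show "a \<in> cone S \<alpha> \<beta>" using a by blast
  qed
  \<comment> \<open>When \<open>P n \<omega> = 0\<close> the cone is an infinite set of zeros and
    \<open>zero_count\<close> is \<open>0\<close> by convention, as is \<open>zero_sum\<close>; the
    convergence then holds for every outcome.\<close>
  have inf: "infinite (cone S \<alpha> \<beta>)"
  proof -
    obtain z where z: "z \<in> S" using S(3) by blast
    then have "z \<noteq> 0" using S(2) by auto
    then have "inj_on (\<lambda>x. of_real (exp x) * z) {\<alpha><..<\<beta>}" by (auto simp: inj_on_def)
    then have "infinite ((\<lambda>x. of_real (exp x) * z) ` {\<alpha><..<\<beta>})"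
      using infinite_Ioo[OF ab] finite_imageD by blast
    moreover have "(\<lambda>x. of_real (exp x) * z) ` {\<alpha><..<\<beta>} \<subseteq> cone S \<alpha> \<beta>" using z by blast
    ultimately show ?thesis using finite_subset by blast
  qed
  have Zlim: "(\<lambda>k. zero_sum (gk k) (?f k) p) \<longlonglongrightarrow> real (zero_count p (cone S \<alpha> \<beta>))" for p
  proof (cases "p = 0")
    case True
    then show ?thesis using inf by (simp add: zero_count_def)
  next
    case False
    have fin: "finite {a. poly p a = 0 \<and> a \<noteq> 0}"
      by (rule finite_subset[OF _ poly_roots_finite[OF False]]) auto
    have "(\<lambda>k. zero_sum (gk k) (?f k) p) \<longlonglongrightarrow>
      (\<Sum>a | poly p a = 0 \<and> a \<noteq> 0. real (order a p) * (indicator {\<alpha><..<\<beta>} (ln (cmod a)) * indicator S (sgn a)))"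
      unfolding zero_sum_def by (intro tendsto_sum tendsto_mult_left tendsto_mult gk2 fk(1))
    also have "(\<Sum>a | poly p a = 0 \<and> a \<noteq> 0. real (order a p) * (indicator {\<alpha><..<\<beta>} (ln (cmod a)) * indicator S (sgn a)))
      = (\<Sum>a\<in>{a \<in> cone S \<alpha> \<beta>. poly p a = 0}. real (order a p))"
    proof (rule sum.mono_neutral_cong_right[OF fin])
      show "{a \<in> cone S \<alpha> \<beta>. poly p a = 0} \<subseteq> {a. poly p a = 0 \<and> a \<noteq> 0}"
        unfolding cone_iff by blast
      show "\<forall>i\<in>{a. poly p a = 0 \<and> a \<noteq> 0} - {a \<in> cone S \<alpha> \<beta>. poly p a = 0}.
        real (order i p) * (indicator {\<alpha><..<\<beta>} (ln (cmod i)) * indicator S (sgn i)) = 0"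
        unfolding cone_iff by (auto simp: indicator_def)
      show "real (order x p) * (indicator {\<alpha><..<\<beta>} (ln (cmod x)) * indicator S (sgn x)) = real (order x p)"
        if "x \<in> {a \<in> cone S \<alpha> \<beta>. poly p a = 0}" for x
        using that unfolding cone_iff mem_Collect_eq by simp
    qed
    also have "\<dots> = real (zero_count p (cone S \<alpha> \<beta>))" by (simp add: zero_count_def)
    finally show ?thesis .
  qed
  note E = random_bump.expectation_zero_sum[OF rb, folded gk_def, OF fk(3) borel_measurable_continuous_onI[OF fk(3)]]
  let ?Z = "\<lambda>k \<omega>. zero_sum (gk k) (?f k) (P n \<omega>)"
  let ?lap = "\<lambda>y. log_laplace \<phi> n (of_real (exp (fst y)) * snd y)"
  have gf: "\<bar>gk k x * ?f k z\<bar> \<le> indicator {\<alpha><..<\<beta>} x" for k x z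
    using mult_mono[OF gk1[of k x] fk(2)[of k z]] by (simp add: abs_mult)
  have l1: "(\<lambda>k. expectation (?Z k)) \<longlonglongrightarrow> expectation (\<lambda>\<omega>. real (zero_count (P n \<omega>) (cone S \<alpha> \<beta>)))"
  proof (rule integral_dominated_convergence[where w = "\<lambda>_. real n * 1"])
    show "(\<lambda>\<omega>. real (zero_count (P n \<omega>) (cone S \<alpha> \<beta>))) \<in> borel_measurable M"
      by (rule borel_measurable_LIMSEQ_real[OF Zlim E(1)])
    show "AE \<omega> in M. (\<lambda>k. ?Z k \<omega>) \<longlonglongrightarrow> real (zero_count (P n \<omega>) (cone S \<alpha> \<beta>))"
      by (rule AE_I2) (rule Zlim)
    show "AE \<omega> in M. norm (?Z k \<omega>) \<le> real n * 1" for k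
    proof (rule AE_I2, unfold real_norm_def, rule zero_sum_bound[OF degree_random_poly])
      show "\<bar>gk k (ln (cmod a)) * ?f k (sgn a)\<bar> \<le> 1" for a
        by (rule order.trans[OF gf]) (simp add: indicator_def)
    qed simp
  qed (rule E(1) integrable_const)+
  have lap_int: "integrable polar_measure (\<lambda>y. indicator {\<alpha>..\<beta>} (fst y) * \<bar>?lap y\<bar>)"
  proof (rule polar_integrable_continuous[of \<alpha> \<beta> "\<lambda>y. \<bar>?lap y\<bar>"])
    show "continuous_on ({\<alpha>..\<beta>} \<times> unit_circle) (\<lambda>y. \<bar>?lap y\<bar>)"
      by (intro continuous_intros continuous_on_log_d[OF kern_positive])
    show "(\<lambda>y. indicator {\<alpha>..\<beta>} (fst y) * \<bar>?lap y\<bar>) \<in> borel_measurable polar_measure"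
      by measurable
  qed simp
  have l2: "(\<lambda>k. 1 / (4 * pi) * (\<integral>y. gk k (fst y) * ?f k (snd y) * ?lap y \<partial>polar_measure)) \<longlonglongrightarrow>
     1 / (4 * pi) * (\<integral>y. indicator {\<alpha><..<\<beta>} (fst y) * indicator S (snd y) * ?lap y \<partial>polar_measure)"
  proof (rule tendsto_mult_left, rule integral_dominated_convergence[OF _ _ lap_int])
    show "AE y in polar_measure. (\<lambda>k. gk k (fst y) * ?f k (snd y) * ?lap y) \<longlonglongrightarrow> indicator {\<alpha><..<\<beta>} (fst y) * indicator S (snd y) * ?lap y"
      by (intro AE_I2 tendsto_mult_right tendsto_mult gk2 fk(1))
    show "AE y in polar_measure. norm (gk k (fst y) * ?f k (snd y) * ?lap y) \<le> indicator {\<alpha>..\<beta>} (fst y) * \<bar>?lap y\<bar>" for k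
    proof (rule AE_I2)
      fix y
      have "\<bar>gk k (fst y) * ?f k (snd y)\<bar> \<le> indicator {\<alpha>..\<beta>} (fst y)"
        by (rule order.trans[OF gf]) (auto simp: indicator_def)
      then show "norm (gk k (fst y) * ?f k (snd y) * ?lap y) \<le> indicator {\<alpha>..\<beta>} (fst y) * \<bar>?lap y\<bar>"
        unfolding real_norm_def abs_mult[of _ "?lap y"] by (rule mult_right_mono) simp
    qed
  qed measurable
  show ?thesis
    by (rule LIMSEQ_unique[OF l1]) (unfold E(2), rule l2)
qed

end

section \<open>Derivative asymptotics\<close>

text \<open>Smallness on a real interval plus a bound on a complex disc controls derivatives at the
  centre: Cauchy bounds the third derivative, and finite differences yield the first two. The
  tolerance depends on \<open>B\<close> and \<open>\<delta>\<close> only, hence is uniform in all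
  points and in \<open>n\<close>.\<close>

lemma small_derivatives:
  fixes B \<delta> :: real
  assumes "0 < \<delta>" "0 \<le> B"
  shows "\<exists>\<epsilon>>0. \<forall>E k k1 k2. E holomorphic_on UNIV \<longrightarrow> (\<forall>w. cmod w \<le> 1 \<longrightarrow> cmod (E w) \<le> B) \<longrightarrow>
       (\<forall>t. E (of_real t) = of_real (k t)) \<longrightarrow>
       (\<forall>t. (k has_real_derivative k1 t) (at t)) \<longrightarrow> (\<forall>t. (k1 has_real_derivative k2 t) (at t)) \<longrightarrow>
       (\<forall>t. \<bar>t\<bar> \<le> 1 \<longrightarrow> \<bar>k t\<bar> \<le> \<epsilon>) \<longrightarrow> \<bar>k1 0\<bar> \<le> \<delta> \<and> \<bar>k2 0\<bar> \<le> \<delta>"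
proof -
  \<comment> \<open>Step size of the differences, making \<open>48 * B * h\<close> at most
    \<open>\<delta> / 2\<close>; the summand \<open>1\<close> covers \<open>B = 0\<close>.\<close>
  define h where "h = min (1 / 2) (\<delta> / (96 * B + 1))"
  have h: "0 < h" using assms by (simp add: h_def)
  have h12: "h \<le> 1 / 2" unfolding h_def by (rule min.cobounded1)
  have hB: "48 * B * h \<le> \<delta> / 2"
  proof -
    have "h \<le> \<delta> / (96 * B + 1)" unfolding h_def by (rule min.cobounded2)
    then have "h * (96 * B + 1) \<le> \<delta>" using assms by (simp add: pos_le_divide_eq)
    then have "h * (96 * B) \<le> \<delta>" using h by (simp add: distrib_left)
    then show ?thesis by (simp add: mult_ac)
  qed
  \<comment> \<open>Makes \<open>4 * \<epsilon>\<close> equal to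
    \<open>\<delta> * h\<^sup>2 / 2\<close>, the half of the permitted error that the remainder does
    not use.\<close>
  define \<epsilon> where "\<epsilon> = \<delta> * h\<^sup>2 / 8"
  have \<epsilon>: "0 < \<epsilon>" using assms h by (simp add: \<epsilon>_def)
  have h2: "h\<^sup>2 \<le> h" using h h12 by (simp add: power2_eq_square mult_left_le)
  show ?thesis
  proof (intro exI[of _ \<epsilon>] conjI[OF \<epsilon>] allI impI)
    fix E :: "complex \<Rightarrow> complex" and k k1 k2 :: "real \<Rightarrow> real"
    assume hol: "E holomorphic_on UNIV" and "\<forall>w. cmod w \<le> 1 \<longrightarrow> cmod (E w) \<le> B"
      and "\<forall>t. E (of_real t) = of_real (k t)"
      and "\<forall>t. (k has_real_derivative k1 t) (at t)" and "\<forall>t. (k1 has_real_derivative k2 t) (at t)"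
      and "\<forall>t. \<bar>t\<bar> \<le> 1 \<longrightarrow> \<bar>k t\<bar> \<le> \<epsilon>"
    note bd = this(2)[rule_format] and Ek = this(3)[rule_format] and d1 = this(4)[rule_format]
      and d2 = this(5)[rule_format] and small = this(6)[rule_format]
    have der: "((deriv ^^ i) E has_field_derivative (deriv ^^ Suc i) E w) (at w within T)" for i w T
    proof -
      have "((deriv ^^ i) E has_field_derivative deriv ((deriv ^^ i) E) w) (at w within T)"
        by (rule holomorphic_derivI[OF holomorphic_higher_deriv[OF hol open_UNIV] open_UNIV UNIV_I])
      then show ?thesis by simp
    qed
    have real_der: "deriv F (of_real t) = of_real f'" if "\<And>t. F (of_real t) = of_real (f t)"
      "(F has_field_derivative deriv F (of_real t)) (at (of_real t))" "(f has_real_derivative f') (at t)"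
      for F :: "complex \<Rightarrow> complex" and f :: "real \<Rightarrow> real" and t f'
    proof -
      have "((\<lambda>t. F (of_real t)) has_vector_derivative deriv F (of_real t)) (at t)"
        by (rule has_vector_derivative_real_field[OF that(2)])
      then have A: "((\<lambda>t. complex_of_real (f t)) has_vector_derivative deriv F (of_real t)) (at t)"
        by (simp only: that(1))
      have "((\<lambda>t. complex_of_real (f t)) has_vector_derivative of_real f') (at t)"
        using that(3) by (rule has_vector_derivative_of_real)
      then show ?thesis by (rule vector_derivative_unique_at[OF A])
    qed
    have E1: "deriv E (of_real t) = of_real (k1 t)" for t
      by (rule real_der[OF Ek _ d1]) (use der[of 0] in simp)
    have E2: "deriv (deriv E) (of_real t) = of_real (k2 t)" for t
      by (rule real_der[OF E1 _ d2]) (use der[of 1] in simp)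
    \<comment> \<open>Cauchy's inequality on circles of radius \<open>1 / 2\<close>, which stay in
      the unit disc: \<open>3!\<close> times \<open>2 ^ 3\<close> is \<open>48\<close>.\<close>
    have E3: "cmod ((deriv ^^ Suc 2) E w) \<le> 48 * B" if w: "w \<in> cball 0 (1 / 2)" for w
    proof -
      have "cmod ((deriv ^^ 3) E w) \<le> fact 3 * B / (1 / 2) ^ 3"
      proof (rule Cauchy_inequality)
        show "E holomorphic_on ball w (1 / 2)" using hol by (rule holomorphic_on_subset) simp
        show "continuous_on (cball w (1 / 2)) E"
          using holomorphic_on_imp_continuous_on[OF hol] by (rule continuous_on_subset) simp
        fix x assume "cmod (w - x) = 1 / 2"
        then have "cmod x \<le> 1" using w norm_triangle_sub[of x w] by (simp add: norm_minus_commute)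
        then show "cmod (E x) \<le> B" by (rule bd)
      qed simp
      moreover have "fact 3 * B / (1 / 2) ^ 3 = 48 * B" by (simp add: eval_nat_numeral)
      moreover have "(3::nat) = Suc 2" by simp
      ultimately show ?thesis by (simp only:)
    qed
    have T: "\<bar>k t - (k 0 + k1 0 * t + k2 0 * t\<^sup>2 / 2)\<bar> \<le> 24 * B * \<bar>t\<bar> ^ 3" if t: "\<bar>t\<bar> \<le> 1 / 2" for t
    proof -
      have "cmod ((deriv ^^ 0) E (of_real t) - (\<Sum>i\<le>2. (deriv ^^ i) E 0 * (of_real t - 0) ^ i / fact i))
          \<le> 48 * B * cmod (of_real t - 0) ^ Suc 2 / fact 2"
      proof (rule complex_Taylor[where S = "cball 0 (1 / 2)" and f = "\<lambda>i. (deriv ^^ i) E"])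
        show "((deriv ^^ i) E has_field_derivative (deriv ^^ Suc i) E x) (at x within cball 0 (1 / 2))" for i x
          by (rule der)
      qed (use t E3 in simp_all)
      moreover have "(\<Sum>i\<le>2. (deriv ^^ i) E 0 * (of_real t - 0) ^ i / fact i)
          = of_real (k 0 + k1 0 * t + k2 0 * t\<^sup>2 / 2)"
        using Ek[of 0] E1[of 0] E2[of 0] by (simp add: eval_nat_numeral)
      ultimately have "cmod (of_real (k t) - of_real (k 0 + k1 0 * t + k2 0 * t\<^sup>2 / 2))
          \<le> 48 * B * cmod (of_real t - 0) ^ Suc 2 / fact 2"
        by (simp only: funpow_0 Ek)
      then have "\<bar>k t - (k 0 + k1 0 * t + k2 0 * t\<^sup>2 / 2)\<bar> \<le> 48 * B * cmod (of_real t - 0) ^ Suc 2 / fact 2"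
        by (simp only: of_real_diff[symmetric] norm_of_real)
      also have "48 * B * cmod (of_real t - 0) ^ Suc 2 / fact 2 = 24 * B * \<bar>t\<bar> ^ 3"
        by (simp add: eval_nat_numeral)
      finally show ?thesis .
    qed
    \<comment> \<open>In the sum of the expansions at \<open>h\<close> and \<open>- h\<close> only
      \<open>k2 0\<close> survives besides values of \<open>k\<close>, in their difference only
      \<open>k1 0\<close>.\<close>
    have p: "\<bar>k h - (k 0 + k1 0 * h + k2 0 * h\<^sup>2 / 2)\<bar> \<le> 24 * B * h ^ 3"
      using T[of h] h h12 by simp
    have m: "\<bar>k (- h) - (k 0 - k1 0 * h + k2 0 * h\<^sup>2 / 2)\<bar> \<le> 24 * B * h ^ 3"
      using T[of "-h"] h h12 by simp
    have s: "\<bar>k h\<bar> \<le> \<epsilon>" "\<bar>k (- h)\<bar> \<le> \<epsilon>" "\<bar>k 0\<bar> \<le> \<epsilon>" using h h12 by (auto intro!: small)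
    have c3: "48 * B * h ^ 3 \<le> \<delta> / 2 * h\<^sup>2"
      using mult_right_mono[OF hB, of "h\<^sup>2"] by (simp add: eval_nat_numeral mult_ac)
    have "\<bar>k2 0 * h\<^sup>2\<bar> \<le> 4 * \<epsilon> + 48 * B * h ^ 3" using p m s by linarith
    also have "\<dots> \<le> \<delta> * h\<^sup>2" using c3 by (simp add: \<epsilon>_def)
    finally have k2: "\<bar>k2 0\<bar> \<le> \<delta>" using h by (simp add: abs_mult)
    have "\<bar>2 * k1 0 * h\<bar> \<le> 2 * \<epsilon> + 48 * B * h ^ 3" using p m s by linarith
    then have "\<bar>2 * k1 0 * h\<bar> \<le> \<delta> * h\<^sup>2" using c3 assms(1) zero_le_power2[of h] \<epsilon> by (simp add: \<epsilon>_def)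
    then have "2 * \<bar>k1 0\<bar> * h \<le> \<delta> * h\<^sup>2" using h by (simp only: abs_mult abs_of_pos abs_numeral)
    also have "\<delta> * h\<^sup>2 \<le> \<delta> * h" using h2 assms(1) by (intro mult_left_mono) auto
    finally have "2 * \<bar>k1 0\<bar> * h \<le> \<delta> * h" .
    then have "\<bar>k1 0\<bar> \<le> \<delta>" using h assms(1) by simp
    with k2 show "\<bar>k1 0\<bar> \<le> \<delta> \<and> \<bar>k2 0\<bar> \<le> \<delta>" by (rule conjI[rotated])
  qed
qed

text \<open>The diagonal of the kernel along a line extends to a holomorphic function.\<close>

definition kern_ext :: "(nat \<Rightarrow> complex poly) \<Rightarrow> nat \<Rightarrow> complex \<Rightarrow> complex \<Rightarrow> complex \<Rightarrow> complex" where
  "kern_ext \<phi> n z e w = (\<Sum>j\<le>n. poly (\<phi> j) (z * exp (e * w)) * cnj (poly (\<phi> j) (z * exp (e * cnj w))))"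

lemma kern_ext_real: "kern_ext \<phi> n z e (of_real t) = of_real (kern \<phi> n (z * exp (e * of_real t)))"
  by (simp add: kern_ext_def kern_def complex_norm_square del: of_real_power)

text \<open>Conjugated coefficients turn the conjugated factor into a polynomial in
  \<open>exp (cnj e * w)\<close>.\<close>

lemma kern_ext_holomorphic: "kern_ext \<phi> n z e holomorphic_on UNIV"
proof -
  have "(\<lambda>w. \<Sum>j\<le>n. poly (\<phi> j) (z * exp (e * w)) * poly (map_poly cnj (\<phi> j)) (cnj z * exp (cnj e * w))) holomorphic_on UNIV"
    by (intro holomorphic_intros)
  moreover have "cnj (poly p (z * exp (e * cnj w))) = poly (map_poly cnj p) (cnj z * exp (cnj e * w))" for p w
    by (simp only: poly_cnj complex_cnj_mult exp_cnj complex_cnj_cnj)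
  ultimately show ?thesis by (simp only: kern_ext_def[abs_def])
qed

text \<open>The two conjugations land on diagonal values at two points, so the asymptotics of
  \<open>kern\<close> alone bound the extension on a complex disc.\<close>

lemma kern_ext_bound:
  "cmod (kern_ext \<phi> n z e w) \<le> (kern \<phi> n (z * exp (e * w)) + kern \<phi> n (z * exp (e * cnj w))) / 2"
proof -
  have "cmod (kern_ext \<phi> n z e w) \<le> (\<Sum>j\<le>n. cmod (poly (\<phi> j) (z * exp (e * w)) * cnj (poly (\<phi> j) (z * exp (e * cnj w)))))"
    unfolding kern_ext_def by (rule norm_sum)
  also have "\<dots> \<le> (\<Sum>j\<le>n. ((cmod (poly (\<phi> j) (z * exp (e * w))))\<^sup>2 + (cmod (poly (\<phi> j) (z * exp (e * cnj w))))\<^sup>2) / 2)"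
  proof (rule sum_mono)
    fix j
    show "cmod (poly (\<phi> j) (z * exp (e * w)) * cnj (poly (\<phi> j) (z * exp (e * cnj w))))
       \<le> ((cmod (poly (\<phi> j) (z * exp (e * w))))\<^sup>2 + (cmod (poly (\<phi> j) (z * exp (e * cnj w))))\<^sup>2) / 2"
      using sum_squares_bound[of "cmod (poly (\<phi> j) (z * exp (e * w)))" "cmod (poly (\<phi> j) (z * exp (e * cnj w)))"]
      by (simp add: norm_mult)
  qed
  also have "\<dots> = (kern \<phi> n (z * exp (e * w)) + kern \<phi> n (z * exp (e * cnj w))) / 2"
    by (simp add: kern_def sum.distrib sum_divide_distrib[symmetric])
  finally show ?thesis .
qed

lemma kern_powers: "kern (monom 1) N (exp (u / of_nat n)) = ref_sum N n (Re u)"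
proof -
  have "(cmod (exp (u / of_nat n) ^ j))\<^sup>2 = exp (2 * Re u * real j / real n)" for j
  proof -
    have "cmod (exp (u / of_nat n) ^ j) = exp (real j * Re (u / of_nat n))"
      by (simp only: norm_power norm_exp_eq_Re exp_of_nat_mult)
    then have "(cmod (exp (u / of_nat n) ^ j))\<^sup>2 = exp (real 2 * (real j * Re (u / of_nat n)))"
      unfolding exp_of_nat_mult by simp
    then show ?thesis by (simp add: mult_ac)
  qed
  then show ?thesis by (simp only: kern_def ref_sum_def poly_monom mult_1)
qed

text \<open>Directions are divided by \<open>n\<close>, so that derivatives are taken in the
  rescaled variable \<open>u\<close>; the monomials carry no \<open>2 * pi\<close>, which sits in
  \<open>c\<close>.\<close>

definition derivatives_close ::
  "real \<Rightarrow> real \<Rightarrow> (nat \<Rightarrow> complex poly) \<Rightarrow> nat \<Rightarrow> complex \<Rightarrow> complex \<Rightarrow> complex \<Rightarrow> bool" where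
  "derivatives_close c \<delta> \<phi> n e z u \<longleftrightarrow>
     \<bar>c / n * kern_d1 (e / of_nat n) \<phi> n (z * exp (u / of_nat n)) - 1 / n * kern_d1 (e / of_nat n) (monom 1) n (exp (u / of_nat n))\<bar> \<le> \<delta> \<and>
     \<bar>c / n * kern_d2 (e / of_nat n) \<phi> n (z * exp (u / of_nat n)) - 1 / n * kern_d2 (e / of_nat n) (monom 1) n (exp (u / of_nat n))\<bar> \<le> \<delta>"

text \<open>The difference of the rescaled kernels, restricted to a line through \<open>u\<close>,
  satisfies the hypotheses of \<open>small_derivatives\<close>; since \<open>e\<close> and the
  parameter have modulus at most one, the values are needed up to radius
  \<open>R + 1\<close>.\<close>

lemma kern_derivative_comparison:
  assumes as: "\<And>R \<epsilon>. 0 < \<epsilon> \<Longrightarrow> \<forall>\<^sub>F n in sequentially. \<forall>z\<in>S. \<forall>u. cmod u \<le> R \<longrightarrow>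
        \<bar>W z * kern \<phi> n (z * exp (u / of_nat n)) / real n - ref_sum n n (Re u) / real n\<bar> \<le> \<epsilon>"
    and W: "\<And>z. z \<in> S \<Longrightarrow> (0::real) < W z" and e: "cmod e \<le> 1" and \<delta>: "0 < \<delta>"
  shows "\<forall>\<^sub>F n in sequentially. \<forall>z\<in>S. \<forall>u. cmod u \<le> R \<longrightarrow>
      derivatives_close (W z) \<delta> \<phi> n e z u"
proof -
  \<comment> \<open>Twice the bound \<open>2 * exp (4 * (R + 1))\<close> of the model kernel, plus
    one for the deviation of the other kernel from it.\<close>
  define B where "B = 4 * exp (4 * (R + 1)) + 1"
  have B: "0 \<le> B" by (simp add: B_def)
  obtain \<epsilon> where \<epsilon>: "0 < \<epsilon>" and L: "\<forall>E k k1 k2. E holomorphic_on UNIV \<longrightarrow> (\<forall>w. cmod w \<le> 1 \<longrightarrow> cmod (E w) \<le> B) \<longrightarrow>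
       (\<forall>t. E (of_real t) = of_real (k t)) \<longrightarrow>
       (\<forall>t. (k has_real_derivative k1 t) (at t)) \<longrightarrow> (\<forall>t. (k1 has_real_derivative k2 t) (at t)) \<longrightarrow>
       (\<forall>t. \<bar>t\<bar> \<le> 1 \<longrightarrow> \<bar>k t\<bar> \<le> \<epsilon>) \<longrightarrow> \<bar>k1 0\<bar> \<le> \<delta> \<and> \<bar>k2 0\<bar> \<le> \<delta>"
    using small_derivatives[OF \<delta> B] by (elim exE conjE)
  have "0 < min \<epsilon> 1" using \<epsilon> by simp
  from as[OF this, of "R + 1"] eventually_gt_at_top[of 0] show ?thesis
  proof eventually_elim
    case (elim n)
    show ?case
    proof (intro ballI allI impI)
      fix z u assume z: "z \<in> S" and u: "cmod u \<le> R"
      have n: "0 < n" by (rule elim(2))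
      let ?e = "e / of_nat n"
      define z' where "z' = z * exp (u / of_nat n)"
      define x' where "x' = exp (u / of_nat n)"
      have cl: "\<bar>W z * kern \<phi> n (z' * exp (?e * w)) / real n - kern (monom 1) n (x' * exp (?e * w)) / real n\<bar> \<le> min \<epsilon> 1"
        and rb: "kern (monom 1) n (x' * exp (?e * w)) / real n \<le> 2 * exp (4 * (R + 1))" if w: "cmod w \<le> 1" for w
      proof -
        have "cmod (u + e * w) \<le> cmod u + cmod e * cmod w" using norm_triangle_ineq[of u "e * w"] by (simp add: norm_mult)
        also have "\<dots> \<le> R + 1 * 1" by (intro add_mono u mult_mono e w) auto
        finally have uw: "cmod (u + e * w) \<le> R + 1" by simp
        have ex: "exp (u / of_nat n) * exp (?e * w) = exp ((u + e * w) / of_nat n)"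
          by (simp add: exp_add[symmetric] add_divide_distrib)
        have k: "kern (monom 1) n (x' * exp (?e * w)) = ref_sum n n (Re (u + e * w))"
          unfolding x'_def ex by (rule kern_powers)
        show "\<bar>W z * kern \<phi> n (z' * exp (?e * w)) / real n - kern (monom 1) n (x' * exp (?e * w)) / real n\<bar> \<le> min \<epsilon> 1"
          unfolding k z'_def mult.assoc[of z] ex using elim(1) z uw by blast
        have "\<bar>Re (u + e * w)\<bar> \<le> R + 1" using abs_Re_le_cmod uw by (rule order.trans)
        from ref_sum_le[OF this n] show "kern (monom 1) n (x' * exp (?e * w)) / real n \<le> 2 * exp (4 * (R + 1))"
          unfolding k using n by (simp add: divide_le_eq mult.commute)
      qed
      define E where "E w = of_real (W z / n) * kern_ext \<phi> n z' ?e w - of_real (1 / n) * kern_ext (monom 1) n x' ?e w" for w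
      define k where "k t = W z / n * kern \<phi> n (z' * exp (?e * of_real t)) - 1 / n * kern (monom 1) n (x' * exp (?e * of_real t))" for t
      define k1 where "k1 t = W z / n * kern_d1 ?e \<phi> n (z' * exp (?e * of_real t)) - 1 / n * kern_d1 ?e (monom 1) n (x' * exp (?e * of_real t))" for t
      define k2 where "k2 t = W z / n * kern_d2 ?e \<phi> n (z' * exp (?e * of_real t)) - 1 / n * kern_d2 ?e (monom 1) n (x' * exp (?e * of_real t))" for t
      have "\<bar>k1 0\<bar> \<le> \<delta> \<and> \<bar>k2 0\<bar> \<le> \<delta>"
      proof (rule L[rule_format])
        show "E holomorphic_on UNIV"
          unfolding E_def by (intro holomorphic_intros kern_ext_holomorphic)
        show "E (of_real t) = of_real (k t)" for t
          unfolding E_def k_def kern_ext_real by simp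
        show "(k has_real_derivative k1 t) (at t)" for t
          unfolding k_def k1_def by (intro DERIV_diff DERIV_cmult kern_along_curve)
        show "(k1 has_real_derivative k2 t) (at t)" for t
          unfolding k1_def k2_def by (intro DERIV_diff DERIV_cmult kern_d1_along_curve)
        show "\<bar>k t\<bar> \<le> \<epsilon>" if "\<bar>t\<bar> \<le> 1" for t
          using cl[of "of_real t"] that by (simp add: k_def)
        fix w :: complex assume w: "cmod w \<le> 1"
        have cw: "cmod (cnj w) \<le> 1" using w by simp
        have b1: "W z / n * kern \<phi> n (z' * exp (?e * v)) \<le> 2 * exp (4 * (R + 1)) + 1" if "cmod v \<le> 1" for v
          using cl[OF that] rb[OF that] by (simp add: abs_le_iff)
        have "cmod (of_real (W z / n) * kern_ext \<phi> n z' ?e w) \<le> W z / n * ((kern \<phi> n (z' * exp (?e * w)) + kern \<phi> n (z' * exp (?e * cnj w))) / 2)"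
          using W[OF z] n unfolding norm_mult norm_of_real by (intro mult_mono kern_ext_bound) auto
        also have "\<dots> \<le> 2 * exp (4 * (R + 1)) + 1"
          using b1[OF w] b1[OF cw] by (simp add: distrib_left add_divide_distrib)
        finally have 1: "cmod (of_real (W z / n) * kern_ext \<phi> n z' ?e w) \<le> 2 * exp (4 * (R + 1)) + 1" .
        have "cmod (of_real (1 / n) * kern_ext (monom 1) n x' ?e w) \<le> 1 / n * ((kern (monom 1) n (x' * exp (?e * w)) + kern (monom 1) n (x' * exp (?e * cnj w))) / 2)"
          using n unfolding norm_mult norm_of_real by (intro mult_mono kern_ext_bound) auto
        also have "\<dots> \<le> 2 * exp (4 * (R + 1))"
          using rb[OF w] rb[OF cw] by (simp add: add_divide_distrib)
        finally have 2: "cmod (of_real (1 / n) * kern_ext (monom 1) n x' ?e w) \<le> 2 * exp (4 * (R + 1))" .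
        show "cmod (E w) \<le> B"
        proof -
          have "cmod (E w) \<le> cmod (of_real (W z / n) * kern_ext \<phi> n z' ?e w) + cmod (of_real (1 / n) * kern_ext (monom 1) n x' ?e w)"
            unfolding E_def by (rule norm_triangle_ineq4)
          then show ?thesis using 1 2 unfolding B_def by linarith
        qed
      qed
      then show "derivatives_close (W z) \<delta> \<phi> n e z u"
        by (simp add: derivatives_close_def k1_def k2_def z'_def x'_def)
    qed
  qed
qed

section \<open>The limit function\<close>

text \<open>By uniform continuity each cell errs by at most \<open>\<epsilon> / (2 * n)\<close>; the
  induction adds up the cells.\<close>

lemma riemann_sum_tendsto:
  fixes f :: "real \<Rightarrow> real"
  assumes f: "continuous_on {0..1} f"
  shows "(\<lambda>n. (\<Sum>j\<le>n. f (real j / real n)) / real n) \<longlonglongrightarrow> integral {0..1} f"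
proof -
  have "(\<lambda>n. (\<Sum>j\<in>{1..n}. f (real j / real n)) / real n) \<longlonglongrightarrow> integral {0..1} f"
  proof (rule LIMSEQ_I)
    fix \<epsilon> :: real assume \<epsilon>: "0 < \<epsilon>"
    have "uniformly_continuous_on {0..1} f" by (rule compact_uniformly_continuous[OF f]) simp
    then obtain d where d: "0 < d" "\<And>x y. x \<in> {0..1} \<Longrightarrow> y \<in> {0..1} \<Longrightarrow> dist y x < d \<Longrightarrow> dist (f y) (f x) < \<epsilon> / 2"
      using \<epsilon> unfolding uniformly_continuous_on_def by (metis half_gt_zero)
    obtain n0 where n0: "0 < n0" "1 / real n0 < d" using d(1) by (metis nat_approx_posE of_nat_0_less_iff zero_less_Suc)
    show "\<exists>n0. \<forall>n\<ge>n0. norm ((\<Sum>j\<in>{1..n}. f (real j / real n)) / real n - integral {0..1} f) < \<epsilon>"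
    proof (intro exI[of _ n0] allI impI)
      fix n assume n: "n0 \<le> n"
      then have n1: "0 < n" "1 / real n < d"
        using n0 frac_le[of 1 1 "real n0" "real n"] by auto
      have int: "f integrable_on {a..b}" if "0 \<le> a" "b \<le> 1" for a b
        by (rule integrable_continuous_real[OF continuous_on_subset[OF f]]) (use that in auto)
      have "m \<le> n \<Longrightarrow> \<bar>integral {0..real m / real n} f - (\<Sum>j\<in>{1..m}. f (real j / real n)) / real n\<bar> \<le> real m * (\<epsilon> / 2 / real n)" for m
      proof (induction m)
        case 0 then show ?case by simp
      next
        case (Suc m)
        let ?a = "real m / real n" and ?b = "real (Suc m) / real n"
        have ab: "0 \<le> ?a" "?a \<le> ?b" "?b \<le> 1" "?b - ?a = 1 / real n"
          using Suc.prems n1 by (auto simp: divide_right_mono diff_divide_distrib[symmetric])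
        have "integral {0..?a} f + integral {?a..?b} f = integral {0..?b} f"
          using ab by (intro Henstock_Kurzweil_Integration.integral_combine int) auto
        moreover have "norm (integral {?a..?b} (\<lambda>x. f x - f ?b)) \<le> \<epsilon> / 2 * (?b - ?a)"
        proof (rule integral_bound[OF ab(2)])
          show "continuous_on {?a..?b} (\<lambda>x. f x - f ?b)"
            using ab by (intro continuous_intros continuous_on_subset[OF f]) auto
          fix t assume t: "t \<in> {?a..?b}"
          then have "dist t ?b < d" using n1(2) ab(4) by (auto simp: dist_real_def)
          moreover have "0 \<le> t" "t \<le> 1" "0 \<le> ?b"
            using t ab(1,2,3) unfolding atLeastAtMost_iff by linarith+
          ultimately have "dist (f t) (f ?b) < \<epsilon> / 2"
            using ab(3) by (intro d(2)) (simp_all only: atLeastAtMost_iff simp_thms)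
          then show "norm (f t - f ?b) \<le> \<epsilon> / 2" by (simp add: dist_norm)
        qed
        moreover have "integral {?a..?b} (\<lambda>x. f x - f ?b) = integral {?a..?b} f - f ?b / real n"
          using ab int[of ?a ?b] by (subst Henstock_Kurzweil_Integration.integral_diff) auto
        moreover have "(\<Sum>j\<in>{1..Suc m}. f (real j / real n)) / real n = (\<Sum>j\<in>{1..m}. f (real j / real n)) / real n + f ?b / real n"
          by (simp add: add_divide_distrib)
        moreover have "\<bar>integral {0..?a} f - (\<Sum>j\<in>{1..m}. f (real j / real n)) / real n\<bar> \<le> real m * (\<epsilon> / 2 / real n)"
          using Suc by simp
        moreover have "real (Suc m) * (\<epsilon> / 2 / real n) = real m * (\<epsilon> / 2 / real n) + \<epsilon> / 2 * (1 / real n)"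
          by (simp add: distrib_right add_divide_distrib)
        ultimately show ?case unfolding ab(4) real_norm_def by linarith
      qed
      from this[of n] have "\<bar>integral {0..1} f - (\<Sum>j\<in>{1..n}. f (real j / real n)) / real n\<bar> \<le> \<epsilon> / 2"
        using n1(1) by simp
      then show "norm ((\<Sum>j\<in>{1..n}. f (real j / real n)) / real n - integral {0..1} f) < \<epsilon>"
        using \<epsilon> unfolding real_norm_def by linarith
    qed
  qed
  \<comment> \<open>The sum in the claim has \<open>n + 1\<close> terms; the additional one at
    \<open>j = 0\<close> disappears in the limit.\<close>
  moreover have "(\<lambda>n. f 0 / real n) \<longlonglongrightarrow> 0" by (rule lim_const_over_n)
  ultimately have "(\<lambda>n. f 0 / real n + (\<Sum>j\<in>{1..n}. f (real j / real n)) / real n) \<longlonglongrightarrow> 0 + integral {0..1} f"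
    by (intro tendsto_add)
  moreover have "(\<Sum>j\<le>n. f (real j / real n)) = f 0 + (\<Sum>j\<in>{1..n}. f (real j / real n))" for n
    by (simp add: atMost_atLeast0 sum.atLeast_Suc_atMost)
  ultimately show ?thesis by (simp add: add_divide_distrib)
qed

text \<open>\<open>H\<close> and its derivatives in one formula, free of the removable singularity
  at \<open>0\<close>.\<close>

definition exp_moment :: "nat \<Rightarrow> real \<Rightarrow> real" where
  "exp_moment a s = integral {0..1} (\<lambda>x. x ^ a * exp (s * x))"

lemma exp_moment_derivative: "(exp_moment a has_real_derivative exp_moment (Suc a) s) (at s)"
proof -
  have "((\<lambda>s. integral (cbox 0 1) (\<lambda>x. x ^ a * exp (s * x))) has_field_derivative
      integral (cbox 0 1) (\<lambda>x. x ^ Suc a * exp (s * x))) (at s within UNIV)"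
  proof (rule leibniz_rule_field_derivative)
    show "((\<lambda>s. x ^ a * exp (s * x)) has_field_derivative x ^ Suc a * exp (s * x)) (at s within UNIV)" for s x :: real
      by (auto intro!: derivative_eq_intros)
    show "continuous_on (UNIV \<times> cbox 0 1) (\<lambda>(s, x). (x::real) ^ Suc a * exp (s * x))"
      unfolding case_prod_beta by (intro continuous_intros)
  qed (auto intro!: integrable_continuous_real continuous_intros)
  then show ?thesis by (simp add: exp_moment_def[abs_def])
qed

lemma H_eq_exp_moment: "H = exp_moment 0"
proof
  fix s :: real
  have "((\<lambda>x. exp (s * x)) has_integral exp (s * 1) / s - exp (s * 0) / s) {0..1}" if "s \<noteq> 0"
    using that by (intro fundamental_theorem_of_calculus)
      (auto intro!: derivative_eq_intros simp flip: has_real_derivative_iff_has_vector_derivative)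
  then show "H s = exp_moment 0 s"
    by (auto simp: H_def exp_moment_def integral_unique diff_divide_distrib)
qed

lemma H_pos: "0 < H s"
proof -
  have "0 < (exp s - 1) / s" if "s \<noteq> 0"
    using that by (cases "0 < s") (auto simp: zero_less_divide_iff)
  then show ?thesis by (simp add: H_def)
qed

text \<open>The second derivative of \<open>ln H\<close>, which is the variance of the density
  proportional to \<open>exp (s * x)\<close> on \<open>[0, 1]\<close>.\<close>

definition H_log_d2 :: "real \<Rightarrow> real" where
  "H_log_d2 s = exp_moment 2 s / H s - (exp_moment 1 s / H s)\<^sup>2"

lemma deriv_H: "deriv H s = exp_moment 1 s"
  unfolding H_eq_exp_moment using exp_moment_derivative[of 0 s] by (simp add: DERIV_imp_deriv)

lemma H_log_derivative: "((\<lambda>s. deriv H s / H s) has_real_derivative H_log_d2 s) (at s)"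
proof -
  have h: "(H has_real_derivative exp_moment 1 s) (at s)"
    unfolding H_eq_exp_moment using exp_moment_derivative[of 0 s] by simp
  have e: "(exp_moment 1 has_real_derivative exp_moment 2 s) (at s)"
    using exp_moment_derivative[of 1 s] by (simp add: numeral_2_eq_2)
  show ?thesis
    unfolding deriv_H H_log_d2_def using H_pos[of s]
    by (intro DERIV_cong[OF DERIV_divide[OF e h]]) (simp_all add: field_simps power2_eq_square)
qed

lemma H_log_d2_continuous: "continuous_on A H_log_d2"
proof -
  have "continuous_on A (exp_moment a)" for a
    by (rule DERIV_continuous_on[OF DERIV_subset[OF exp_moment_derivative]]) simp
  then show ?thesis
    unfolding H_log_d2_def[abs_def] using H_pos
    by (intro continuous_intros) (auto simp: H_eq_exp_moment less_imp_neq[THEN not_sym])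
qed

text \<open>Each \<open>euler_op\<close> brings down a factor \<open>j\<close> on
  \<open>monom 1 j\<close>; divided by powers of \<open>n\<close>, the resulting sums are Riemann
  sums for \<open>exp_moment\<close>.\<close>

definition ref_moment :: "nat \<Rightarrow> nat \<Rightarrow> real \<Rightarrow> real" where
  "ref_moment a n s = (\<Sum>j\<le>n. (real j / real n) ^ a * exp (s * (real j / real n))) / real n"

lemma ref_moment_tendsto: "(\<lambda>n. ref_moment a n s) \<longlonglongrightarrow> exp_moment a s"
  unfolding ref_moment_def exp_moment_def by (intro riemann_sum_tendsto continuous_intros)

lemma ref_moment_bounds:
  assumes n: "0 < n" and s: "\<bar>s\<bar> \<le> R"
  shows "0 \<le> ref_moment a n s" "ref_moment a n s \<le> 2 * exp R" "exp (- R) \<le> ref_moment 0 n s"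
proof -
  show "0 \<le> ref_moment a n s" by (simp add: ref_moment_def sum_nonneg)
  have j: "0 \<le> real j / real n" "real j / real n \<le> 1" "\<bar>s * (real j / real n)\<bar> \<le> R" if "j \<le> n" for j
  proof -
    show 1: "0 \<le> real j / real n" "real j / real n \<le> 1" using n that by auto
    show "\<bar>s * (real j / real n)\<bar> \<le> R"
      using mult_mono[OF s 1(2)] s 1(1) by (simp add: abs_mult)
  qed
  have "(\<Sum>j\<le>n. (real j / real n) ^ a * exp (s * (real j / real n))) \<le> (\<Sum>j\<le>n. 1 * exp R)"
  proof (intro sum_mono mult_mono power_le_one)
    fix i assume "i \<in> {..n}"
    then show "exp (s * (real i / real n)) \<le> exp R"
      using abs_le_D1[OF j(3)] by (simp only: exp_le_cancel_iff atMost_iff)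
  qed (use j in auto)
  also have "\<dots> \<le> 2 * exp R * real n" using n by (simp add: algebra_simps)
  finally show "ref_moment a n s \<le> 2 * exp R" using n by (simp add: ref_moment_def divide_le_eq)
  have "exp (- R) * real n \<le> (\<Sum>j\<le>n. exp (- R))" by (simp add: distrib_right)
  also have "\<dots> \<le> (\<Sum>j\<le>n. (real j / real n) ^ 0 * exp (s * (real j / real n)))"
  proof (intro sum_mono)
    fix i assume "i \<in> {..n}"
    then have "i \<le> n" by simp
    from j(3)[OF this] have "- R \<le> s * (real i / real n)" by linarith
    then show "exp (- R) \<le> (real i / real n) ^ 0 * exp (s * (real i / real n))"
      by (simp only: power_0 mult_1 exp_le_cancel_iff)
  qed
  finally show "exp (- R) \<le> ref_moment 0 n s" using n by (simp add: ref_moment_def le_divide_eq)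
qed

text \<open>With \<open>u = s / 2\<close> one has
  \<open>(cmod (x ^ j))\<^sup>2 = exp (s * (j / n))\<close>, so a radial derivative in
  \<open>u\<close> brings down \<open>2 * j / n\<close>. The model kernel depends on the modulus
  only, so angular derivatives vanish.\<close>

lemma powers_reference:
  fixes s :: real
  assumes n: "0 < n"
  defines "x \<equiv> exp (of_real (s / 2) / of_nat n) :: complex"
  shows "1 / n * kern_d1 (1 / of_nat n) (monom 1) n x = 2 * ref_moment 1 n s"
    "1 / n * kern_d1 (\<i> / of_nat n) (monom 1) n x = 0"
    "1 / n * kern_d2 (1 / of_nat n) (monom 1) n x = 4 * ref_moment 2 n s"
    "1 / n * kern_d2 (\<i> / of_nat n) (monom 1) n x = 0"
    "ref_sum n n (s / 2) / n = ref_moment 0 n s"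
proof -
  have pe: "poly (euler_op (monom 1 j)) z = of_nat j * z ^ j" for j and z :: complex
    by (cases j) (simp_all add: euler_op_def pderiv_monom poly_monom)
  have pee: "poly (euler_op (euler_op (monom 1 j))) z = of_nat j ^ 2 * z ^ j" for j and z :: complex
  proof -
    have "euler_op (monom 1 j :: complex poly) = smult (of_nat j) (monom 1 j)"
      by (cases j) (simp_all add: euler_op_def pderiv_monom smult_monom flip: monom_Suc)
    moreover have "euler_op (smult c p) = smult c (euler_op p)" for c :: complex and p
      by (simp add: euler_op_def pderiv_smult)
    ultimately show ?thesis using pe[of j z] by (simp add: power2_eq_square)
  qed
  have x: "x ^ j * cnj (x ^ j) = of_real (exp (s * (real j / real n)))" for j
  proof -
    have "x ^ j = of_real (exp (s * (real j / real n) / 2))"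
      unfolding x_def exp_of_nat_mult[symmetric] exp_of_real[symmetric] by (simp add: mult_ac)
    then show ?thesis by (simp add: exp_add[symmetric] flip: of_real_mult)
  qed
  define m where "m a = (\<Sum>j\<le>n. real j ^ a * exp (s * (real j / real n)))" for a
  have k10: "kmix (D_fam (monom 1)) (monom 1) n x = of_real (m 1)"
    unfolding kmix_def pe poly_monom m_def mult.assoc mult_1 x by simp
  have k20: "kmix (D_fam (D_fam (monom 1))) (monom 1) n x = of_real (m 2)"
    unfolding kmix_def pee poly_monom m_def mult.assoc mult_1 x by simp
  have "kmix (D_fam (monom 1)) (D_fam (monom 1)) n x = (\<Sum>j\<le>n. of_nat j ^ 2 * (x ^ j * cnj (x ^ j)))"
    unfolding kmix_def pe by (intro sum.cong refl) (simp add: power2_eq_square)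
  then have k11: "kern (D_fam (monom 1)) n x = m 2"
    unfolding kern_kmix x m_def by simp
  have mr: "m a / real n ^ a / real n = ref_moment a n s" for a
    by (simp add: m_def ref_moment_def sum_divide_distrib power_divide)
  show "1 / n * kern_d1 (1 / of_nat n) (monom 1) n x = 2 * ref_moment 1 n s"
    unfolding kern_d1_def k10 mr[symmetric] by simp
  show "1 / n * kern_d1 (\<i> / of_nat n) (monom 1) n x = 0"
    unfolding kern_d1_def k10 by simp
  show "1 / n * kern_d2 (1 / of_nat n) (monom 1) n x = 4 * ref_moment 2 n s"
    unfolding kern_d2_def k20 k11 mr[symmetric] by (simp add: norm_divide power_divide)
  show "1 / n * kern_d2 (\<i> / of_nat n) (monom 1) n x = 0"
    unfolding kern_d2_def k20 k11 by (simp add: norm_divide power_divide)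
  show "ref_sum n n (s / 2) / n = ref_moment 0 n s"
    by (simp add: ref_sum_def ref_moment_def)
qed

text \<open>Constant factors drop out of logarithmic derivatives, so the kernel may be normalised by
  \<open>c\<close>; the directions \<open>e / n\<close> account for the division by
  \<open>n^2\<close>.\<close>

lemma log_laplace_scaled:
  fixes c :: real
  assumes k: "0 < kern \<phi> n z" and n: "0 < n" and c: "0 < c"
  defines "K \<equiv> c * kern \<phi> n z"
  shows "log_laplace \<phi> n z / (real n)\<^sup>2 =
      c * kern_d2 (1 / of_nat n) \<phi> n z / K - (c * kern_d1 (1 / of_nat n) \<phi> n z / K)\<^sup>2
    + (c * kern_d2 (\<i> / of_nat n) \<phi> n z / K - (c * kern_d1 (\<i> / of_nat n) \<phi> n z / K)\<^sup>2)"
proof -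
  have d1: "kern_d1 (e / of_nat n) \<phi> n z = kern_d1 e \<phi> n z / real n" for e
    by (simp add: kern_d1_def)
  have d2: "kern_d2 (e / of_nat n) \<phi> n z = kern_d2 e \<phi> n z / (real n)\<^sup>2" for e
  proof -
    have "Re ((e / of_nat n)\<^sup>2 * w) = Re (e\<^sup>2 * w) / (real n)\<^sup>2" for w
    proof -
      have "(e / of_nat n)\<^sup>2 * w = e\<^sup>2 * w / of_real ((real n)\<^sup>2)" by (simp add: power_divide)
      then show ?thesis by (simp only: Re_divide_of_real)
    qed
    then show ?thesis by (simp add: kern_d2_def norm_divide power_divide add_divide_distrib)
  qed
  have "log_laplace \<phi> n z = log_d2 1 \<phi> n z + log_d2 \<i> \<phi> n z"
    using k by (intro log_laplace_eq[symmetric]) simp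
  moreover have "c * (d / (real n)\<^sup>2) / (c * kern \<phi> n z) = d / kern \<phi> n z / (real n)\<^sup>2"
    "(c * (d / real n) / (c * kern \<phi> n z))\<^sup>2 = (d / kern \<phi> n z)\<^sup>2 / (real n)\<^sup>2" for d
    using c by (simp_all add: power_divide power_mult_distrib mult.commute)
  ultimately show ?thesis
    unfolding log_d2_def d1 d2 K_def by (simp only: add_divide_distrib diff_divide_distrib)
qed

section \<open>Rescaling of the region and passage to the limit\<close>

lemma scaled_ln_tendsto: "(\<lambda>n. 2 * real n * ln (1 + \<tau> / (2 * real n))) \<longlonglongrightarrow> \<tau>"
  by real_asymp

text \<open>The substitution \<open>x = ln r\<close>. Positivity of the lower edge is required for
  the logarithm and holds once \<open>n\<close> is large.\<close>

lemma Omega_eq_cone: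
  assumes "0 < 1 + \<tau>1 / (2 * real n)" and "\<tau>1 < \<tau>2" "0 < n"
  shows "Omega n S \<tau>1 \<tau>2 = {of_real (exp x) * z | x z. z \<in> S \<and> x \<in> {ln (1 + \<tau>1 / (2 * real n)) <..< ln (1 + \<tau>2 / (2 * real n))}}"
proof -
  have lt: "1 + \<tau>1 / (2 * real n) < 1 + \<tau>2 / (2 * real n)" using assms by (simp add: divide_strict_right_mono)
  have iff: "exp x \<in> {1 + \<tau>1 / (2 * real n)<..<1 + \<tau>2 / (2 * real n)} \<longleftrightarrow> x \<in> {ln (1 + \<tau>1 / (2 * real n)) <..< ln (1 + \<tau>2 / (2 * real n))}" for x
    using assms lt ln_less_cancel_iff[of _ "exp x"] ln_less_cancel_iff[of "exp x"] by auto
  show ?thesis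
  proof (intro equalityI subsetI)
    fix a assume "a \<in> Omega n S \<tau>1 \<tau>2"
    then obtain r z where a: "a = of_real r * z" "z \<in> S" "r \<in> {1 + \<tau>1 / (2 * real n)<..<1 + \<tau>2 / (2 * real n)}"
      unfolding Omega_def by blast
    then have "exp (ln r) = r" using assms(1) by simp
    then show "a \<in> {of_real (exp x) * z | x z. z \<in> S \<and> x \<in> {ln (1 + \<tau>1 / (2 * real n)) <..< ln (1 + \<tau>2 / (2 * real n))}}"
      using a iff[of "ln r"] by (intro CollectI exI[of _ "ln r"] exI[of _ z]) simp
  qed (use iff in \<open>unfold Omega_def, blast\<close>)
qed

context random_zeros
begin

text \<open>Substitution \<open>x = s / (2 * n)\<close>: the Jacobian \<open>1 / (2 * n)\<close>,
  the \<open>n^2\<close> moved into the integrand and the outer \<open>1 / n\<close> turn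
  \<open>1 / (4 * pi)\<close> into \<open>1 / (8 * pi)\<close>.\<close>

lemma expected_zero_count_scaled:
  assumes S: "compact S" "S \<subseteq> unit_circle" "S \<noteq> {}" and n: "0 < n" and \<tau>: "0 < 1 + \<tau>1 / (2 * real n)" "\<tau>1 < \<tau>2"
  shows "1 / real n * expectation (\<lambda>\<omega>. real (zero_count (P n \<omega>) (Omega n S \<tau>1 \<tau>2))) = 1 / (8 * pi) *
     (\<integral>y. indicator {2 * real n * ln (1 + \<tau>1 / (2 * real n)) <..< 2 * real n * ln (1 + \<tau>2 / (2 * real n))} (fst y) * indicator S (snd y) *
        (log_laplace \<phi> n (snd y * exp (of_real (fst y / 2) / of_nat n)) / (real n)\<^sup>2) \<partial>polar_measure)"
proof -
  define \<alpha> where "\<alpha> = ln (1 + \<tau>1 / (2 * real n))"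
  define \<beta> where "\<beta> = ln (1 + \<tau>2 / (2 * real n))"
  have "1 + \<tau>1 / (2 * real n) < 1 + \<tau>2 / (2 * real n)" using n \<tau> by (simp add: divide_strict_right_mono)
  then have ab: "\<alpha> < \<beta>" unfolding \<alpha>_def \<beta>_def using \<tau> by (subst ln_less_cancel_iff) auto
  have [measurable]: "S \<in> sets borel" using compact_imp_closed[OF S(1)] by simp
  define F where "F x z = indicator {\<alpha><..<\<beta>} x * indicator S z * log_laplace \<phi> n (of_real (exp x) * z)" for x :: real and z
  define G where "G s z = indicator {2 * real n * \<alpha><..<2 * real n * \<beta>} s * indicator S z *
      (log_laplace \<phi> n (z * exp (of_real (s / 2) / of_nat n)) / (real n)\<^sup>2)" for s :: real and z
  have Fm[measurable]: "case_prod F \<in> borel_measurable polar_measure" unfolding F_def by measurable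
  have Gm[measurable]: "case_prod G \<in> borel_measurable polar_measure" unfolding G_def by measurable
  have iF: "integrable polar_measure (case_prod F)"
  proof (rule polar_integrable_dominated[OF _ Fm])
    show "continuous_on ({\<alpha>..\<beta>} \<times> unit_circle) (\<lambda>y. log_laplace \<phi> n (of_real (exp (fst y)) * snd y))"
      by (intro continuous_intros continuous_on_log_d[OF kern_positive])
  qed (auto simp: F_def indicator_def)
  have iG: "integrable polar_measure (case_prod G)"
  proof (rule polar_integrable_dominated[OF _ Gm])
    show "continuous_on ({2 * real n * \<alpha>..2 * real n * \<beta>} \<times> unit_circle)
        (\<lambda>y. log_laplace \<phi> n (snd y * exp (of_real (fst y / 2) / of_nat n)) / (real n)\<^sup>2)"
      using n by (intro continuous_intros continuous_on_log_d[OF kern_positive]) auto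
  qed (auto simp: G_def indicator_def)
  have FG: "F (0 + 1 / (2 * real n) * s) z = (real n)\<^sup>2 * G s z" for s z
  proof -
    have "s / (2 * real n) \<in> {\<alpha><..<\<beta>} \<longleftrightarrow> s \<in> {2 * real n * \<alpha><..<2 * real n * \<beta>}"
      using n by (auto simp: field_simps)
    moreover have "of_real (exp (s / (2 * real n))) = exp (of_real (s / 2) / of_nat n :: complex)"
      by (simp add: exp_of_real[symmetric])
    ultimately show ?thesis using n by (auto simp: F_def G_def indicator_def mult.commute)
  qed
  have "(\<integral>x. F x z \<partial>lborel) = real n / 2 * (\<integral>s. G s z \<partial>lborel)" for z
  proof -
    have "(\<integral>x. F x z \<partial>lborel) = \<bar>1 / (2 * real n)\<bar> *\<^sub>R (\<integral>s. F (0 + 1 / (2 * real n) * s) z \<partial>lborel)"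
      using n by (intro lborel_integral_real_affine) simp
    also have "\<dots> = real n / 2 * (\<integral>s. G s z \<partial>lborel)"
      unfolding FG using n by (simp add: power2_eq_square)
    finally show ?thesis .
  qed
  then have "integral\<^sup>L polar_measure (case_prod F) = real n / 2 * integral\<^sup>L polar_measure (case_prod G)"
    unfolding box.integral_snd[OF iF, symmetric] box.integral_snd[OF iG, symmetric]
    by (simp only: integral_mult_right_zero)
  moreover have "expectation (\<lambda>\<omega>. real (zero_count (P n \<omega>) (Omega n S \<tau>1 \<tau>2))) = 1 / (4 * pi) * integral\<^sup>L polar_measure (case_prod F)"
    unfolding Omega_eq_cone[OF \<tau> n] \<alpha>_def[symmetric] \<beta>_def[symmetric] expected_zero_count[OF S ab]
    by (simp add: F_def[abs_def] case_prod_beta')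
  ultimately show ?thesis
    using n by (simp add: G_def[abs_def] \<alpha>_def \<beta>_def case_prod_beta')
qed

end

text \<open>Quotients of rescaled kernel derivatives approach quotients of moments. The first claim
  provides the dominating constant, the second the pointwise limit.\<close>

lemma log_laplace_asymptotics:
  assumes pos: "\<And>n z. 0 < kern \<phi> n z"
    and W: "\<And>z. z \<in> S \<Longrightarrow> (0::real) < W z"
    and as: "\<And>R \<epsilon>. 0 < \<epsilon> \<Longrightarrow> \<forall>\<^sub>F n in sequentially. \<forall>z\<in>S. \<forall>u. cmod u \<le> R \<longrightarrow>
        \<bar>W z * kern \<phi> n (z * exp (u / of_nat n)) / real n - ref_sum n n (Re u) / real n\<bar> \<le> \<epsilon>"
  shows "\<And>R. \<exists>C\<ge>0. \<forall>\<^sub>F n in sequentially. \<forall>z\<in>S. \<forall>s. \<bar>s\<bar> \<le> R \<longrightarrow>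
      \<bar>log_laplace \<phi> n (z * exp (of_real (s / 2) / of_nat n)) / (real n)\<^sup>2\<bar> \<le> C"
    and "\<And>z s. z \<in> S \<Longrightarrow> (\<lambda>n. log_laplace \<phi> n (z * exp (of_real (s / 2) / of_nat n)) / (real n)\<^sup>2) \<longlonglongrightarrow> 4 * H_log_d2 s"
proof -
  define K where "K n z s = W z / real n * kern \<phi> n (z * exp (of_real (s / 2) / of_nat n))" for n z s
  define A where "A e n z s = W z / real n * kern_d1 (e / of_nat n) \<phi> n (z * exp (of_real (s / 2) / of_nat n))" for e n z s
  define B where "B e n z s = W z / real n * kern_d2 (e / of_nat n) \<phi> n (z * exp (of_real (s / 2) / of_nat n))" for e n z s
  have lap: "log_laplace \<phi> n (z * exp (of_real (s / 2) / of_nat n)) / (real n)\<^sup>2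
      = B 1 n z s / K n z s - (A 1 n z s / K n z s)\<^sup>2 + (B \<i> n z s / K n z s - (A \<i> n z s / K n z s)\<^sup>2)"
    if "z \<in> S" "0 < n" for n z s
    unfolding K_def A_def B_def using W[OF that(1)] that(2) by (intro log_laplace_scaled pos) auto
  have cs: "cmod (complex_of_real (s / 2)) \<le> \<bar>s\<bar>" for s by simp
  have ev: "\<forall>\<^sub>F n in sequentially. 0 < n \<and> (\<forall>z\<in>S. \<forall>s. \<bar>s\<bar> \<le> R \<longrightarrow>
      \<bar>K n z s - ref_moment 0 n s\<bar> \<le> \<delta> \<and> \<bar>A 1 n z s - 2 * ref_moment 1 n s\<bar> \<le> \<delta> \<and> \<bar>A \<i> n z s\<bar> \<le> \<delta> \<and>
      \<bar>B 1 n z s - 4 * ref_moment 2 n s\<bar> \<le> \<delta> \<and> \<bar>B \<i> n z s\<bar> \<le> \<delta>)" if \<delta>: "0 < \<delta>" for R \<delta>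
  proof -
    have cmp: "\<forall>\<^sub>F n in sequentially. \<forall>z\<in>S. \<forall>u. cmod u \<le> R \<longrightarrow>
      derivatives_close (W z) \<delta> \<phi> n e z u"
      if "cmod e \<le> 1" for e
      using that \<delta> by (intro kern_derivative_comparison as W)
    have "cmod 1 \<le> 1" "cmod \<i> \<le> 1" by simp_all
    from as[OF \<delta>, of R] cmp[OF this(1)] cmp[OF this(2)] eventually_gt_at_top[of 0] show ?thesis
    proof eventually_elim
      case (elim n)
      have n: "0 < n" by (rule elim(4))
      note pr = powers_reference[OF n]
      show ?case
      proof (intro conjI ballI allI impI)
        show "0 < n" by (rule n)
        fix z s assume z: "z \<in> S" and s: "\<bar>s\<bar> \<le> R"
        have u: "cmod (complex_of_real (s / 2)) \<le> R" using cs s by (rule order.trans)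
        have "\<bar>W z * kern \<phi> n (z * exp (of_real (s / 2) / of_nat n)) / real n - ref_sum n n (Re (of_real (s / 2))) / real n\<bar> \<le> \<delta>"
          using elim(1) z u by blast
        then show "\<bar>K n z s - ref_moment 0 n s\<bar> \<le> \<delta>" by (simp add: K_def pr(5)[symmetric])
        have e1: "derivatives_close (W z) \<delta> \<phi> n 1 z (of_real (s / 2))"
          using elim(2) z u by blast
        have e2: "derivatives_close (W z) \<delta> \<phi> n \<i> z (of_real (s / 2))"
          using elim(3) z u by blast
        show "\<bar>A 1 n z s - 2 * ref_moment 1 n s\<bar> \<le> \<delta>" "\<bar>B 1 n z s - 4 * ref_moment 2 n s\<bar> \<le> \<delta>"
          using e1 unfolding derivatives_close_def A_def B_def pr by blast+
        show "\<bar>A \<i> n z s\<bar> \<le> \<delta>" "\<bar>B \<i> n z s\<bar> \<le> \<delta>"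
          using e2 unfolding derivatives_close_def A_def B_def pr diff_0_right by blast+
      qed
    qed
  qed
  show "\<exists>C\<ge>0. \<forall>\<^sub>F n in sequentially. \<forall>z\<in>S. \<forall>s. \<bar>s\<bar> \<le> R \<longrightarrow>
      \<bar>log_laplace \<phi> n (z * exp (of_real (s / 2) / of_nat n)) / (real n)\<^sup>2\<bar> \<le> C" for R
  proof -
    \<comment> \<open>Half of the lower bound \<open>exp (- R)\<close> for
      \<open>ref_moment 0\<close>, so that \<open>K\<close> stays above the other half.\<close>
    define \<kappa> where "\<kappa> = exp (- R) / 2"
    have \<kappa>: "0 < \<kappa>" by (simp add: \<kappa>_def)
    \<comment> \<open>The largest model term is \<open>4 * ref_moment 2\<close>, which is at most
      \<open>8 * exp R\<close>.\<close>
    define D where "D = 8 * exp R + \<kappa>"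
    have D: "0 \<le> D" using \<kappa> by (simp add: D_def)
    show ?thesis
    proof (intro exI[of _ "2 * (D / \<kappa>) + 2 * (D / \<kappa>)\<^sup>2"] conjI)
      show "0 \<le> 2 * (D / \<kappa>) + 2 * (D / \<kappa>)\<^sup>2" using D \<kappa> by simp
      show "\<forall>\<^sub>F n in sequentially. \<forall>z\<in>S. \<forall>s. \<bar>s\<bar> \<le> R \<longrightarrow>
        \<bar>log_laplace \<phi> n (z * exp (of_real (s / 2) / of_nat n)) / (real n)\<^sup>2\<bar> \<le> 2 * (D / \<kappa>) + 2 * (D / \<kappa>)\<^sup>2"
        using ev[OF \<kappa>, of R]
      proof eventually_elim
        case (elim n)
        have n: "0 < n" using elim by blast
        show ?case
        proof (intro ballI allI impI)
          fix z s assume z: "z \<in> S" and s: "\<bar>s\<bar> \<le> R"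
          have b: "\<bar>K n z s - ref_moment 0 n s\<bar> \<le> \<kappa>" "\<bar>A 1 n z s - 2 * ref_moment 1 n s\<bar> \<le> \<kappa>" "\<bar>A \<i> n z s\<bar> \<le> \<kappa>"
            "\<bar>B 1 n z s - 4 * ref_moment 2 n s\<bar> \<le> \<kappa>" "\<bar>B \<i> n z s\<bar> \<le> \<kappa>" using elim z s by blast+
          note rm = ref_moment_bounds[OF n s]
          have K: "\<kappa> \<le> K n z s" using b(1) rm(3) unfolding \<kappa>_def by linarith
          have q: "\<bar>x / K n z s\<bar> \<le> D / \<kappa>" if "\<bar>x\<bar> \<le> D" for x
            unfolding abs_divide using K \<kappa> that D by (intro frac_le) auto
          have "0 \<le> exp R" by simp
          then have x: "\<bar>A 1 n z s\<bar> \<le> D" "\<bar>A \<i> n z s\<bar> \<le> D" "\<bar>B 1 n z s\<bar> \<le> D" "\<bar>B \<i> n z s\<bar> \<le> D"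
            using b rm(1)[of 1] rm(2)[of 1] rm(1)[of 2] rm(2)[of 2] unfolding D_def by linarith+
          have sq: "(y::real)\<^sup>2 \<le> (D / \<kappa>)\<^sup>2" if "\<bar>y\<bar> \<le> D / \<kappa>" for y
            using that by (metis abs_ge_zero power2_abs power_mono)
          show "\<bar>log_laplace \<phi> n (z * exp (of_real (s / 2) / of_nat n)) / (real n)\<^sup>2\<bar> \<le> 2 * (D / \<kappa>) + 2 * (D / \<kappa>)\<^sup>2"
            unfolding lap[OF z n]
            using q[OF x(3)] q[OF x(4)] sq[OF q[OF x(1)]] sq[OF q[OF x(2)]]
              zero_le_power2[of "A 1 n z s / K n z s"] zero_le_power2[of "A \<i> n z s / K n z s"] by linarith
        qed
      qed
    qed
  qed
  fix z s assume z: "z \<in> S"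
  have lim0: "X \<longlonglongrightarrow> 0" if "\<And>\<delta>. 0 < \<delta> \<Longrightarrow> \<forall>\<^sub>F n in sequentially. \<bar>X n\<bar> \<le> \<delta>" for X :: "nat \<Rightarrow> real"
    unfolding tendsto_iff dist_real_def
  proof (intro allI impI)
    fix e :: real assume "0 < e"
    then have "\<forall>\<^sub>F n in sequentially. \<bar>X n\<bar> \<le> e / 2" by (intro that) simp
    then show "\<forall>\<^sub>F n in sequentially. \<bar>X n - 0\<bar> < e" by eventually_elim (use \<open>0 < e\<close> in auto)
  qed
  have ev': "\<forall>\<^sub>F n in sequentially.
      \<bar>K n z s - ref_moment 0 n s\<bar> \<le> \<delta> \<and> \<bar>A 1 n z s - 2 * ref_moment 1 n s\<bar> \<le> \<delta> \<and> \<bar>A \<i> n z s\<bar> \<le> \<delta> \<and>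
      \<bar>B 1 n z s - 4 * ref_moment 2 n s\<bar> \<le> \<delta> \<and> \<bar>B \<i> n z s\<bar> \<le> \<delta>" if "0 < \<delta>" for \<delta>
    using ev[OF that, of "\<bar>s\<bar>"] by eventually_elim (use z in blast)
  have l: "(\<lambda>n. K n z s - ref_moment 0 n s) \<longlonglongrightarrow> 0" "(\<lambda>n. A 1 n z s - 2 * ref_moment 1 n s) \<longlonglongrightarrow> 0"
    "(\<lambda>n. B 1 n z s - 4 * ref_moment 2 n s) \<longlonglongrightarrow> 0"
    and 0: "(\<lambda>n. A \<i> n z s) \<longlonglongrightarrow> 0" "(\<lambda>n. B \<i> n z s) \<longlonglongrightarrow> 0"
    by (rule lim0, drule ev', erule eventually_mono, blast)+
  have 1: "(\<lambda>n. K n z s) \<longlonglongrightarrow> H s" "(\<lambda>n. A 1 n z s) \<longlonglongrightarrow> 2 * exp_moment 1 s" "(\<lambda>n. B 1 n z s) \<longlonglongrightarrow> 4 * exp_moment 2 s"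
    using tendsto_add[OF l(1) ref_moment_tendsto[of 0 s]] tendsto_add[OF l(2) tendsto_mult_left[OF ref_moment_tendsto[of 1 s], of 2]]
      tendsto_add[OF l(3) tendsto_mult_left[OF ref_moment_tendsto[of 2 s], of 4]]
    by (simp_all add: H_eq_exp_moment)
  have Hn: "H s \<noteq> 0" using H_pos[of s] by simp
  have "(\<lambda>n. B 1 n z s / K n z s - (A 1 n z s / K n z s)\<^sup>2 + (B \<i> n z s / K n z s - (A \<i> n z s / K n z s)\<^sup>2)) \<longlonglongrightarrow>
     4 * exp_moment 2 s / H s - (2 * exp_moment 1 s / H s)\<^sup>2 + (0 / H s - (0 / H s)\<^sup>2)"
    by (intro tendsto_intros 0 1 Hn)
  also have "4 * exp_moment 2 s / H s - (2 * exp_moment 1 s / H s)\<^sup>2 + (0 / H s - (0 / H s)\<^sup>2) = 4 * H_log_d2 s"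
    by (simp add: H_log_d2_def power_mult_distrib power_divide)
  finally show "(\<lambda>n. log_laplace \<phi> n (z * exp (of_real (s / 2) / of_nat n)) / (real n)\<^sup>2) \<longlonglongrightarrow> 4 * H_log_d2 s"
    by (rule Lim_transform_eventually) (use eventually_gt_at_top[of 0] in eventually_elim, simp only: lap[OF z])
qed

theorem theorem3:
  fixes M :: "'w measure"
    and \<eta> :: "nat \<Rightarrow> 'w \<Rightarrow> complex"
    and \<mu> :: "complex measure"
    and \<phi> :: "nat \<Rightarrow> complex poly"
    and \<alpha> :: "nat \<Rightarrow> complex"
    and S :: "complex set"
    and \<tau>1 \<tau>2 :: real
  assumes "prob_space M"
    and "iid_complex_std_gaussian M \<eta>"
    and "circle_prob_measure \<mu>"
    and "opuc \<mu> \<phi>"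
    and "recurrence_coeffs \<phi> \<alpha>"
    and "range \<alpha> \<subseteq> complex_of_real ` {-1<..<1}"
    and "\<alpha> \<longlonglongrightarrow> 0"
    and "compact S"
    and "S \<subseteq> unit_circle - {1, -1}"
    and "ac_pos_cont_density_on \<mu> S"
    and "\<tau>1 < \<tau>2"
  shows "(\<lambda>n. 1 / real n *
            prob_space.expectation M
              (\<lambda>\<omega>. real (zero_count (random_poly \<eta> \<phi> n \<omega>) (Omega n S \<tau>1 \<tau>2))))
         \<longlonglongrightarrow> measure arclength S / (2 * pi) * (deriv H \<tau>2 / H \<tau>2 - deriv H \<tau>1 / H \<tau>1)"
proof (cases "S = {}")
  \<comment> \<open>Separate because \<open>cone_indicator\<close> measures the distance to
    \<open>S\<close> and calls for a nonempty set.\<close>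
  case True
  then show ?thesis by (simp add: Omega_def zero_count_def)
next
  case False
  have S: "S \<subseteq> unit_circle" using assms(9) by blast
  have [measurable]: "S \<in> sets borel" using compact_imp_closed[OF assms(8)] by simp
  have sys: "circle_system \<mu> \<phi>" by (rule circle_system_opuc[OF assms(3,4)])
  interpret random_zeros M \<eta> \<mu> \<phi>
    using assms(1,2) sys by (intro random_zeros.intro random_zeros_axioms.intro)
  obtain W where W: "\<And>z. z \<in> S \<Longrightarrow> 0 < W z"
    and as: "\<And>R \<epsilon>. 0 < \<epsilon> \<Longrightarrow> \<forall>\<^sub>F n in sequentially. \<forall>z\<in>S. \<forall>u. cmod u \<le> R \<longrightarrow>
        \<bar>W z * kern \<phi> n (z * exp (u / of_nat n)) / real n - ref_sum n n (Re u) / real n\<bar> \<le> \<epsilon>"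
    by (rule kern_asymptotics[OF assms(3,4,5,7,8) S assms(10)]) (rule that, assumption+)
  have lap_bd: "\<exists>C\<ge>0. \<forall>\<^sub>F n in sequentially. \<forall>z\<in>S. \<forall>s. \<bar>s\<bar> \<le> R \<longrightarrow>
      \<bar>log_laplace \<phi> n (z * exp (of_real (s / 2) / of_nat n)) / (real n)\<^sup>2\<bar> \<le> C" for R
    by (rule log_laplace_asymptotics(1)[OF kern_positive W as])
  have lap_lim: "(\<lambda>n. log_laplace \<phi> n (z * exp (of_real (s / 2) / of_nat n)) / (real n)\<^sup>2) \<longlonglongrightarrow> 4 * H_log_d2 s"
    if "z \<in> S" for z s
    by (rule log_laplace_asymptotics(2)[OF kern_positive W as that])
  let ?a = "\<lambda>n. 2 * real n * ln (1 + \<tau>1 / (2 * real n))" and ?b = "\<lambda>n. 2 * real n * ln (1 + \<tau>2 / (2 * real n))"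
  let ?lap = "\<lambda>n y. log_laplace \<phi> n (snd y * exp (of_real (fst y / 2) / of_nat n)) / (real n)\<^sup>2"
  let ?G = "\<lambda>n y. indicator {?a n<..<?b n} (fst y) * indicator S (snd y) * ?lap n y"
  let ?L = "\<lambda>y. indicator {\<tau>1<..<\<tau>2} (fst y) * indicator S (snd y) * (4 * H_log_d2 (fst y))"
  \<comment> \<open>Large enough for both moving edges to lie eventually in
    \<open>(-R, R)\<close>.\<close>
  define R where "R = \<bar>\<tau>1\<bar> + \<bar>\<tau>2\<bar> + 1"
  obtain C where C: "0 \<le> C" "\<forall>\<^sub>F n in sequentially. \<forall>z\<in>S. \<forall>s. \<bar>s\<bar> \<le> R \<longrightarrow>
      \<bar>log_laplace \<phi> n (z * exp (of_real (s / 2) / of_nat n)) / (real n)\<^sup>2\<bar> \<le> C"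
    using lap_bd[of R] by blast
  have a_lim: "?a \<longlonglongrightarrow> \<tau>1" and b_lim: "?b \<longlonglongrightarrow> \<tau>2" by (rule scaled_ln_tendsto)+
  have "\<forall>\<^sub>F n in sequentially. - R < ?a n" "\<forall>\<^sub>F n in sequentially. ?b n < R"
    by (rule order_tendstoD[OF a_lim] order_tendstoD[OF b_lim], simp add: R_def)+
  moreover have "(\<lambda>n. 1 + \<tau>1 / (2 * real n)) \<longlonglongrightarrow> 1" by real_asymp
  then have "\<forall>\<^sub>F n in sequentially. 0 < 1 + \<tau>1 / (2 * real n)" by (rule order_tendstoD) simp
  ultimately have "\<forall>\<^sub>F n in sequentially. - R < ?a n \<and> ?b n < R \<and> 0 < 1 + \<tau>1 / (2 * real n) \<and> 0 < n \<and>
      (\<forall>z\<in>S. \<forall>s. \<bar>s\<bar> \<le> R \<longrightarrow> \<bar>log_laplace \<phi> n (z * exp (of_real (s / 2) / of_nat n)) / (real n)\<^sup>2\<bar> \<le> C)"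
    using C(2) eventually_gt_at_top[of 0] by eventually_elim blast
  then obtain N where N: "\<And>n. n \<ge> N \<Longrightarrow> - R < ?a n \<and> ?b n < R \<and> 0 < 1 + \<tau>1 / (2 * real n) \<and> 0 < n \<and>
      (\<forall>z\<in>S. \<forall>s. \<bar>s\<bar> \<le> R \<longrightarrow> \<bar>log_laplace \<phi> n (z * exp (of_real (s / 2) / of_nat n)) / (real n)\<^sup>2\<bar> \<le> C)"
    unfolding eventually_sequentially by blast
  have Hm[measurable]: "H_log_d2 \<in> borel_measurable borel"
    by (rule borel_measurable_continuous_onI[OF H_log_d2_continuous])
  \<comment> \<open>At \<open>\<tau>1\<close> and \<open>\<tau>2\<close> themselves the indicators
    of the moving intervals need not converge; those points form a null set.\<close>
  have pw: "(\<lambda>n. ?G n y) \<longlonglongrightarrow> ?L y" if "fst y \<noteq> \<tau>1" "fst y \<noteq> \<tau>2" for y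
  proof (cases "snd y \<in> S")
    case True
    have "\<forall>\<^sub>F n in sequentially. (fst y \<in> {?a n<..<?b n}) = (fst y \<in> {\<tau>1<..<\<tau>2})"
    proof -
      have "\<forall>\<^sub>F n in sequentially. (?a n < fst y) = (\<tau>1 < fst y)"
      proof (cases "\<tau>1 < fst y")
        case True
        then show ?thesis using order_tendstoD(2)[OF a_lim True] by (auto elim: eventually_mono)
      next
        case False
        then have "fst y < \<tau>1" using that by simp
        from order_tendstoD(1)[OF a_lim this] show ?thesis by eventually_elim (use False in auto)
      qed
      moreover have "\<forall>\<^sub>F n in sequentially. (fst y < ?b n) = (fst y < \<tau>2)"
      proof (cases "fst y < \<tau>2")
        case True
        then show ?thesis using order_tendstoD(1)[OF b_lim True] by (auto elim: eventually_mono)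
      next
        case False
        then have "\<tau>2 < fst y" using that by simp
        from order_tendstoD(2)[OF b_lim this] show ?thesis by eventually_elim (use False in auto)
      qed
      ultimately show ?thesis by eventually_elim simp
    qed
    then have "\<forall>\<^sub>F n in sequentially. indicator {\<tau>1<..<\<tau>2} (fst y) = (indicator {?a n<..<?b n} (fst y) :: real)"
      by eventually_elim (simp add: indicator_def)
    then have "(\<lambda>n. indicator {?a n<..<?b n} (fst y) :: real) \<longlonglongrightarrow> indicator {\<tau>1<..<\<tau>2} (fst y)"
      by (rule Lim_transform_eventually[OF tendsto_const])
    then show ?thesis
      using lap_lim[OF True, of "fst y"] by (intro tendsto_mult tendsto_const)
  next
    case False then show ?thesis by simp
  qed
  have AE_ne: "AE y in polar_measure. fst y \<noteq> \<tau>1 \<and> fst y \<noteq> \<tau>2"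
  proof (rule box.AE_pair_measure)
    show "{x \<in> space polar_measure. fst x \<noteq> \<tau>1 \<and> fst x \<noteq> \<tau>2} \<in> sets polar_measure" by measurable
    show "AE x in lborel. AE z in arclength. fst (x, z) \<noteq> \<tau>1 \<and> fst (x, z) \<noteq> \<tau>2"
      using AE_lborel_singleton[of \<tau>1] AE_lborel_singleton[of \<tau>2] by eventually_elim simp
  qed
  have dom: "integrable polar_measure (\<lambda>y. C * indicator {-R..R} (fst y))"
    by (rule polar_integrable_bounded[of _ C "-R" R]) (use C(1) in auto)
  have lap_meas[measurable]: "?lap n \<in> borel_measurable polar_measure" for n by measurable
  \<comment> \<open>The bounds are available from \<open>N\<close> on only, whereas dominated
    convergence asks for every index; hence the shift.\<close>
  have "(\<lambda>n. \<integral>y. ?G (n + N) y \<partial>polar_measure) \<longlonglongrightarrow> (\<integral>y. ?L y \<partial>polar_measure)"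
  proof (rule integral_dominated_convergence[OF _ _ dom])
    show "?L \<in> borel_measurable polar_measure" by measurable
    show "?G (n + N) \<in> borel_measurable polar_measure" for n by measurable
    show "AE y in polar_measure. (\<lambda>n. ?G (n + N) y) \<longlonglongrightarrow> ?L y"
      using AE_ne
    proof eventually_elim
      case (elim y)
      then have "(\<lambda>n. ?G n y) \<longlonglongrightarrow> ?L y" by (intro pw) auto
      then show ?case by (rule LIMSEQ_ignore_initial_segment)
    qed
    show "AE y in polar_measure. norm (?G (n + N) y) \<le> C * indicator {-R..R} (fst y)" for n
    proof (rule AE_I2)
      fix y
      show "norm (?G (n + N) y) \<le> C * indicator {-R..R} (fst y)"
      proof (cases "fst y \<in> {?a (n + N)<..<?b (n + N)} \<and> snd y \<in> S")
        case True
        have NN: "- R < ?a (n + N)" "?b (n + N) < R" using N[of "n + N"] by auto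
        have "?a (n + N) < fst y" "fst y < ?b (n + N)" using True by auto
        then have r: "\<bar>fst y\<bar> \<le> R" using NN by linarith
        have "\<bar>?lap (n + N) y\<bar> \<le> C"
          by (rule N[of "n + N", THEN conjunct2, THEN conjunct2, THEN conjunct2, THEN conjunct2, rule_format,
                OF le_add2 conjunct2[OF True] r])
        moreover have "fst y \<in> {-R..R}" using r by auto
        ultimately show ?thesis using True by simp
      next
        case False
        then show ?thesis using C(1) by (auto simp: indicator_def)
      qed
    qed
  qed
  then have "(\<lambda>n. 1 / (8 * pi) * (\<integral>y. ?G (n + N) y \<partial>polar_measure)) \<longlonglongrightarrow> 1 / (8 * pi) * (\<integral>y. ?L y \<partial>polar_measure)"
    by (rule tendsto_mult_left)
  moreover have eq: "1 / (8 * pi) * (\<integral>y. ?G (n + N) y \<partial>polar_measure) = 1 / real (n + N) *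
        expectation (\<lambda>\<omega>. real (zero_count (random_poly \<eta> \<phi> (n + N) \<omega>) (Omega (n + N) S \<tau>1 \<tau>2)))" for n
    by (rule expected_zero_count_scaled[OF assms(8) S False _ _ assms(11), symmetric]) (use N[of "n + N"] in auto)
  ultimately have "(\<lambda>n. 1 / real (n + N) * expectation (\<lambda>\<omega>. real (zero_count (random_poly \<eta> \<phi> (n + N) \<omega>) (Omega (n + N) S \<tau>1 \<tau>2))))
      \<longlonglongrightarrow> 1 / (8 * pi) * (\<integral>y. ?L y \<partial>polar_measure)"
    by (simp only:)
  then have lim: "(\<lambda>n. 1 / real n * expectation (\<lambda>\<omega>. real (zero_count (random_poly \<eta> \<phi> n \<omega>) (Omega n S \<tau>1 \<tau>2))))
      \<longlonglongrightarrow> 1 / (8 * pi) * (\<integral>y. ?L y \<partial>polar_measure)"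
    by (rule LIMSEQ_offset)
  have "(H_log_d2 has_integral deriv H \<tau>2 / H \<tau>2 - deriv H \<tau>1 / H \<tau>1) {\<tau>1..\<tau>2}"
    using assms(11) H_log_derivative
    by (intro fundamental_theorem_of_calculus)
       (auto intro: DERIV_subset[OF H_log_derivative] simp flip: has_real_derivative_iff_has_vector_derivative)
  from lborel_integral_of_has_integral(2)[OF this H_log_d2_continuous]
  have "(\<integral>x. indicator {\<tau>1..\<tau>2} x * H_log_d2 x \<partial>lborel) = deriv H \<tau>2 / H \<tau>2 - deriv H \<tau>1 / H \<tau>1" .
  also have "(\<integral>x. indicator {\<tau>1..\<tau>2} x * H_log_d2 x \<partial>lborel) = (\<integral>x. indicator {\<tau>1<..<\<tau>2} x * H_log_d2 x \<partial>lborel)"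
  proof (rule integral_cong_AE)
    show "AE x in lborel. indicator {\<tau>1..\<tau>2} x * H_log_d2 x = indicator {\<tau>1<..<\<tau>2} x * H_log_d2 x"
      using AE_lborel_singleton[of \<tau>1] AE_lborel_singleton[of \<tau>2] by eventually_elim (auto simp: indicator_def)
  qed measurable
  finally have I: "(\<integral>x. indicator {\<tau>1<..<\<tau>2} x * H_log_d2 x \<partial>lborel) = deriv H \<tau>2 / H \<tau>2 - deriv H \<tau>1 / H \<tau>1" .
  have G0: "integrable polar_measure ?L"
  proof (rule polar_integrable_dominated)
    show "continuous_on ({\<tau>1..\<tau>2} \<times> unit_circle) (\<lambda>y. 4 * H_log_d2 (fst y))"
      by (intro continuous_intros continuous_on_compose2[OF H_log_d2_continuous[of UNIV]]) auto
    show "?L \<in> borel_measurable polar_measure" by measurable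
  qed (auto simp: indicator_def)
  have "(\<integral>y. ?L y \<partial>polar_measure) = (\<integral>x. (\<integral>z. ?L (x, z) \<partial>arclength) \<partial>lborel)"
    by (rule box.integral_fst'[OF G0, symmetric])
  also have "\<dots> = (\<integral>x. 4 * measure arclength S * (indicator {\<tau>1<..<\<tau>2} x * H_log_d2 x) \<partial>lborel)"
  proof (intro Bochner_Integration.integral_cong refl)
    fix x :: real
    have "(\<integral>z. ?L (x, z) \<partial>arclength) = (\<integral>z. (4 * indicator {\<tau>1<..<\<tau>2} x * H_log_d2 x) * indicator S z \<partial>arclength)"
      by (intro Bochner_Integration.integral_cong refl) (simp add: mult_ac)
    also have "\<dots> = 4 * measure arclength S * (indicator {\<tau>1<..<\<tau>2} x * H_log_d2 x)"
      by simp
    finally show "(\<integral>z. ?L (x, z) \<partial>arclength) = 4 * measure arclength S * (indicator {\<tau>1<..<\<tau>2} x * H_log_d2 x)" .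
  qed
  also have "\<dots> = 4 * measure arclength S * (deriv H \<tau>2 / H \<tau>2 - deriv H \<tau>1 / H \<tau>1)"
    by (simp only: integral_mult_right_zero I)
  finally have L: "(\<integral>y. ?L y \<partial>polar_measure) = 4 * measure arclength S * (deriv H \<tau>2 / H \<tau>2 - deriv H \<tau>1 / H \<tau>1)" .
  \<comment> \<open>The \<open>4\<close> of \<open>4 * H_log_d2\<close> turns
    \<open>1 / (8 * pi)\<close> into the factor \<open>1 / (2 * pi)\<close> of the claim.\<close>
  have "1 / (8 * pi) * (4 * m * d) = m / (2 * pi) * d" for m d :: real by simp
  then show ?thesis using lim unfolding L by (simp only:)
qed

end
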